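(* Let $\gamma>0$ be irrational, let $b>0$, and let $V(x)=x^\gamma W(x)$ be a potential on $[0,b]$ satisfying the assumptions listed in the context, with $E\in K$ where $E-V\ge\delta_0>0$ on $[0,b]$. Set $$\sigma_E=\int_0^b\sqrt{E-V(y)}\,dy,\qquad D_h=\begin{pmatrix}\cos\frac{\sigma_E}{h} & -\sin\frac{\sigma_E}{h}\\ \sin\frac{\sigma_E}{h} & \cos\frac{\sigma_E}{h}\end{pmatrix}.$$ Then there exist $2\times2$ matrices $\mathbb{A}^{+}_h(E)$ and $\mathbb{A}^-_h(E)$ (depending on $h$, $E$, $V$, but not on the solution $\phi$ below), each admitting as $h\to0^+$ an asymptotic expansion with exponent set $\{m\gamma+n:\ m\ge0,\ n\ge0\ \text{integers}\}\setminus\{0\}$, such that for all sufficiently small $h>0$ and every solution $\phi$ on $[0,b]$ of $-h^2\phi''+V\phi=E\phi$, $$\begin{pmatrix}E^{1/4}\phi(0)\\ E^{-1/4}h\phi'(0)\end{pmatrix}=\Big(D_h+\cos\big(\tfrac{\sigma_E}{h}\big)\,\mathbb{A}^+_h(E)+\sin\big(\tfrac{\sigma_E}{h}\big)\,\mathbb{A}^-_h(E)\Big)\begin{pmatrix}(E-V(b))^{1/4}\phi(b)\\ (E-V(b))^{-1/4}h\phi'(b)\end{pmatrix}.$$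
   Context: Assumptions on $V$: $V$ is continuous on $[0,b]$, smooth and increasing on $(0,b]$, $V(0)=0$, and $V(x)=x^\gamma W(x)$ for $x>0$ with $W$ smooth and $W>0$ on $[0,b]$. $K\subset(0,\infty)$ is a compact interval of energies, and there is $\delta_0>0$ with $E-V(x)\ge\delta_0$ for all $E\in K$, $x\in[0,b]$. Asymptotic expansion in $h$ with exponent set $\mathcal{A}$ (a locally finite subset of $\mathbb{R}$ bounded below): $F_h$ admits such an expansion if there are coefficients $(a_\alpha)_{\alpha\in\mathcal{A}}$ (matrices if $F_h$ is matrix valued, independent of $h$, possibly zero) such that for every $N\ge 0$ there is $C_N$ with $\big|F_h-\sum_{\alpha\in\mathcal{A},\,\alpha<N}a_\alpha h^\alpha\big|\le C_N h^N$ for all sufficiently small $h>0$. *)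

theory Defs
  imports "HOL-Analysis.Analysis"
begin

(* Used for nondegenerate intervals S only; derivatives at an endpoint belonging to S
   are one-sided. The family g consists of the successive derivatives of f on S. *)
definition smooth_on :: "real set \<Rightarrow> (real \<Rightarrow> real) \<Rightarrow> bool" where
  "smooth_on S f \<longleftrightarrow>
     (\<exists>g :: nat \<Rightarrow> real \<Rightarrow> real. (\<forall>x\<in>S. g 0 x = f x) \<and>
        (\<forall>n. \<forall>x\<in>S. (g n has_real_derivative g (Suc n) x) (at x within S)))"

(* Bounded below and locally finite (a set of reals is locally finite iff it meets every
   compact interval in a finite set); this makes the truncated sums below finite. *)
definition exponent_set :: "real set \<Rightarrow> bool" where
  "exponent_set A \<longleftrightarrow> bdd_below A \<and> (\<forall>x y. finite (A \<inter> {x..y}))"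

(* The range of h on which the N-th estimate holds may depend on N. *)
definition asymp_expansion :: "real set \<Rightarrow> (real \<Rightarrow> 'a::real_normed_vector) \<Rightarrow> bool" where
  "asymp_expansion A F \<longleftrightarrow> exponent_set A \<and>
     (\<exists>a :: real \<Rightarrow> 'a. \<forall>N\<ge>0. \<exists>C. \<forall>\<^sub>F h in at_right 0.
        norm (F h - (\<Sum>\<alpha>\<in>{\<alpha>\<in>A. \<alpha> < N}. (h powr \<alpha>) *\<^sub>R a \<alpha>)) \<le> C * h powr N)"

definition exponents :: "real \<Rightarrow> real set" where
  "exponents \<gamma> = {real m * \<gamma> + real n | m n. True} - {0}"

lemma exponent_set_exponents:
  assumes "\<gamma> > 0"
  shows "exponent_set (exponents \<gamma>)"
  unfolding exponent_set_def
proof (intro conjI allI)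
  have "0 \<le> x" if "x \<in> exponents \<gamma>" for x
    using that assms by (auto simp: exponents_def)
  then show "bdd_below (exponents \<gamma>)"
    by (rule bdd_belowI)
next
  fix x y :: real
  have "exponents \<gamma> \<inter> {x..y}
      \<subseteq> (\<lambda>(m, n). real m * \<gamma> + real n) ` ({..nat \<lceil>y / \<gamma>\<rceil>} \<times> {..nat \<lceil>y\<rceil>})"
  proof
    fix z assume "z \<in> exponents \<gamma> \<inter> {x..y}"
    then obtain m n :: nat where z: "z = real m * \<gamma> + real n" and "z \<le> y"
      by (auto simp: exponents_def)
    have "0 \<le> real m * \<gamma>"
      using assms by simp
    then have "real n \<le> y" "real m * \<gamma> \<le> y"
      using z \<open>z \<le> y\<close> by linarith+
    then have "real n \<le> y" "real m \<le> y / \<gamma>"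
      using assms by (simp_all add: field_simps)
    then have "n \<le> nat \<lceil>y\<rceil>" "m \<le> nat \<lceil>y / \<gamma>\<rceil>"
      by linarith+
    then show "z \<in> (\<lambda>(m, n). real m * \<gamma> + real n) ` ({..nat \<lceil>y / \<gamma>\<rceil>} \<times> {..nat \<lceil>y\<rceil>})"
      using z by force
  qed
  then show "finite (exponents \<gamma> \<inter> {x..y})"
    by (rule finite_subset) simp
qed

(* \<phi> solves the equation classically on [0,b], with derivative d\<phi> (one-sided at 0 and b). *)
definition schrodinger_solution ::
  "(real \<Rightarrow> real) \<Rightarrow> real \<Rightarrow> real \<Rightarrow> real \<Rightarrow> (real \<Rightarrow> complex) \<Rightarrow> (real \<Rightarrow> complex) \<Rightarrow> bool" where
  "schrodinger_solution V b E h \<phi> d\<phi> \<longleftrightarrow>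
     (\<exists>dd\<phi>. \<forall>x\<in>{0..b}.
        (\<phi> has_vector_derivative d\<phi> x) (at x within {0..b}) \<and>
        (d\<phi> has_vector_derivative dd\<phi> x) (at x within {0..b}) \<and>
        - (of_real (h^2) * dd\<phi> x) + of_real (V x) * \<phi> x = of_real E * \<phi> x)"

definition action :: "(real \<Rightarrow> real) \<Rightarrow> real \<Rightarrow> real \<Rightarrow> real" where
  "action V b E = integral {0..b} (\<lambda>y. sqrt (E - V y))"

definition propagation_rotation :: "real \<Rightarrow> complex^2^2" where
  "propagation_rotation \<theta> = vector [vector [of_real (cos \<theta>), of_real (- sin \<theta>)],
                                    vector [of_real (sin \<theta>), of_real (cos \<theta>)]]"

(* u and du are values of a solution and of its derivative; p is the value of E - V there. *)
definition scaled_data :: "real \<Rightarrow> real \<Rightarrow> complex \<Rightarrow> complex \<Rightarrow> complex^2" where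
  "scaled_data p h u du =
     vector [of_real (p powr (1/4)) * u, of_real (p powr (- 1/4) * h) * du]"

end

theory Submission
  imports Defs
begin

text \<open>
  With \<open>p = sqrt (E - V)\<close>, \<open>S(x) = \<integral>\<^sub>0\<^sup>x p\<close>, \<open>q = p' / (2 p)\<close> and the waves
  \<open>z\<^sub>\<plusminus> = p\<^sup>1\<^sup>/\<^sup>2 \<phi> \<plusminus> i p\<^sup>-\<^sup>1\<^sup>/\<^sup>2 h \<phi>'\<close>, the functions \<open>u = exp(i S / h) z\<^sub>+\<close> and
  \<open>v = exp(- i S / h) z\<^sub>-\<close> satisfy \<open>u' = q exp(2 i S / h) v\<close>, \<open>v' = q exp(- 2 i S / h) u\<close>.
  Two successive integrations against \<open>q exp(\<plusminus> 2 i S / h)\<close> gain a positive power of \<open>h\<close>, so the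
  Dyson series converges for small \<open>h\<close>, and finitely many of its terms determine the solution up
  to \<open>O(h\<^sup>M)\<close>.

  In the variable \<open>s = S(x)\<close>, the density \<open>q / p\<close> is a sum of homogeneous terms
  \<open>s\<^sup>j\<^sup>\<gamma>\<^sup>+\<^sup>l\<^sup>-\<^sup>1\<close> with \<open>j \<ge> 1\<close> plus a remainder that is flat at \<open>0\<close> to any prescribed order.
  An iterated integral of homogeneous terms has the form \<open>h\<^sup>m\<^sup>\<gamma>\<^sup>+\<^sup>n g(s / h)\<close>, where \<open>g\<close> expands at
  infinity into powers, with and without the factor \<open>exp(\<plusminus> 2 i t)\<close>. As \<open>\<gamma>\<close> is irrational,
  the exponent \<open>-1\<close> never occurs in a nonoscillating integrand, so there are no logarithms.
  Flat terms do not feel the endpoint \<open>0\<close>: there \<open>g\<close> may be replaced by its expansion,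
  and integration by parts applies. At \<open>x = b\<close> this yields \<open>A(h) + exp(\<plusminus> 2 i \<sigma> / h) B(h)\<close>.
\<close>

section \<open>Functions flat at the origin\<close>

text \<open>The obstacle is the endpoint 0, where q may be as large as x^(\<gamma> - 1): repeated
  integration by parts fails there, and this is the source of noninteger powers of h. In the
  variable s the phase is exactly linear, so integrals of homogeneous densities scale exactly under
  s = h t; hence the density has to be expanded in powers of s and not of x. Integrating by parts,
  or replacing g by its expansion, costs flatness and derivatives. Approximation statements are
  therefore quantified over a flatness order N, a number k of derivatives and an error order M, so
  that the price can be paid in advance. The signs of the phases alternate along the iteration. A
  new kernel thus cancels exactly the oscillating part of the previous integral, and only there
  could the exponent -1 do harm. For each M this gives coefficients up to order M only, whereas
  single matrices are wanted. The coefficients of different orders must therefore be shown to agree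
  and must then be summed. With t = \<sigma> / h, all phases at b combine to exp(i t) and exp(- i
  t), whose real and imaginary parts yield the cosine and sine blocks; both matrices have real
  entries.\<close>

inductive_set sums_of :: "('b \<Rightarrow> 'a::comm_monoid_add) set \<Rightarrow> ('b \<Rightarrow> 'a) set" for G where
  sums_of_zero: "(\<lambda>x. 0) \<in> sums_of G"
| sums_of_gen: "f \<in> G \<Longrightarrow> f \<in> sums_of G"
| sums_of_add: "f \<in> sums_of G \<Longrightarrow> g \<in> sums_of G \<Longrightarrow> (\<lambda>x. f x + g x) \<in> sums_of G"

text \<open>Scalar coefficients sit inside the generators of all classes used below, so closure
  under addition is enough and additive operations need checking on generators only.\<close>

lemma sums_of_map:
  assumes "f \<in> sums_of G" "\<And>x. T x 0 = 0" "\<And>x u v. T x (u + v) = T x u + T x v"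
    and "\<And>g. g \<in> G \<Longrightarrow> (\<lambda>x. T x (g x)) \<in> sums_of G'"
  shows "(\<lambda>x. T x (f x)) \<in> sums_of G'"
  using assms(1) by induction (auto simp: assms intro: sums_of.intros)

lemma sums_of_mono: "f \<in> sums_of G \<Longrightarrow> G \<subseteq> G' \<Longrightarrow> f \<in> sums_of G'"
  by (induction rule: sums_of.induct) (auto intro: sums_of.intros)

lemma eventually_unit: "\<forall>\<^sub>F h in at_right 0. h \<in> {0<..1::real}"
  by (auto simp: eventually_at_right_field intro!: exI[of _ 1])

section \<open>Primitives across an integrable singularity at 0\<close>

lemma powr_tendsto_0:
  assumes "a > 0" shows "((\<lambda>h. C * h powr a) \<longlongrightarrow> (0::real)) (at_right 0)"
proof -
  have "((\<lambda>x::real. x powr a) \<longlongrightarrow> 0 powr a) (at_right 0)"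
    using assms by (intro tendsto_intros) (auto simp: eventually_at_right_field intro!: exI[of _ 1])
  then show ?thesis using tendsto_mult_left[of "\<lambda>x. x powr a" 0 _ C] by simp
qed

text \<open>Mean value inequality on \<open>{e..x}\<close> against
  \<open>C / (a + 1) * y powr (a + 1)\<close>, then \<open>e\<close> to 0. A derivative that is
  merely integrable at 0 is enough, and the limit at 0 fixes the constant.\<close>

lemma bound_from_zero:
  fixes F :: "real \<Rightarrow> 'a::real_normed_vector"
  assumes lim: "(F \<longlongrightarrow> 0) (at_right 0)" and a: "a > -1"
    and der: "\<And>y. y \<in> {0<..b} \<Longrightarrow>
      \<exists>d. (F has_vector_derivative d) (at y within {0<..b}) \<and> norm d \<le> C * y powr a"
    and x: "x \<in> {0<..b}"
  shows "norm (F x) \<le> C / (a + 1) * x powr (a + 1)"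
proof -
  obtain d where d: "\<And>y. y \<in> {0<..b} \<Longrightarrow> (F has_vector_derivative d y) (at y within {0<..b})"
      "\<And>y. y \<in> {0<..b} \<Longrightarrow> norm (d y) \<le> C * y powr a"
    using der by metis
  have "0 \<le> norm (d x)" by simp
  also have "\<dots> \<le> C * x powr a" using d(2) x by auto
  finally have C: "C \<ge> 0" using x by (simp add: zero_le_mult_iff)
  have *: "norm (F x - F e) \<le> C / (a + 1) * x powr (a + 1)" if e: "0 < e" "e < x" for e
  proof -
    have "norm (F x - F e) \<le> C / (a + 1) * x powr (a + 1) - C / (a + 1) * e powr (a + 1)"
    proof (rule differentiable_bound_general[where f' = d and \<phi>' = "\<lambda>y. C * y powr a"])
      show "continuous_on {e..x} F"
      proof (rule continuous_on_subset)
        show "continuous_on {0<..b} F"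
          using d(1) by (meson continuous_on_eq_continuous_within has_vector_derivative_continuous)
        show "{e..x} \<subseteq> {0<..b}" using e x by auto
      qed
      show "continuous_on {e..x} (\<lambda>x. C / (a + 1) * x powr (a + 1))"
        using e a by (auto intro!: continuous_intros)
      fix y assume y: "e < y" "y < x"
      have "at y within {0<..b} = at y"
        using y e x by (intro at_within_interior) auto
      then show "(F has_vector_derivative d y) (at y)"
        using d(1)[of y] y e x by auto
      show "((\<lambda>x. C / (a + 1) * x powr (a + 1)) has_vector_derivative C * y powr a) (at y)"
        unfolding has_real_derivative_iff_has_vector_derivative[symmetric]
        using y e a by (auto intro!: derivative_eq_intros)
      show "norm (d y) \<le> C * y powr a"
        using d(2) y e x by auto
    qed (use e in auto)
    also have "\<dots> \<le> C / (a + 1) * x powr (a + 1)" using C a by simp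
    finally show ?thesis .
  qed
  have lim': "((\<lambda>e. norm (F x - F e)) \<longlongrightarrow> norm (F x - 0)) (at_right 0)"
    by (intro tendsto_intros lim)
  have "\<forall>\<^sub>F e in at_right 0. norm (F x - F e) \<le> C / (a + 1) * x powr (a + 1)"
    using * x by (auto simp: eventually_at_right_field)
  from tendsto_upperbound[OF lim' this] show ?thesis by simp
qed

text \<open>The value of \<open>f\<close> at 0 is arbitrary, so integrability is obtained by
  domination on the half-open interval and carried to \<open>{0..b}\<close> across a null
  set.\<close>

lemma antiderivative_from_zero:
  fixes f :: "real \<Rightarrow> 'a::euclidean_space"
  assumes b: "b > 0" and cont: "continuous_on {0<..b} f" and a: "a > -1"
    and bound: "\<And>x. x \<in> {0<..b} \<Longrightarrow> norm (f x) \<le> C * x powr a"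
  shows "continuous_on {0..b} (\<lambda>x. integral {0..x} f)"
    and "\<And>x. x \<in> {0<..b} \<Longrightarrow>
      ((\<lambda>x. integral {0..x} f) has_vector_derivative f x) (at x within {0<..b})"
    and "((\<lambda>x. integral {0..x} f) \<longlongrightarrow> 0) (at_right 0)"
    and "f integrable_on {0..b}"
proof -
  have neg: "negligible {x \<in> {0..b} - {0<..b}. g x \<noteq> 0}"
    "negligible {x \<in> {0<..b} - {0..b}. g x \<noteq> 0}" for g :: "real \<Rightarrow> 'c::real_normed_vector"
    by (rule negligible_subset[of "{0}"], simp, force)+
  have "f integrable_on {0<..b}"
  proof (rule measurable_bounded_by_integrable_imp_integrable)
    show "f \<in> borel_measurable (lebesgue_on {0<..b})"
      by (rule continuous_imp_measurable_on_sets_lebesgue[OF cont]) auto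
    have "(\<lambda>x. C * x powr a) integrable_on {0..b}"
      using integrable_on_powr_from_0[OF a, of b] b by (simp add: integrable_on_mult_right)
    then show "(\<lambda>x. C * x powr a) integrable_on {0<..b}"
      by (rule integrable_spike_set[OF _ neg])
  qed (use bound in auto)
  then show int: "f integrable_on {0..b}"
    by (rule integrable_spike_set[OF _ neg(2,1)])
  show c: "continuous_on {0..b} (\<lambda>x. integral {0..x} f)"
    by (rule indefinite_integral_continuous_1[OF int])
  show "((\<lambda>x. integral {0..x} f) has_vector_derivative f x) (at x within {0<..b})"
    if "x \<in> {0<..b}" for x
  proof -
    have "{0..b} - {0} = {0<..b}" by auto
    then show ?thesis
      using integral_has_vector_derivative_continuous_at[OF int, of x "{0}"] that cont
      by (auto simp: continuous_on_eq_continuous_within)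
  qed
  have "((\<lambda>x. integral {0..x} f) \<longlongrightarrow> integral {0..0} f) (at 0 within {0..b})"
    using c[unfolded continuous_on_def, rule_format, of 0] b by simp
  then show "((\<lambda>x. integral {0..x} f) \<longlongrightarrow> 0) (at_right 0)"
    using b by (simp add: at_within_Icc_at_right)
qed

section \<open>Order of vanishing at 0, stable under the Euler field x d/dx\<close>

lemma powr_le_powr_weaken:
  assumes "N' \<le> N" "0 < x" "x \<le> (b::real)"
  shows "x powr N \<le> b powr (N - N') * x powr N'"
proof -
  have "x powr N = x powr (N - N') * x powr N'" by (simp flip: powr_add)
  also have "\<dots> \<le> b powr (N - N') * x powr N'"
    using assms by (intro mult_right_mono powr_mono2) auto
  finally show ?thesis .
qed

text \<open>The Euler field x d/dx maps x^N to a multiple of itself for every real N, so a single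
  order \<open>N\<close>, possibly negative, controls all \<open>k\<close> derivatives. A plain
  derivative costs one order, and this is the price of each later integration by parts.\<close>

primrec flat :: "real \<Rightarrow> nat \<Rightarrow> real \<Rightarrow> (real \<Rightarrow> real) \<Rightarrow> bool" where
  "flat b 0 N f \<longleftrightarrow> continuous_on {0<..b} f \<and> (\<exists>C. \<forall>x\<in>{0<..b}. \<bar>f x\<bar> \<le> C * x powr N)"
| "flat b (Suc k) N f \<longleftrightarrow> (\<exists>C. \<forall>x\<in>{0<..b}. \<bar>f x\<bar> \<le> C * x powr N) \<and>
     (\<exists>d. (\<forall>x\<in>{0<..b}. (f has_real_derivative d x) (at x within {0<..b})) \<and>
        flat b k N (\<lambda>x. x * d x))"

lemma flat_bound:
  assumes "flat b k N f"
  obtains C where "C > 0" "\<And>x. x \<in> {0<..b} \<Longrightarrow> \<bar>f x\<bar> \<le> C * x powr N"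
proof -
  obtain C where C: "\<forall>x\<in>{0<..b}. \<bar>f x\<bar> \<le> C * x powr N"
    using assms by (cases k) auto
  show thesis
  proof (rule that[of "\<bar>C\<bar> + 1"])
    show "\<bar>f x\<bar> \<le> (\<bar>C\<bar> + 1) * x powr N" if "x \<in> {0<..b}" for x
    proof -
      have "\<bar>f x\<bar> \<le> C * x powr N" using C that by auto
      also have "\<dots> \<le> (\<bar>C\<bar> + 1) * x powr N" by (intro mult_right_mono) auto
      finally show ?thesis .
    qed
  qed simp
qed

lemma flat_continuous: "flat b k N f \<Longrightarrow> continuous_on {0<..b} f"
  by (cases k) (auto intro: DERIV_continuous_on)

lemma flat_deriv:
  assumes "flat b (Suc k) N f"
  obtains d where "\<And>x. x \<in> {0<..b} \<Longrightarrow> (f has_real_derivative d x) (at x within {0<..b})"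
    "flat b k N (\<lambda>x. x * d x)"
proof -
  have "\<exists>d. (\<forall>x\<in>{0<..b}. (f has_real_derivative d x) (at x within {0<..b})) \<and>
    flat b k N (\<lambda>x. x * d x)" using assms by simp
  then show thesis using that by blast
qed

lemma flat_Suc_I:
  assumes "\<exists>C. \<forall>x\<in>{0<..b}. \<bar>f x\<bar> \<le> C * x powr N"
    and "\<And>x. x \<in> {0<..b} \<Longrightarrow> (f has_real_derivative d x) (at x within {0<..b})"
    and "flat b k N (\<lambda>x. x * d x)"
  shows "flat b (Suc k) N f"
  unfolding flat.simps using assms by blast

lemma flat_cong:
  assumes "flat b k N f" "\<And>x. x \<in> {0<..b} \<Longrightarrow> f x = g x"
  shows "flat b k N g"
proof (cases k)
  case 0
  then show ?thesis
    using assms continuous_on_cong[of "{0<..b}" "{0<..b}" f g] by auto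
next
  case (Suc l)
  obtain C where C: "\<forall>x\<in>{0<..b}. \<bar>f x\<bar> \<le> C * x powr N" using assms Suc by auto
  obtain d where d: "\<And>x. x \<in> {0<..b} \<Longrightarrow> (f has_real_derivative d x) (at x within {0<..b})"
    "flat b l N (\<lambda>x. x * d x)"
    using assms(1) flat_deriv Suc by blast
  have "(g has_real_derivative d x) (at x within {0<..b})" if "x \<in> {0<..b}" for x
    using d(1)[OF that] assms(2) that unfolding has_field_derivative_def
    by (intro has_derivative_transform[where g = g and f = f]) auto
  moreover have "\<exists>C. \<forall>x\<in>{0<..b}. \<bar>g x\<bar> \<le> C * x powr N" using C assms(2) by auto
  ultimately show ?thesis unfolding Suc using d(2) by (intro flat_Suc_I)
qed

lemma flat_tendsto_0:
  assumes b: "b > 0" and f: "flat b k N f" and N: "N > 0"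
  shows "(f \<longlongrightarrow> 0) (at_right 0)"
proof -
  obtain C where C: "C > 0" "\<And>x. x \<in> {0<..b} \<Longrightarrow> \<bar>f x\<bar> \<le> C * x powr N"
    using flat_bound[OF f] by blast
  show ?thesis
  proof (rule Lim_null_comparison)
    show "\<forall>\<^sub>F x in at_right 0. norm (f x) \<le> C * x powr N"
      using C(2) b by (auto simp: eventually_at_right_field)
  qed (rule powr_tendsto_0[OF N])
qed

lemma flat_dec: "flat b (Suc k) N f \<Longrightarrow> flat b k N f"
proof (induction k arbitrary: f)
  case 0
  then show ?case using flat_continuous[OF 0] by auto
next
  case (Suc k)
  obtain d where d: "\<And>x. x \<in> {0<..b} \<Longrightarrow> (f has_real_derivative d x) (at x within {0<..b})"
    "flat b (Suc k) N (\<lambda>x. x * d x)"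
    using Suc.prems flat_deriv by blast
  have "\<exists>C. \<forall>x\<in>{0<..b}. \<bar>f x\<bar> \<le> C * x powr N" using Suc.prems by auto
  moreover have "flat b k N (\<lambda>x. x * d x)" using Suc.IH[OF d(2)] .
  ultimately show ?case using d(1) by (intro flat_Suc_I)
qed

lemma flat_le:
  assumes "flat b k N f" "m \<le> k"
  shows "flat b m N f"
  using assms(2,1) by (induction rule: inc_induct) (auto simp del: flat.simps intro: flat_dec)

lemma flat_weaken:
  assumes "flat b k N f" "N' \<le> N"
  shows "flat b k N' f"
proof -
  have bd: "\<exists>C. \<forall>x\<in>{0<..b}. \<bar>f x\<bar> \<le> C * x powr N'" if f: "flat b j N f" for f j
  proof -
    obtain C where C: "C > 0" "\<And>x. x \<in> {0<..b} \<Longrightarrow> \<bar>f x\<bar> \<le> C * x powr N"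
      using flat_bound[OF f] by blast
    have "\<bar>f x\<bar> \<le> C * b powr (N - N') * x powr N'" if x: "x \<in> {0<..b}" for x
    proof -
      have "C * x powr N \<le> C * (b powr (N - N') * x powr N')"
        using powr_le_powr_weaken[OF assms(2), of x b] C(1) x by (intro mult_left_mono) auto
      then show ?thesis using C(2)[OF x] by (simp add: mult.assoc)
    qed
    then show ?thesis by blast
  qed
  show ?thesis using assms(1)
  proof (induction k arbitrary: f)
    case 0
    then show ?case using bd[OF 0] by auto
  next
    case (Suc k)
    then obtain d where "\<And>x. x \<in> {0<..b} \<Longrightarrow> (f has_real_derivative d x) (at x within {0<..b})"
      "flat b k N (\<lambda>x. x * d x)"
      using flat_deriv by blast
    then show ?case using Suc.IH bd[OF Suc.prems] by (intro flat_Suc_I) auto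
  qed
qed

lemma flat_add: "flat b k N f \<Longrightarrow> flat b k N g \<Longrightarrow> flat b k N (\<lambda>x. f x + g x)"
proof (induction k arbitrary: f g)
  have bd: "\<exists>C. \<forall>x\<in>{0<..b}. \<bar>f x + g x\<bar> \<le> C * x powr N"
    if f: "flat b j N f" and g: "flat b j N g" for f g j
  proof -
    obtain C where C: "C > 0" "\<And>x. x \<in> {0<..b} \<Longrightarrow> \<bar>f x\<bar> \<le> C * x powr N"
      using flat_bound[OF f] by blast
    obtain D where D: "D > 0" "\<And>x. x \<in> {0<..b} \<Longrightarrow> \<bar>g x\<bar> \<le> D * x powr N"
      using flat_bound[OF g] by blast
    have "\<bar>f x + g x\<bar> \<le> (C + D) * x powr N" if x: "x \<in> {0<..b}" for x
      using C(2)[OF x] D(2)[OF x] by (simp add: distrib_right)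
    then show ?thesis by blast
  qed
  {
    case 0
    show ?case using bd[OF 0] continuous_on_add[OF 0[THEN flat_continuous]] by simp
  next
    case (Suc k)
    obtain d where d: "\<And>x. x \<in> {0<..b} \<Longrightarrow> (f has_real_derivative d x) (at x within {0<..b})"
      "flat b k N (\<lambda>x. x * d x)"
      using Suc.prems flat_deriv by blast
    obtain e where e: "\<And>x. x \<in> {0<..b} \<Longrightarrow> (g has_real_derivative e x) (at x within {0<..b})"
      "flat b k N (\<lambda>x. x * e x)"
      using Suc.prems flat_deriv by blast
    have "((\<lambda>x. f x + g x) has_real_derivative d x + e x) (at x within {0<..b})"
      if "x \<in> {0<..b}" for x
      using d(1)[OF that] e(1)[OF that] by (rule DERIV_add)
    moreover have "flat b k N (\<lambda>x. x * (d x + e x))"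
      using Suc.IH[OF d(2) e(2)] by (simp add: distrib_left)
    ultimately show ?case by (intro flat_Suc_I bd[OF Suc.prems])
  }
qed

lemma flat_mult: "flat b k N f \<Longrightarrow> flat b k M g \<Longrightarrow> flat b k (N + M) (\<lambda>x. f x * g x)"
proof (induction k arbitrary: f g)
  have bd: "\<exists>C. \<forall>x\<in>{0<..b}. \<bar>f x * g x\<bar> \<le> C * x powr (N + M)"
    if f: "flat b j N f" and g: "flat b j M g" for f g j
  proof -
    obtain C where C: "C > 0" "\<And>x. x \<in> {0<..b} \<Longrightarrow> \<bar>f x\<bar> \<le> C * x powr N"
      using flat_bound[OF f] by blast
    obtain D where D: "D > 0" "\<And>x. x \<in> {0<..b} \<Longrightarrow> \<bar>g x\<bar> \<le> D * x powr M"
      using flat_bound[OF g] by blast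
    have "\<bar>f x * g x\<bar> \<le> (C * D) * x powr (N + M)" if x: "x \<in> {0<..b}" for x
      using mult_mono[OF C(2)[OF x] D(2)[OF x]] C(1)
      by (simp add: abs_mult powr_add algebra_simps)
    then show ?thesis by blast
  qed
  {
    case 0
    show ?case using bd[OF 0] continuous_on_mult[OF 0[THEN flat_continuous]] by simp
  next
    case (Suc k)
    obtain d where d: "\<And>x. x \<in> {0<..b} \<Longrightarrow> (f has_real_derivative d x) (at x within {0<..b})"
      "flat b k N (\<lambda>x. x * d x)"
      using Suc.prems flat_deriv by blast
    obtain e where e: "\<And>x. x \<in> {0<..b} \<Longrightarrow> (g has_real_derivative e x) (at x within {0<..b})"
      "flat b k M (\<lambda>x. x * e x)"
      using Suc.prems flat_deriv by blast
    have "((\<lambda>x. f x * g x) has_real_derivative d x * g x + f x * e x) (at x within {0<..b})"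
      if "x \<in> {0<..b}" for x
      using d(1)[OF that] e(1)[OF that] by (auto intro!: derivative_eq_intros)
    moreover have "flat b k (N + M) (\<lambda>x. x * (d x * g x + f x * e x))"
      using flat_add[OF Suc.IH[OF d(2) flat_dec[OF Suc.prems(2)]]
          Suc.IH[OF flat_dec[OF Suc.prems(1)] e(2)]]
      by (simp add: algebra_simps)
    ultimately show ?case by (intro flat_Suc_I bd[OF Suc.prems])
  }
qed

lemma flat_powr: "flat b k a (\<lambda>x. c * x powr a)"
proof (induction k arbitrary: c)
  case 0
  have "\<bar>c * x powr a\<bar> \<le> \<bar>c\<bar> * x powr a" for x by (simp add: abs_mult)
  then have "\<exists>C. \<forall>x\<in>{0<..b}. \<bar>c * x powr a\<bar> \<le> C * x powr a" by blast
  moreover have "continuous_on {0<..b} (\<lambda>x. c * x powr a)"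
    by (intro continuous_intros) auto
  ultimately show ?case by simp
next
  case (Suc k)
  have "((\<lambda>x. c * x powr a) has_real_derivative c * a * x powr (a - 1)) (at x within {0<..b})"
    if "x \<in> {0<..b}" for x
    using that by (auto intro!: derivative_eq_intros)
  moreover have "flat b k a (\<lambda>x. x * (c * a * x powr (a - 1)))"
    by (rule flat_cong[OF Suc.IH[of "c * a"]]) (auto simp: powr_diff)
  moreover have "\<bar>c * x powr a\<bar> \<le> \<bar>c\<bar> * x powr a" for x by (simp add: abs_mult)
  then have "\<exists>C. \<forall>x\<in>{0<..b}. \<bar>c * x powr a\<bar> \<le> C * x powr a" by blast
  ultimately show ?case by (intro flat_Suc_I)
qed

lemma flat_const: "flat b k 0 (\<lambda>x. c)"
  by (rule flat_cong[OF flat_powr[of b k 0 c]]) auto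

lemma flat_ident: "flat b k 1 (\<lambda>x. x)"
  by (rule flat_cong[OF flat_powr[of b k 1 1]]) auto

lemma flat_zero: "flat b k N (\<lambda>x. 0)"
  by (rule flat_cong[OF flat_powr[of b k N 0]]) auto

lemma flat_cmult: "flat b k N f \<Longrightarrow> flat b k N (\<lambda>x. c * f x)"
  using flat_mult[OF flat_const, of b k N f c] by simp

lemma flat_diff: "flat b k N f \<Longrightarrow> flat b k N g \<Longrightarrow> flat b k N (\<lambda>x. f x - g x)"
  using flat_add[OF _ flat_cmult[of b k N g "-1"], of f] by simp

text \<open>Chain rule: passing from \<open>H i\<close> to \<open>H (Suc i)\<close> loses one power
  of \<open>y - c\<close>, and the Euler derivative of \<open>f\<close> supplies a factor of order
  \<open>\<epsilon>\<close> in exchange. The truncated \<open>J - i\<close> leaves mere boundedness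
  from \<open>i = J\<close> on.\<close>

lemma flat_comp:
  assumes H: "\<And>i y. y \<in> Y \<Longrightarrow> (H i has_real_derivative H (Suc i) y) (at y within Y)"
    and bd: "\<And>i. \<exists>C. \<forall>y\<in>Y. \<bar>H i y\<bar> \<le> C * \<bar>y - c\<bar> ^ (J - i)"
    and f: "flat b k \<epsilon> (\<lambda>x. f x - c)" and Y: "\<And>x. x \<in> {0<..b} \<Longrightarrow> f x \<in> Y" and e: "\<epsilon> \<ge> 0"
  shows "flat b k (real (J - i) * \<epsilon>) (\<lambda>x. H i (f x))"
  using f
proof (induction k arbitrary: i)
  have bd': "\<exists>C. \<forall>x\<in>{0<..b}. \<bar>H i (f x)\<bar> \<le> C * x powr (real (J - i) * \<epsilon>)"
    if f: "flat b k \<epsilon> (\<lambda>x. f x - c)" for k i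
  proof -
    obtain C where C: "C > 0" "\<And>x. x \<in> {0<..b} \<Longrightarrow> \<bar>f x - c\<bar> \<le> C * x powr \<epsilon>"
      using flat_bound[OF f] by blast
    obtain D where D: "\<forall>y\<in>Y. \<bar>H i y\<bar> \<le> D * \<bar>y - c\<bar> ^ (J - i)" using bd by blast
    have "\<bar>H i (f x)\<bar> \<le> \<bar>D\<bar> * C ^ (J - i) * x powr (real (J - i) * \<epsilon>)" if x: "x \<in> {0<..b}" for x
    proof -
      have "\<bar>H i (f x)\<bar> \<le> D * \<bar>f x - c\<bar> ^ (J - i)" using D Y[OF x] by auto
      also have "\<dots> \<le> \<bar>D\<bar> * (C * x powr \<epsilon>) ^ (J - i)"
        using C(2)[OF x] by (intro mult_mono power_mono) auto
      also have "\<dots> = \<bar>D\<bar> * C ^ (J - i) * x powr (real (J - i) * \<epsilon>)"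
        using x by (simp add: power_mult_distrib powr_powr mult.commute flip: powr_realpow)
      finally show ?thesis .
    qed
    then show ?thesis by blast
  qed
  {
    case 0
    have "continuous_on {0<..b} f"
      using continuous_on_add[OF flat_continuous[OF 0] continuous_on_const[of _ c]] by simp
    moreover have "continuous_on Y (H i)" by (rule DERIV_continuous_on[OF H])
    moreover have "f ` {0<..b} \<subseteq> Y" using Y by auto
    ultimately have "continuous_on {0<..b} (\<lambda>x. H i (f x))"
      using continuous_on_compose2 by blast
    then show ?case using bd'[OF 0] by auto
  next
    case (Suc k)
    obtain d where d: "\<And>x. x \<in> {0<..b} \<Longrightarrow> ((\<lambda>x. f x - c) has_real_derivative d x) (at x within {0<..b})"
      "flat b k \<epsilon> (\<lambda>x. x * d x)"
      using Suc.prems flat_deriv by blast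
    have f': "(f has_real_derivative d x) (at x within {0<..b})" if "x \<in> {0<..b}" for x
      using DERIV_add[OF d(1)[OF that] DERIV_const[of c]] by simp
    have "((\<lambda>x. H i (f x)) has_real_derivative H (Suc i) (f x) * d x) (at x within {0<..b})"
      if x: "x \<in> {0<..b}" for x
    proof -
      have "f ` {0<..b} \<subseteq> Y" using Y by blast
      from DERIV_image_chain[OF DERIV_subset[OF H[OF Y[OF x], of i] this] f'[OF x]]
      show ?thesis by (simp add: o_def)
    qed
    moreover have "flat b k (real (J - Suc i) * \<epsilon> + \<epsilon>) (\<lambda>x. H (Suc i) (f x) * (x * d x))"
      by (rule flat_mult[OF Suc.IH[OF flat_dec[OF Suc.prems]] d(2)])
    then have "flat b k (real (J - i) * \<epsilon>) (\<lambda>x. x * (H (Suc i) (f x) * d x))"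
    proof (rule flat_weaken[OF flat_cong])
      \<comment> \<open>Equality of the factors for \<open>i < J\<close>; from then on truncated
        subtraction makes the left side 0.\<close>
      have "real (J - i) * \<epsilon> \<le> (real (J - Suc i) + 1) * \<epsilon>"
        using e by (intro mult_right_mono) auto
      then show "real (J - i) * \<epsilon> \<le> real (J - Suc i) * \<epsilon> + \<epsilon>" by (simp add: distrib_right)
    qed (simp add: algebra_simps)
    ultimately show ?case by (intro flat_Suc_I bd'[OF Suc.prems])
  }
qed

text \<open>The derivative of a Taylor remainder of \<open>H i\<close> is the remainder of
  \<open>H (Suc i)\<close> with one term fewer. The remainders thus form a derivative family of the
  kind that \<open>flat_comp\<close> accepts.\<close>

lemma taylor_remainder_family:
  fixes H :: "nat \<Rightarrow> real \<Rightarrow> real"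
  assumes H: "\<And>i y. y \<in> {lo..hi} \<Longrightarrow> (H i has_real_derivative H (Suc i) y) (at y within {lo..hi})"
    and y0: "y0 \<in> {lo..hi}"
  defines "T \<equiv> \<lambda>J i y. H i y - (\<Sum>j<J - i. H (i + j) y0 / fact j * (y - y0) ^ j)"
  shows "y \<in> {lo..hi} \<Longrightarrow> (T J i has_real_derivative T J (Suc i) y) (at y within {lo..hi})"
    and "\<exists>C. \<forall>y\<in>{lo..hi}. \<bar>T J i y\<bar> \<le> C * \<bar>y - y0\<bar> ^ (J - i)"
proof -
  have bounded: "\<exists>B. \<forall>y\<in>{lo..hi}. \<bar>H i y\<bar> \<le> B" for i
  proof -
    have "compact (H i ` {lo..hi})"
      using DERIV_continuous_on[OF H] by (intro compact_continuous_image) auto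
    then have "bounded (H i ` {lo..hi})" by (rule compact_imp_bounded)
    then show ?thesis by (auto simp: bounded_iff)
  qed
  show "(T J i has_real_derivative T J (Suc i) y) (at y within {lo..hi})" if y: "y \<in> {lo..hi}"
  proof (cases "J - i")
    case 0
    then show ?thesis using H[OF y, of i] by (simp add: T_def)
  next
    case (Suc m)
    then have m: "J - Suc i = m" by simp
    have "((\<lambda>y. \<Sum>j<Suc m. H (i + j) y0 / fact j * (y - y0) ^ j) has_real_derivative
        (\<Sum>j<Suc m. H (i + j) y0 / fact j * (real j * (y - y0) ^ (j - 1)))) (at y within {lo..hi})"
      by (intro DERIV_sum) (auto intro!: derivative_eq_intros)
    also have "(\<Sum>j<Suc m. H (i + j) y0 / fact j * (real j * (y - y0) ^ (j - 1)))
        = (\<Sum>j<m. H (Suc i + j) y0 / fact j * (y - y0) ^ j)"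
      by (subst sum.lessThan_Suc_shift) (auto intro!: sum.cong simp: field_simps simp del: of_nat_Suc)
    finally show ?thesis
      unfolding T_def m Suc by (intro DERIV_diff H[OF y])
  qed
  show "\<exists>C. \<forall>y\<in>{lo..hi}. \<bar>T J i y\<bar> \<le> C * \<bar>y - y0\<bar> ^ (J - i)"
  proof (cases "J - i")
    case 0
    then show ?thesis using bounded[of i] by (simp add: T_def)
  next
    case (Suc m)
    obtain B where B: "\<forall>y\<in>{lo..hi}. \<bar>H (i + Suc m) y\<bar> \<le> B" using bounded by blast
    have "\<bar>T J i y\<bar> \<le> B / fact m * \<bar>y - y0\<bar> ^ Suc m" if y: "y \<in> {lo..hi}" for y
      using field_Taylor[of "{lo..hi}" m "\<lambda>j. H (i + j)" B y0 y] H B y y0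
      by (simp add: T_def Suc lessThan_Suc_atMost)
    then show ?thesis unfolding Suc by blast
  qed
qed

text \<open>The remainder after \<open>J\<close> terms vanishes to order \<open>J\<close> at
  \<open>y0\<close>, hence has order \<open>J * \<epsilon>\<close> along \<open>f\<close>. For
  \<open>J = 0\<close> this is the stability of order 0 under composition with a smooth
  function.\<close>

lemma flat_taylor:
  assumes H: "\<And>i y. y \<in> {lo..hi} \<Longrightarrow> (H i has_real_derivative H (Suc i) y) (at y within {lo..hi})"
    and y0: "y0 \<in> {lo..hi}" and f: "flat b k \<epsilon> (\<lambda>x. f x - y0)"
    and r: "\<And>x. x \<in> {0<..b} \<Longrightarrow> f x \<in> {lo..hi}" and e: "\<epsilon> \<ge> 0"
  shows "flat b k (real J * \<epsilon>) (\<lambda>x. H 0 (f x) - (\<Sum>j<J. H j y0 / fact j * (f x - y0) ^ j))"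
proof -
  let ?T = "\<lambda>i y. H i y - (\<Sum>j<J - i. H (i + j) y0 / fact j * (y - y0) ^ j)"
  have "flat b k (real (J - 0) * \<epsilon>) (\<lambda>x. ?T 0 (f x))"
  proof (rule flat_comp[where Y = "{lo..hi}" and H = ?T and c = y0 and i = 0])
    show "(?T i has_real_derivative ?T (Suc i) y) (at y within {lo..hi})"
      if "y \<in> {lo..hi}" for i y
      by (rule taylor_remainder_family(1)[where H = H]) (use H y0 that in auto)
    show "\<exists>C. \<forall>y\<in>{lo..hi}. \<bar>?T i y\<bar> \<le> C * \<bar>y - y0\<bar> ^ (J - i)" for i
      by (rule taylor_remainder_family(2)[where H = H]) (use H y0 in auto)
  qed (use f r e in auto)
  then show ?thesis by simp
qed

lemma powr_family:
  fixes a :: real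
  assumes "lo > 0"
  shows "\<exists>H. (\<forall>i. \<forall>y\<in>{lo..hi}. (H i has_real_derivative H (Suc i) y) (at y within {lo..hi})) \<and>
    H 0 = (\<lambda>y. y powr a)"
proof (intro exI conjI allI ballI)
  let ?H = "\<lambda>i y. (\<Prod>j<i. a - real j) * y powr (a - real i)"
  show "(?H i has_real_derivative ?H (Suc i) y) (at y within {lo..hi})" if "y \<in> {lo..hi}" for i y
    using that assms by (auto intro!: derivative_eq_intros simp: algebra_simps)
qed auto

lemma flat_powr_comp:
  assumes f: "flat b k 0 f" and lo: "lo > 0" "\<And>x. x \<in> {0<..b} \<Longrightarrow> lo \<le> f x"
  shows "flat b k 0 (\<lambda>x. f x powr a)"
proof -
  obtain C where C: "C > 0" "\<And>x. x \<in> {0<..b} \<Longrightarrow> \<bar>f x\<bar> \<le> C * x powr 0"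
    using flat_bound[OF f] by blast
  define hi where "hi = C + lo"
  obtain H where H: "\<forall>i. \<forall>y\<in>{lo..hi}. (H i has_real_derivative H (Suc i) y) (at y within {lo..hi})"
    "H 0 = (\<lambda>y. y powr a)" using powr_family[OF lo(1)] by meson
  \<comment> \<open>With \<open>J = 0\<close> no polynomial is subtracted, and any point of the
    interval may serve as centre; \<open>lo\<close> is taken.\<close>
  have "flat b k (real 0 * 0) (\<lambda>x. H 0 (f x) - (\<Sum>j<0. H j lo / fact j * (f x - lo) ^ j))"
  proof (rule flat_taylor)
    show "flat b k 0 (\<lambda>x. f x - lo)" by (intro flat_diff f flat_const)
    show "f x \<in> {lo..hi}" if "x \<in> {0<..b}" for x
      using C(2)[OF that] lo that by (auto simp: hi_def)
    show "lo \<in> {lo..hi}" using C lo by (simp add: hi_def)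
  qed (use H in auto)
  then show ?thesis by (simp add: H(2))
qed

text \<open>Since x D' = x d, one order and one derivative are gained together; the limit at 0
  excludes an additive constant, which would only have order 0.\<close>

lemma flat_antiderivative:
  assumes "flat b k N d" "N > -1" "(D \<longlongrightarrow> 0) (at_right 0)"
    and der: "\<And>x. x \<in> {0<..b} \<Longrightarrow> (D has_real_derivative d x) (at x within {0<..b})"
  shows "flat b (Suc k) (N + 1) D"
proof (rule flat_Suc_I[OF _ der])
  obtain C where C: "C > 0" "\<And>x. x \<in> {0<..b} \<Longrightarrow> \<bar>d x\<bar> \<le> C * x powr N"
    using flat_bound[OF assms(1)] by blast
  have "\<bar>D x\<bar> \<le> C / (N + 1) * x powr (N + 1)" if "x \<in> {0<..b}" for x
    using bound_from_zero[OF assms(3,2), of b C x] der C(2) that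
    by (auto simp: has_real_derivative_iff_has_vector_derivative)
  then show "\<exists>C. \<forall>x\<in>{0<..b}. \<bar>D x\<bar> \<le> C * x powr (N + 1)" by blast
  show "flat b k (N + 1) (\<lambda>x. x * d x)"
    using flat_mult[OF flat_ident assms(1)] by (simp add: add.commute)
qed

section \<open>Expansion of the potential in powers of the phase\<close>

text \<open>The energy is fixed. The derivatives of \<open>W\<close> are a parameter so that its
  Taylor coefficients at 0 can be named.\<close>

locale potential =
  fixes \<gamma> b E \<delta> :: real and V W :: "real \<Rightarrow> real" and dW :: "nat \<Rightarrow> real \<Rightarrow> real"
  assumes gamma: "\<gamma> > 0" and b: "b > 0" and delta: "\<delta> > 0"
    and V_cont: "continuous_on {0..b} V" and V_0: "V 0 = 0"
    and V_eq: "\<And>x. x \<in> {0<..b} \<Longrightarrow> V x = x powr \<gamma> * W x"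
    and W_eq: "\<And>x. x \<in> {0..b} \<Longrightarrow> dW 0 x = W x"
    and dW: "\<And>n x. x \<in> {0..b} \<Longrightarrow> (dW n has_real_derivative dW (Suc n) x) (at x within {0..b})"
    and gap: "\<And>x. x \<in> {0..b} \<Longrightarrow> E - V x \<ge> \<delta>"
begin

definition p :: "real \<Rightarrow> real" where "p x = sqrt (E - V x)"

definition S :: "real \<Rightarrow> real" where "S x = integral {0..x} p"

definition W1 :: "real \<Rightarrow> real" where "W1 x = \<gamma> * dW 0 x + x * dW 1 x"

text \<open>This is q / p, that is p' / (2 p^2) = - V' / (4 p^3) with V' = x powr (\<gamma> - 1) *
  \<open>W1\<close>: the density of q dx with respect to dS.\<close>

definition r :: "real \<Rightarrow> real" where
  "r x = (- 1 / 4) * x powr (\<gamma> - 1) * W1 x * (E - V x) powr (- 3 / 2)"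

lemma flat_dW: "flat b k 0 (dW n)"
proof -
  have "flat b k (real 0 * 1) (\<lambda>x. dW (n + 0) x - (\<Sum>j<0. dW (n + j) 0 / fact j * (x - 0) ^ j))"
    by (rule flat_taylor[where H = "\<lambda>i. dW (n + i)" and f = "\<lambda>x. x" and lo = 0 and hi = b])
       (use b dW in \<open>auto simp: flat_ident\<close>)
  then show ?thesis by simp
qed

lemma flat_dW_taylor: "flat b k (real J) (\<lambda>x. dW n x - (\<Sum>j<J. dW (n + j) 0 / fact j * x ^ j))"
proof -
  have "flat b k (real J * 1) (\<lambda>x. dW (n + 0) x - (\<Sum>j<J. dW (n + j) 0 / fact j * (x - 0) ^ j))"
    by (rule flat_taylor[where H = "\<lambda>i. dW (n + i)" and f = "\<lambda>x. x" and lo = 0 and hi = b])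
       (use b dW in \<open>auto simp: flat_ident\<close>)
  then show ?thesis by simp
qed

lemma flat_V: "flat b k \<gamma> V"
proof -
  have "flat b k (\<gamma> + 0) (\<lambda>x. (1 * x powr \<gamma>) * dW 0 x)"
    by (intro flat_mult flat_powr flat_dW)
  then have "flat b k \<gamma> (\<lambda>x. (1 * x powr \<gamma>) * dW 0 x)" by simp
  then show ?thesis
    by (rule flat_cong) (auto simp: V_eq W_eq)
qed

lemma flat_E_V: "flat b k 0 (\<lambda>x. E - V x)"
  using gamma by (intro flat_diff flat_const flat_weaken[OF flat_V]) auto

lemma flat_E_V_powr: "flat b k 0 (\<lambda>x. (E - V x) powr a)"
  by (rule flat_powr_comp[OF flat_E_V delta]) (use gap in auto)

lemma E_V_pos: "x \<in> {0..b} \<Longrightarrow> E - V x > 0"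
  using gap[of x] delta by auto

lemma p_eq_powr: "x \<in> {0..b} \<Longrightarrow> p x = (E - V x) powr (1/2)"
  using E_V_pos by (simp add: p_def powr_half_sqrt less_imp_le)

lemma p_pos: "x \<in> {0..b} \<Longrightarrow> p x > 0"
  using E_V_pos by (simp add: p_def)

lemma p_ge: "x \<in> {0..b} \<Longrightarrow> p x \<ge> sqrt \<delta>"
  using gap by (simp add: p_def)

lemma p_powr: "x \<in> {0..b} \<Longrightarrow> p x powr a = (E - V x) powr (a / 2)"
  by (simp add: p_eq_powr powr_powr)

lemma flat_p_powr: "flat b k 0 (\<lambda>x. p x powr a)"
  by (rule flat_cong[OF flat_E_V_powr[of k "a / 2"]]) (auto simp: p_powr)

lemma flat_p: "flat b k 0 p"
  by (rule flat_cong[OF flat_p_powr[of k 1]]) (auto simp: p_pos less_imp_le)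

lemma p_cont: "continuous_on {0..b} p"
  unfolding p_def by (intro continuous_intros V_cont)

lemma p_bound: obtains C where "C > 0" "\<And>x. x \<in> {0<..b} \<Longrightarrow> norm (p x) \<le> C * x powr 0"
  using flat_bound[OF flat_p] by (metis real_norm_def)

lemma S_props:
  shows S_cont: "continuous_on {0..b} S"
    and S_deriv: "x \<in> {0<..b} \<Longrightarrow> (S has_real_derivative p x) (at x within {0<..b})"
    and S_lim: "(S \<longlongrightarrow> 0) (at_right 0)"
    and p_integrable: "p integrable_on {0..b}"
proof -
  obtain C where C: "\<And>x. x \<in> {0<..b} \<Longrightarrow> norm (p x) \<le> C * x powr 0"
    using p_bound by blast
  have S: "S = (\<lambda>x. integral {0..x} p)" by (auto simp: S_def)
  have pc: "continuous_on {0<..b} p" by (rule continuous_on_subset[OF p_cont]) auto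
  note * = antiderivative_from_zero[OF b pc _ C, simplified]
  show "continuous_on {0..b} S" "(S \<longlongrightarrow> 0) (at_right 0)" "p integrable_on {0..b}"
    using * unfolding S by simp_all
  show "x \<in> {0<..b} \<Longrightarrow> (S has_real_derivative p x) (at x within {0<..b})"
    using * unfolding S by (simp add: has_real_derivative_iff_has_vector_derivative)
qed

lemma S_0: "S 0 = 0" by (simp add: S_def)

lemma flat_S: "flat b k 1 S"
  using flat_dec[OF flat_antiderivative[OF flat_p _ S_lim S_deriv]] by simp

lemma S_ge: assumes "x \<in> {0..b}" shows "S x \<ge> sqrt \<delta> * x"
proof -
  have "integral {0..x} (\<lambda>_. sqrt \<delta>) \<le> integral {0..x} p"
    using assms p_ge by (intro integral_le integrable_on_subinterval[OF p_integrable]) auto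
  then show ?thesis using assms by (simp add: S_def mult.commute)
qed

lemma S_pos: "x \<in> {0<..b} \<Longrightarrow> S x > 0"
  using S_ge[of x] delta by (smt (verit) atLeastAtMost_iff greaterThanAtMost_iff mult_pos_pos real_sqrt_gt_zero)

lemma flat_inverse_x: "flat b k (-1) (\<lambda>x. 1 / x)"
  by (rule flat_cong[OF flat_powr[of b k "-1" 1]]) (auto simp: powr_minus field_simps)

lemma flat_S_div_x: "flat b k 0 (\<lambda>x. S x / x)"
  using flat_mult[OF flat_S flat_inverse_x, of k] by simp

lemma S_div_x_ge: "x \<in> {0<..b} \<Longrightarrow> S x / x \<ge> sqrt \<delta>"
  using S_ge[of x] by (simp add: field_simps)

lemma flat_S_div_x_powr: "flat b k 0 (\<lambda>x. (S x / x) powr a)"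
  by (rule flat_powr_comp[OF flat_S_div_x, of "sqrt \<delta>"]) (use S_div_x_ge delta in auto)

text \<open>The quotient S / x has order 0 and is bounded below, so in every estimate of this kind
  \<open>S\<close> may replace x.\<close>

lemma flat_S_powr: "flat b k a (\<lambda>x. S x powr a)"
proof -
  have "flat b k (a + 0) (\<lambda>x. (1 * x powr a) * (S x / x) powr a)"
    by (intro flat_mult flat_powr flat_S_div_x_powr)
  then have "flat b k a (\<lambda>x. (1 * x powr a) * (S x / x) powr a)" by simp
  then show ?thesis
    by (rule flat_cong) (use S_pos in \<open>auto simp: powr_divide less_imp_le\<close>)
qed

lemma flat_x_div_S: "flat b k 0 (\<lambda>x. x / S x)"
  by (rule flat_cong[OF flat_S_div_x_powr[of k "-1"]])
     (use S_pos in \<open>auto simp: powr_minus field_simps less_imp_le\<close>)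

text \<open>The smallest positive exponent j \<gamma> + l, hence the guaranteed gain of one
  bootstrap step.\<close>

definition eps :: real where "eps = min 1 \<gamma>"

lemma eps: "eps > 0" "eps \<le> 1" "eps \<le> \<gamma>"
  using gamma by (auto simp: eps_def)

section \<open>Calculus of finite expansions in powers of S\<close>

definition S_powers :: "(real \<Rightarrow> real) set" where
  "S_powers = {\<lambda>x. c * S x powr (real j * \<gamma> + real l) | c j l. True}"

lemma S_powers_I: "(\<lambda>x. c * S x powr (real j * \<gamma> + real l)) \<in> S_powers"
  by (auto simp: S_powers_def)

lemma S_powers_cmult: "P \<in> sums_of S_powers \<Longrightarrow> (\<lambda>x. c * P x) \<in> sums_of S_powers"
proof (erule sums_of_map)
  fix g assume "g \<in> S_powers"
  then obtain d i m where "g = (\<lambda>x. d * S x powr (real i * \<gamma> + real m))"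
    by (auto simp: S_powers_def)
  then have "(\<lambda>x. c * g x) = (\<lambda>x. (c * d) * S x powr (real i * \<gamma> + real m))"
    by (simp add: mult.assoc)
  also have "\<dots> \<in> sums_of S_powers" by (intro sums_of_gen S_powers_I)
  finally show "(\<lambda>x. c * g x) \<in> sums_of S_powers" .
qed (simp_all add: distrib_left)

lemma S_powers_mult_S:
  "P \<in> sums_of S_powers \<Longrightarrow> (\<lambda>x. S x powr (real j * \<gamma> + real l) * P x) \<in> sums_of S_powers"
proof (erule sums_of_map)
  fix g assume "g \<in> S_powers"
  then obtain c i m where "g = (\<lambda>x. c * S x powr (real i * \<gamma> + real m))"
    by (auto simp: S_powers_def)
  then have "(\<lambda>x. S x powr (real j * \<gamma> + real l) * g x) =
      (\<lambda>x. c * S x powr (real (i + j) * \<gamma> + real (m + l)))"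
    by (auto simp: fun_eq_iff algebra_simps simp flip: powr_add)
  also have "\<dots> \<in> sums_of S_powers" by (intro sums_of_gen S_powers_I)
  finally show "(\<lambda>x. S x powr (real j * \<gamma> + real l) * g x) \<in> sums_of S_powers" .
qed (simp_all add: distrib_left)

lemma S_powers_mult:
  assumes "P \<in> sums_of S_powers" "Q \<in> sums_of S_powers"
  shows "(\<lambda>x. P x * Q x) \<in> sums_of S_powers"
  using assms(1)
proof (rule sums_of_map[where T = "\<lambda>x y. y * Q x"])
  fix g assume "g \<in> S_powers"
  then obtain c i m where "g = (\<lambda>x. c * S x powr (real i * \<gamma> + real m))"
    by (auto simp: S_powers_def)
  then show "(\<lambda>x. g x * Q x) \<in> sums_of S_powers"
    using S_powers_cmult[OF S_powers_mult_S[OF assms(2), of i m], of c] by (simp add: mult.assoc)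
qed (simp_all add: distrib_right)

text \<open>All exponents other than 0 are at least \<open>eps\<close>. The constant split off here
  becomes the centre of Taylor expansion when a smooth function is applied.\<close>

lemma S_powers_limit:
  assumes "P \<in> sums_of S_powers"
  shows "\<exists>c. flat b k eps (\<lambda>x. P x - c)"
  using assms
proof induction
  case sums_of_zero
  show ?case using flat_zero by (intro exI[of _ 0]) simp
next
  case (sums_of_gen f)
  then obtain c j l where f: "f = (\<lambda>x. c * S x powr (real j * \<gamma> + real l))"
    by (auto simp: S_powers_def)
  show ?case
  proof (cases "j = 0 \<and> l = 0")
    case True
    have "flat b k eps (\<lambda>x. f x - c)"
      by (rule flat_cong[OF flat_zero]) (use True S_pos f in \<open>auto simp: less_le\<close>)
    then show ?thesis ..
  next
    case False
    have "eps \<le> real j * \<gamma> + real l"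
    proof (cases "j = 0")
      case True
      then show ?thesis using False eps by simp
    next
      case False
      then have "1 * \<gamma> \<le> real j * \<gamma>" using gamma by (intro mult_right_mono) auto
      then show ?thesis using eps(3) by simp
    qed
    then have "flat b k eps (\<lambda>x. f x - 0)"
      unfolding f by (simp, intro flat_cmult flat_weaken[OF flat_S_powr])
    then show ?thesis ..
  qed
next
  case (sums_of_add f g)
  then obtain c d where "flat b k eps (\<lambda>x. f x - c)" "flat b k eps (\<lambda>x. g x - d)" by blast
  from flat_add[OF this] have "flat b k eps (\<lambda>x. (f x + g x) - (c + d))"
    by (simp add: algebra_simps)
  then show ?case ..
qed

lemma flat_S_powers:
  assumes "P \<in> sums_of S_powers" shows "flat b k 0 P"
proof -
  obtain c where "flat b k eps (\<lambda>x. P x - c)" using S_powers_limit[OF assms] by blast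
  then have "flat b k 0 (\<lambda>x. P x - c)" by (rule flat_weaken) (use eps in auto)
  from flat_add[OF this flat_const[of b k c]] show ?thesis by simp
qed

definition expansion :: "nat \<Rightarrow> real \<Rightarrow> (real \<Rightarrow> real) \<Rightarrow> bool" where
  "expansion k N f \<longleftrightarrow> (\<exists>P\<in>sums_of S_powers. flat b k N (\<lambda>x. f x - P x))"

lemma expansionI:
  "P \<in> sums_of S_powers \<Longrightarrow> flat b k N (\<lambda>x. f x - P x) \<Longrightarrow> expansion k N f"
  unfolding expansion_def by (rule bexI)

lemma expansionE:
  assumes "expansion k N f"
  obtains P where "P \<in> sums_of S_powers" "flat b k N (\<lambda>x. f x - P x)"
  using assms unfolding expansion_def by (elim bexE)

lemma expansion_cong:
  assumes "expansion k N f" "\<And>x. x \<in> {0<..b} \<Longrightarrow> f x = g x"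
  shows "expansion k N g"
proof -
  obtain P where P: "P \<in> sums_of S_powers" "flat b k N (\<lambda>x. f x - P x)"
    using assms(1) by (rule expansionE)
  show ?thesis by (rule expansionI[OF P(1) flat_cong[OF P(2)]]) (simp add: assms(2))
qed

lemma expansion_weaken: "expansion k N f \<Longrightarrow> N' \<le> N \<Longrightarrow> expansion k N' f"
  by (elim expansionE) (rule expansionI, assumption, rule flat_weaken)

lemma expansion_flat: "flat b k N f \<Longrightarrow> expansion k N f"
  by (rule expansionI[OF sums_of_zero]) simp

lemma expansion_imp_flat:
  assumes "expansion k N f" "N \<ge> 0" shows "flat b k 0 f"
proof -
  obtain P where P: "P \<in> sums_of S_powers" "flat b k N (\<lambda>x. f x - P x)"
    using assms(1) by (rule expansionE)
  from flat_add[OF flat_weaken[OF P(2) assms(2)] flat_S_powers[OF P(1)]] show ?thesis by simp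
qed

lemma expansion_add: 
  assumes "expansion k N f" "expansion k N g" shows "expansion k N (\<lambda>x. f x + g x)"
proof -
  obtain P Q where "P \<in> sums_of S_powers" "flat b k N (\<lambda>x. f x - P x)"
    "Q \<in> sums_of S_powers" "flat b k N (\<lambda>x. g x - Q x)"
    using assms by (elim expansionE)
  then show ?thesis
    using flat_add[of b k N "\<lambda>x. f x - P x" "\<lambda>x. g x - Q x"]
    by (intro expansionI[OF sums_of_add[of P _ Q]]) (auto simp: algebra_simps)
qed

lemma expansion_mult:
  assumes "expansion k N f" "expansion k N g" "N \<ge> 0" shows "expansion k N (\<lambda>x. f x * g x)"
proof -
  obtain P Q where PQ: "P \<in> sums_of S_powers" "flat b k N (\<lambda>x. f x - P x)"
    "Q \<in> sums_of S_powers" "flat b k N (\<lambda>x. g x - Q x)"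
    using assms(1,2) by (elim expansionE)
  have "flat b k N (\<lambda>x. (f x - P x) * g x + P x * (g x - Q x))"
    using flat_mult[OF PQ(2) expansion_imp_flat[OF assms(2,3)]]
      flat_mult[OF flat_S_powers[OF PQ(1)] PQ(4)]
    by (intro flat_add) auto
  then have "flat b k N (\<lambda>x. f x * g x - P x * Q x)" by (simp add: algebra_simps)
  then show ?thesis by (rule expansionI[OF S_powers_mult[OF PQ(1,3)]])
qed

lemma expansion_const: "expansion k N (\<lambda>x. c)"
proof -
  have "flat b k N (\<lambda>x. c - c * S x powr (real 0 * \<gamma> + real 0))"
    by (rule flat_cong[OF flat_zero]) (use S_pos in \<open>auto simp: less_le\<close>)
  then show ?thesis by (rule expansionI[OF sums_of_gen[OF S_powers_I]])
qed

lemma expansion_cmult: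
  assumes "expansion k N f" shows "expansion k N (\<lambda>x. c * f x)"
proof -
  obtain P where P: "P \<in> sums_of S_powers" "flat b k N (\<lambda>x. f x - P x)"
    using assms by (rule expansionE)
  from expansionI[OF S_powers_cmult[OF P(1)], of k N "\<lambda>x. c * f x" c] flat_cmult[OF P(2), of c]
  show ?thesis by (simp add: right_diff_distrib)
qed

lemma expansion_power: "expansion k N f \<Longrightarrow> N \<ge> 0 \<Longrightarrow> expansion k N (\<lambda>x. f x ^ n)"
  by (induction n) (auto intro: expansion_const expansion_mult)

lemma expansion_sum:
  "(\<And>i. i \<in> I \<Longrightarrow> expansion k N (f i)) \<Longrightarrow> expansion k N (\<lambda>x. \<Sum>i\<in>I. f i x)"
  by (induction I rule: infinite_finite_induct) (auto intro: expansion_const expansion_add)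

lemma expansion_mult_S:
  assumes "expansion k N f"
  shows "expansion k (real j * \<gamma> + real l + N) (\<lambda>x. S x powr (real j * \<gamma> + real l) * f x)"
proof -
  obtain P where P: "P \<in> sums_of S_powers" "flat b k N (\<lambda>x. f x - P x)"
    using assms by (rule expansionE)
  show ?thesis
    by (rule expansionI[OF S_powers_mult_S[OF P(1), of j l]])
       (use flat_mult[OF flat_S_powr P(2), of "real j * \<gamma> + real l"] in \<open>simp add: right_diff_distrib\<close>)
qed

text \<open>From order \<open>eps\<close> on, \<open>f\<close> has a limit \<open>c\<close> at 0 and
  \<open>f - c\<close> has order \<open>eps\<close>; a Taylor polynomial at \<open>c\<close> then
  reduces the claim to powers of \<open>f\<close>. An expansion of order 0 guarantees no limit, and
  there only the composition estimate is used.\<close>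

lemma expansion_comp:
  assumes H: "\<And>i y. y \<in> {lo..hi} \<Longrightarrow> (H i has_real_derivative H (Suc i) y) (at y within {lo..hi})"
    and f: "expansion k N f" and N: "N = 0 \<or> N \<ge> eps"
    and r: "\<And>x. x \<in> {0<..b} \<Longrightarrow> f x \<in> {lo..hi}"
  shows "expansion k N (\<lambda>x. H 0 (f x))"
proof (cases "N = 0")
  case True
  have lo: "lo \<in> {lo..hi}" using r[of b] b by auto
  have "flat b k 0 f" using expansion_imp_flat f True by auto
  then have "flat b k 0 (\<lambda>x. f x - lo)" by (intro flat_diff flat_const)
  from flat_taylor[where H = H and J = 0, OF _ lo this] H r have "flat b k 0 (\<lambda>x. H 0 (f x))"
    by simp
  then show ?thesis using True by (intro expansion_flat) simp
next
  case False
  then have N: "N \<ge> eps" "N \<ge> 0" using N eps by auto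
  obtain P where P: "P \<in> sums_of S_powers" "flat b k N (\<lambda>x. f x - P x)"
    using f by (rule expansionE)
  obtain c where c: "flat b k eps (\<lambda>x. P x - c)" using S_powers_limit[OF P(1)] by blast
  have fc: "flat b k eps (\<lambda>x. f x - c)"
    using flat_add[OF flat_weaken[OF P(2) N(1)] c] by simp
  have clim: "(f \<longlongrightarrow> c) (at_right 0)"
    using flat_tendsto_0[OF b fc eps(1)] by (simp add: LIM_zero_iff)
  have ev: "\<forall>\<^sub>F x in at_right 0. f x \<in> {lo..hi}"
    using r b by (auto simp: eventually_at_right_field)
  \<comment> \<open>The centre must lie where \<open>H\<close> is differentiable; it does, as a
    limit of values of \<open>f\<close>.\<close>
  have cin: "c \<in> {lo..hi}"
    using tendsto_lowerbound[OF clim eventually_mono[OF ev]] tendsto_upperbound[OF clim eventually_mono[OF ev]]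
    by simp
  obtain J where J: "N \<le> real J * eps" using eps(1) by (meson ex_less_of_nat_mult less_imp_le)
  have rem: "flat b k N (\<lambda>x. H 0 (f x) - (\<Sum>j<J. H j c / fact j * (f x - c) ^ j))"
    by (rule flat_weaken[OF flat_taylor[where H = H, OF _ cin fc]]) (use H r J eps in auto)
  have "expansion k N (\<lambda>x. f x + (- c))" by (intro expansion_add f expansion_const)
  then have "expansion k N (\<lambda>x. \<Sum>j<J. H j c / fact j * (f x - c) ^ j)"
    using N by (intro expansion_sum expansion_cmult expansion_power) auto
  from expansion_add[OF expansion_flat[OF rem] this] show ?thesis by simp
qed

lemma expansion_powr:
  assumes f: "expansion k N f" and N: "N = 0 \<or> N \<ge> eps"
    and lo: "lo > 0" "\<And>x. x \<in> {0<..b} \<Longrightarrow> lo \<le> f x"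
  shows "expansion k N (\<lambda>x. f x powr a)"
proof -
  have "flat b k 0 f" using expansion_imp_flat[OF f] N eps by auto
  then obtain C where C: "C > 0" "\<And>x. x \<in> {0<..b} \<Longrightarrow> \<bar>f x\<bar> \<le> C * x powr 0"
    using flat_bound by blast
  obtain H where H: "\<forall>i. \<forall>y\<in>{lo..C}. (H i has_real_derivative H (Suc i) y) (at y within {lo..C})"
    "H 0 = (\<lambda>y. y powr a)" using powr_family[OF lo(1)] by meson
  have "expansion k N (\<lambda>x. H 0 (f x))"
  proof (rule expansion_comp[where lo = lo and hi = C, OF _ f N])
    show "f x \<in> {lo..C}" if "x \<in> {0<..b}" for x
      using lo(2)[OF that] C(2)[OF that] that by auto
  qed (use H in blast)
  then show ?thesis by (simp add: H(2))
qed

text \<open>Taylor polynomial in x, with x = S * (x / S) expanded in turn.\<close>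

lemma expansion_dW:
  assumes x: "expansion k N (\<lambda>x. x / S x)" and N: "N \<ge> 0"
  shows "expansion k N (dW n)"
proof -
  have "expansion k N (\<lambda>x. S x powr (real 0 * \<gamma> + real 1) * (x / S x))"
    by (rule expansion_weaken[OF expansion_mult_S[OF x]]) simp
  then have x: "expansion k N (\<lambda>x. x)"
    by (rule expansion_cong) (use S_pos in \<open>auto simp: less_le\<close>)
  obtain J where J: "N \<le> real J" by (meson real_arch_simple)
  have "expansion k N (\<lambda>x. \<Sum>j<J. dW (n + j) 0 / fact j * x ^ j)"
    by (rule expansion_sum, rule expansion_cmult, rule expansion_power[OF x N])
  from expansion_add[OF expansion_flat[OF flat_weaken[OF flat_dW_taylor J]] this, of n]
  show ?thesis by simp
qed

lemma x_div_S_ge: obtains lo where "lo > 0" "\<And>x. x \<in> {0<..b} \<Longrightarrow> lo \<le> x / S x"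
proof -
  obtain C where C: "C > 0" "\<And>x. x \<in> {0<..b} \<Longrightarrow> \<bar>S x / x\<bar> \<le> C * x powr 0"
    using flat_bound[OF flat_S_div_x] by blast
  have "1 / C \<le> x / S x" if "x \<in> {0<..b}" for x
    using C(2)[OF that] C(1) S_pos[OF that] that by (simp add: field_simps)
  then show thesis using C(1) that[of "1 / C"] by auto
qed

text \<open>The gain comes from V = S^\<gamma> (x / S)^\<gamma> W: the prefactor raises the order of
  the remainder by \<gamma>, which is at least \<open>eps\<close>.\<close>

lemma expansion_E_V_powr:
  assumes x: "expansion k N (\<lambda>x. x / S x)" and N: "N = 0 \<or> N \<ge> eps"
  shows "expansion k (N + eps) (\<lambda>x. (E - V x) powr a)"
proof (rule expansion_powr)
  have N0: "N \<ge> 0" using N eps by auto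
  obtain lo where lo: "lo > 0" "\<And>x. x \<in> {0<..b} \<Longrightarrow> lo \<le> x / S x" using x_div_S_ge by blast
  have "expansion k (real 1 * \<gamma> + real 0 + N)
      (\<lambda>x. S x powr (real 1 * \<gamma> + real 0) * ((x / S x) powr \<gamma> * dW 0 x))"
    by (rule expansion_mult_S, rule expansion_mult[OF expansion_powr[OF x N lo] expansion_dW[OF x N0] N0])
  then have "expansion k (N + eps) (\<lambda>x. S x powr (real 1 * \<gamma> + real 0) * ((x / S x) powr \<gamma> * dW 0 x))"
    by (rule expansion_weaken) (use eps in auto)
  then have "expansion k (N + eps) V"
    by (rule expansion_cong)
       (use S_pos in \<open>auto simp: powr_divide less_imp_le V_eq W_eq field_simps less_le\<close>)
  from expansion_add[OF expansion_const expansion_cmult[OF this, of "-1"], of E]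
  show "expansion k (N + eps) (\<lambda>x. E - V x)" by simp
  show "\<delta> \<le> E - V x" if "x \<in> {0<..b}" for x using gap that by auto
qed (use N eps delta in auto)

text \<open>As p dx = dS, powers of \<open>S\<close> integrate like monomials; their exponents a are
  nonnegative, so a + 1 is never 0. The factor \<open>S\<close> is kept apart because
  \<open>Q\<close> is to approximate x / S.\<close>

lemma S_powers_integrate:
  assumes "P \<in> sums_of S_powers"
  shows "\<exists>Q\<in>sums_of S_powers. \<forall>x\<in>{0<..b}.
    ((\<lambda>x. S x * Q x) has_real_derivative P x * p x) (at x within {0<..b})"
  using assms
proof induction
  case sums_of_zero
  show ?case by (rule bexI[OF _ sums_of.sums_of_zero]) simp
next
  case (sums_of_gen f)
  then obtain c j l where f: "f = (\<lambda>x. c * S x powr (real j * \<gamma> + real l))"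
    by (auto simp: S_powers_def)
  define a where "a = real j * \<gamma> + real l"
  have a: "a \<ge> 0" using gamma by (simp add: a_def)
  have "((\<lambda>x. S x * (c / (a + 1) * S x powr a)) has_real_derivative f x * p x) (at x within {0<..b})"
    if x: "x \<in> {0<..b}" for x
  proof -
    have "((\<lambda>x. S x powr a) has_real_derivative a * S x powr (a - 1) * p x) (at x within {0<..b})"
      using S_pos[OF x] x by (auto intro!: derivative_eq_intros S_deriv)
    from DERIV_mult[OF S_deriv[OF x] DERIV_cmult[OF this, of "c / (a + 1)"]]
    have "((\<lambda>x. S x * (c / (a + 1) * S x powr a)) has_real_derivative
        p x * (c / (a + 1) * S x powr a) + S x * (c / (a + 1) * (a * S x powr (a - 1) * p x)))
        (at x within {0<..b})"
      by (simp only: mult.commute)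
    moreover have "S x powr a = S x powr (a - 1) * S x"
      using S_pos[OF x] by (simp add: powr_diff)
    then have "p x * (c / (a + 1) * S x powr a) + S x * (c / (a + 1) * (a * S x powr (a - 1) * p x))
       = c / (a + 1) * (a + 1) * (S x powr a * p x)"
      by (simp only:) (simp add: algebra_simps add_divide_distrib)
    moreover have "c / (a + 1) * (a + 1) = c" using a by simp
    ultimately show ?thesis by (simp add: f a_def mult.assoc)
  qed
  moreover have "(\<lambda>x. c / (a + 1) * S x powr a) \<in> sums_of S_powers"
    unfolding a_def by (intro sums_of.sums_of_gen S_powers_I)
  ultimately show ?case by (intro bexI[where x = "\<lambda>x. c / (a + 1) * S x powr a"] ballI)
next
  case (sums_of_add f g)
  then obtain Q R where QR: "Q \<in> sums_of S_powers" "R \<in> sums_of S_powers"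
    "\<forall>x\<in>{0<..b}. ((\<lambda>x. S x * Q x) has_real_derivative f x * p x) (at x within {0<..b})"
    "\<forall>x\<in>{0<..b}. ((\<lambda>x. S x * R x) has_real_derivative g x * p x) (at x within {0<..b})"
    by (elim bexE)
  have "((\<lambda>x. S x * (Q x + R x)) has_real_derivative (f x + g x) * p x) (at x within {0<..b})"
    if "x \<in> {0<..b}" for x
    using DERIV_add[OF QR(3)[rule_format, OF that] QR(4)[rule_format, OF that]]
    by (simp add: distrib_left distrib_right)
  then show ?case by (intro bexI[OF _ sums_of.sums_of_add[OF QR(1,2)]] ballI)
qed

text \<open>The bootstrap: \<open>dx / dS = 1 / p\<close> is a smooth function of \<open>x\<close> and \<open>V\<close>, so knowing
  \<open>x / S\<close> up to order \<open>N\<close> determines \<open>V\<close>, hence \<open>x / S\<close>, up to order \<open>N + min 1 \<gamma>\<close>.\<close>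

lemma expansion_x_div_S_step:
  assumes x: "expansion k N (\<lambda>x. x / S x)" and N: "N = 0 \<or> N \<ge> eps"
  shows "expansion k (N + eps) (\<lambda>x. x / S x)"
proof -
  define M where "M = N + eps"
  have M: "M \<ge> 0" using N eps by (auto simp: M_def)
  obtain P where P: "P \<in> sums_of S_powers" "flat b k M (\<lambda>x. (E - V x) powr (-1/2) - P x)"
    using expansion_E_V_powr[OF assms] unfolding M_def[symmetric] by (rule expansionE)
  obtain Q where Q: "Q \<in> sums_of S_powers"
    "\<And>x. x \<in> {0<..b} \<Longrightarrow> ((\<lambda>x. S x * Q x) has_real_derivative P x * p x) (at x within {0<..b})"
    using S_powers_integrate[OF P(1)] by blast
  define D where "D = (\<lambda>x. x - S x * Q x)"
  have "flat b k (M + 0) (\<lambda>x. ((E - V x) powr (-1/2) - P x) * p x)"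
    by (intro flat_mult P flat_p)
  then have "flat b k M (\<lambda>x. ((E - V x) powr (-1/2) - P x) * p x)" by simp
  \<comment> \<open>The derivative of x - S Q is 1 - P p, which is p times the error of
    \<open>P\<close> as an approximation of 1 / p.\<close>
  then have fl: "flat b k M (\<lambda>x. 1 - P x * p x)"
  proof (rule flat_cong)
    fix x assume "x \<in> {0<..b}"
    then have "x \<in> {0..b}" by auto
    then show "((E - V x) powr (-1/2) - P x) * p x = 1 - P x * p x"
      using E_V_pos[of x] by (simp add: p_eq_powr left_diff_distrib flip: powr_add)
  qed
  \<comment> \<open>Integration gains the order that division by \<open>S\<close> loses again, so x
    / S inherits the order of 1 / p.\<close>
  have "flat b (Suc k) (M + 1) D"
  proof (rule flat_antiderivative[OF fl])
    have "flat b k (1 + 0) (\<lambda>x. S x * Q x)"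
      by (intro flat_mult flat_S flat_S_powers Q)
    from flat_diff[OF flat_ident this[simplified]] have "flat b k 1 D" by (simp add: D_def)
    then show "(D \<longlongrightarrow> 0) (at_right 0)" by (rule flat_tendsto_0[OF b]) simp
    show "(D has_real_derivative 1 - P x * p x) (at x within {0<..b})" if "x \<in> {0<..b}" for x
      unfolding D_def by (intro DERIV_diff DERIV_ident Q(2) that)
  qed (use M in auto)
  from flat_mult[OF flat_dec[OF this] flat_S_powr[of k "-1"]]
  have "flat b k M (\<lambda>x. D x * S x powr (-1))" by simp
  then have "flat b k M (\<lambda>x. x / S x - Q x)"
  proof (rule flat_cong)
    show "D x * S x powr (-1) = x / S x - Q x" if "x \<in> {0<..b}" for x
      using S_pos[OF that] by (simp add: D_def powr_minus field_simps)
  qed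
  then show ?thesis unfolding M_def[symmetric] by (rule expansionI[OF Q(1)])
qed

lemma expansion_x_div_S: "expansion k N (\<lambda>x. x / S x)"
proof -
  have *: "expansion k (real n * eps) (\<lambda>x. x / S x)" for n
  proof (induction n)
    case 0
    show ?case using expansion_flat[OF flat_x_div_S] by simp
  next
    case (Suc n)
    have "real n * eps = 0 \<or> real n * eps \<ge> eps"
      using eps(1) by (cases n) (auto simp: mult_le_cancel_right1)
    then show ?case using expansion_x_div_S_step[OF Suc.IH] by (simp add: algebra_simps)
  qed
  obtain n where "N \<le> real n * eps" using eps(1) by (meson ex_less_of_nat_mult less_imp_le)
  then show ?thesis using expansion_weaken[OF *] by blast
qed

text \<open>S r equals S^\<gamma> times factors that expand to any order. This prefactor accounts
  for \<open>j \<ge> 1\<close>, the condition that later keeps exponents away from the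
  integers.\<close>

lemma r_expansion:
  "\<exists>P\<in>sums_of {\<lambda>x. c * S x powr (real j * \<gamma> + real l) | c j l. j \<ge> 1}.
    flat b k N (\<lambda>x. S x * r x - P x)"
proof -
  \<comment> \<open>Real powers of expandable functions are available at order 0 or from
    \<open>eps\<close> on.\<close>
  define M where "M = max N eps"
  have M: "M = 0 \<or> M \<ge> eps" "M \<ge> 0" "M \<ge> N" using eps by (auto simp: M_def)
  obtain lo where lo: "lo > 0" "\<And>x. x \<in> {0<..b} \<Longrightarrow> lo \<le> x / S x" using x_div_S_ge by blast
  note xS = expansion_x_div_S[of k M]
  have x: "expansion k M (\<lambda>x. x)"
  proof (rule expansion_cong)
    show "expansion k M (\<lambda>x. S x powr (real 0 * \<gamma> + real 1) * (x / S x))"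
      by (rule expansion_weaken[OF expansion_mult_S[OF xS]]) simp
  qed (use S_pos in \<open>auto simp: less_le\<close>)
  have EV: "expansion k M (\<lambda>x. (E - V x) powr (- 3 / 2))"
    by (rule expansion_weaken[OF expansion_E_V_powr[OF xS M(1)]]) (use eps in auto)
  have "expansion k M (\<lambda>x. (- 1 / 4) * ((x / S x) powr (\<gamma> - 1) * (\<gamma> * dW 0 x + x * dW 1 x) *
      (E - V x) powr (- 3 / 2)))"
    by (intro expansion_cmult expansion_mult expansion_add expansion_powr[OF xS M(1) lo]
        expansion_dW[OF xS] x M(2) EV)
  then obtain P where P: "P \<in> sums_of S_powers"
    "flat b k M (\<lambda>x. (- 1 / 4) * ((x / S x) powr (\<gamma> - 1) * (\<gamma> * dW 0 x + x * dW 1 x) *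
      (E - V x) powr (- 3 / 2)) - P x)"
    by (rule expansionE)
  let ?G = "{\<lambda>x. c * S x powr (real j * \<gamma> + real l) | c j l. j \<ge> 1}"
  have "(\<lambda>x. S x powr \<gamma> * P x) \<in> sums_of ?G"
    using P(1)
  proof (rule sums_of_map)
    fix g assume "g \<in> S_powers"
    then obtain c j l where g: "g = (\<lambda>x. c * S x powr (real j * \<gamma> + real l))"
      by (auto simp: S_powers_def)
    then have "(\<lambda>x. S x powr \<gamma> * g x) = (\<lambda>x. c * S x powr (real (j + 1) * \<gamma> + real l))"
      by (auto simp: fun_eq_iff algebra_simps simp flip: powr_add)
    then have "(\<lambda>x. S x powr \<gamma> * g x) \<in> ?G"
      unfolding mem_Collect_eq by (intro exI[of _ c] exI[of _ "j + 1"] exI[of _ l]) simp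
    then show "(\<lambda>x. S x powr \<gamma> * g x) \<in> sums_of ?G" by (rule sums_of_gen)
  qed (auto simp: distrib_left)
  moreover have "flat b k (\<gamma> + M) (\<lambda>x. S x powr \<gamma> * ((- 1 / 4) * ((x / S x) powr (\<gamma> - 1) *
      (\<gamma> * dW 0 x + x * dW 1 x) * (E - V x) powr (- 3 / 2)) - P x))"
    by (intro flat_mult flat_S_powr P(2))
  then have "flat b k (\<gamma> + M) (\<lambda>x. S x * r x - S x powr \<gamma> * P x)"
  proof (rule flat_cong)
    fix x assume x: "x \<in> {0<..b}"
    then have "S x powr \<gamma> * (x / S x) powr (\<gamma> - 1) = S x * x powr (\<gamma> - 1)"
      using S_pos[OF x] by (simp add: powr_divide less_imp_le powr_diff)
    then show "S x powr \<gamma> * ((- 1 / 4) * ((x / S x) powr (\<gamma> - 1) *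
      (\<gamma> * dW 0 x + x * dW 1 x) * (E - V x) powr (- 3 / 2)) - P x) = S x * r x - S x powr \<gamma> * P x"
      by (simp add: r_def W1_def right_diff_distrib flip: mult.assoc)
  qed
  then have "flat b k N (\<lambda>x. S x * r x - S x powr \<gamma> * P x)"
    by (rule flat_weaken) (use M gamma in auto)
  ultimately show ?thesis by (intro bexI[where x = "\<lambda>x. S x powr \<gamma> * P x"])
qed

lemma flat_r: "flat b k (\<gamma> - 1) r"
proof -
  have "flat b k (\<gamma> - 1 + 0 + 0) (\<lambda>x. (- 1 / 4) * x powr (\<gamma> - 1) * W1 x * (E - V x) powr (- 3 / 2))"
    unfolding W1_def
    by (intro flat_mult flat_powr flat_E_V_powr flat_add flat_cmult flat_dW
        flat_weaken[OF flat_mult[OF flat_ident flat_dW]]) auto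
  then show ?thesis unfolding r_def[abs_def] by simp
qed

text \<open>Identifies p r with q = p' / (2 p).\<close>

lemma p_deriv:
  assumes x: "x \<in> {0<..b}"
  shows "(p has_real_derivative 2 * p x * (p x * r x)) (at x within {0<..b})"
proof -
  have "(dW 0 has_real_derivative dW 1 x) (at x within {0<..b})"
    using dW[of x 0] x by (auto intro: DERIV_subset)
  then have "((\<lambda>x. x powr \<gamma> * dW 0 x) has_real_derivative
      \<gamma> * x powr (\<gamma> - 1) * dW 0 x + x powr \<gamma> * dW 1 x) (at x within {0<..b})"
    using x by (auto intro!: derivative_eq_intros)
  also have "\<gamma> * x powr (\<gamma> - 1) * dW 0 x + x powr \<gamma> * dW 1 x = x powr (\<gamma> - 1) * W1 x"
    using x by (simp add: W1_def powr_diff field_simps)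
  finally have "(V has_real_derivative x powr (\<gamma> - 1) * W1 x) (at x within {0<..b})"
    unfolding has_field_derivative_def
    by (rule has_derivative_transform[OF x, rotated]) (auto simp: V_eq W_eq)
  then have "(p has_real_derivative - (x powr (\<gamma> - 1) * W1 x) * inverse (sqrt (E - V x)) / 2)
      (at x within {0<..b})"
    unfolding p_def using E_V_pos[of x] x by (auto intro!: derivative_eq_intros)
  moreover have "- (x powr (\<gamma> - 1) * W1 x) * inverse (sqrt (E - V x)) / 2 = 2 * p x * (p x * r x)"
  proof -
    have "E - V x > 0" using E_V_pos[of x] x by auto
    then have "inverse (sqrt (E - V x)) = (E - V x) powr (- (1 / 2))"
      by (simp add: powr_minus powr_half_sqrt)
    also have "\<dots> = (E - V x) powr (1/2) * (E - V x) powr (1/2) * (E - V x) powr (- 3 / 2)"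
      by (simp only: powr_add[symmetric]) simp
    finally show ?thesis using x by (simp add: r_def p_eq_powr)
  qed
  ultimately show ?thesis by simp
qed

end

section \<open>Homogeneous oscillatory integrals\<close>

lemma has_vector_derivative_cis_phase:
  assumes "(\<theta> has_real_derivative d) (at x within A)"
  shows "((\<lambda>x. cis (\<theta> x)) has_vector_derivative of_real d * \<i> * cis (\<theta> x)) (at x within A)"
  using assms unfolding has_vector_derivative_complex_iff
  by (auto intro!: derivative_eq_intros simp: has_real_derivative_iff_has_vector_derivative[symmetric])

lemma has_vector_derivative_of_real_powr:
  assumes "t > 0"
  shows "((\<lambda>t. complex_of_real (t powr a)) has_vector_derivative of_real (a * t powr (a - 1))) (at t within A)"
proof (rule has_vector_derivative_of_real)
  show "((\<lambda>t. t powr a) has_real_derivative a * t powr (a - 1)) (at t within A)"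
    using assms by (auto intro!: derivative_eq_intros)
qed

text \<open>The derivative is integrable at infinity, so \<open>F\<close> satisfies the Cauchy
  criterion there. The limit supplies the constant term of an expansion at infinity, for which no
  formula is required.\<close>

lemma converges_at_infinity:
  fixes F :: "real \<Rightarrow> 'a::banach"
  assumes L: "L > 0"
    and der: "\<And>t. t \<ge> 1 \<Longrightarrow> (F has_vector_derivative d t) (at t)"
    and bd: "\<And>t. t \<ge> 1 \<Longrightarrow> norm (d t) \<le> C * t powr (- L - 1)"
  shows "\<exists>c. \<forall>t\<ge>1. norm (F t - c) \<le> C / L * t powr (- L)"
proof -
  have "0 \<le> norm (d 1)" by simp
  also have "\<dots> \<le> C" using bd[of 1] by simp
  finally have C: "C \<ge> 0" .
  have *: "norm (F t - F s) \<le> C / L * s powr (- L)" if st: "1 \<le> s" "s \<le> t" for s t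
  proof (cases "s = t")
    case True
    then show ?thesis using C L by simp
  next
    case False
    have "norm (F t - F s) \<le> - (C / L) * t powr (- L) - - (C / L) * s powr (- L)"
    proof (rule differentiable_bound_general[where f' = d and \<phi>' = "\<lambda>t. C * t powr (- L - 1)"])
      show "continuous_on {s..t} F"
        using der st by (meson atLeastAtMost_iff continuous_at_imp_continuous_on
            has_vector_derivative_continuous order_trans)
      show "continuous_on {s..t} (\<lambda>t. - (C / L) * t powr (- L))"
        using st L by (auto intro!: continuous_intros)
      fix x assume x: "s < x" "x < t"
      show "((\<lambda>t. - (C / L) * t powr (- L)) has_vector_derivative C * x powr (- L - 1)) (at x)"
        unfolding has_real_derivative_iff_has_vector_derivative[symmetric]
        using x st L by (auto intro!: derivative_eq_intros)
    qed (use st False der bd in auto)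
    also have "\<dots> \<le> C / L * s powr (- L)" using C L by simp
    finally show ?thesis .
  qed
  define X where "X n = F (real (Suc n))" for n
  have lim0: "(\<lambda>n. C / L * real (Suc n) powr (- L)) \<longlonglongrightarrow> C / L * 0"
    by (intro tendsto_intros tendsto_neg_powr filterlim_compose[OF filterlim_real_sequentially filterlim_Suc])
      (use L in simp)
  have "Cauchy X"
  proof (rule CauchyI)
    fix e :: real assume e: "0 < e"
    have "\<forall>\<^sub>F n in sequentially. C / L * real (Suc n) powr (- L) < e / 2"
      using order_tendstoD(2)[OF lim0, of "e / 2"] e by simp
    then obtain M where M: "C / L * real (Suc M) powr (- L) < e / 2"
      by (meson eventually_sequentially order_refl)
    have "norm (X m - X M) < e / 2" if "m \<ge> M" for m
    proof -
      have "norm (X m - X M) \<le> C / L * real (Suc M) powr (- L)"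
        unfolding X_def by (rule *) (use that in auto)
      then show ?thesis using M by linarith
    qed
    then have "norm (X m - X n) < e" if "m \<ge> M" "n \<ge> M" for m n
      using norm_triangle_lt[of "X m - X M" "X M - X n" e] that
      by (metis (no_types, lifting) add_strict_mono diff_add_cancel field_sum_of_halves
          norm_diff_triangle_less norm_minus_commute)
    then show "\<exists>M. \<forall>m\<ge>M. \<forall>n\<ge>M. norm (X m - X n) < e" by blast
  qed
  then obtain c where c: "X \<longlonglongrightarrow> c" by (auto simp: Cauchy_convergent_iff convergent_def)
  have "norm (F t - c) \<le> C / L * t powr (- L)" if t: "t \<ge> 1" for t
  proof -
    have "(\<lambda>n. norm (X n - F t)) \<longlonglongrightarrow> norm (c - F t)" by (intro tendsto_intros c)
    moreover have "\<forall>\<^sub>F n in sequentially. norm (X n - F t) \<le> C / L * t powr (- L)"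
    proof -
      have "\<forall>\<^sub>F n in sequentially. t \<le> real (Suc n)"
        by (meson eventually_sequentiallyI le_SucI nat_le_real_less real_arch_simple of_nat_le_iff order_trans)
      then show ?thesis by eventually_elim (use * t in \<open>auto simp: X_def\<close>)
    qed
    ultimately show ?thesis
      using tendsto_upperbound[of "\<lambda>n. norm (X n - F t)" "norm (c - F t)" sequentially]
      by (simp add: norm_minus_commute)
  qed
  then show ?thesis by blast
qed

text \<open>The integer \<open>l\<close> has no lower bound because each integration by parts lowers
  the exponent by 1; \<open>j \<ge> 1\<close> keeps the exponents nonzero for irrational
  \<gamma>.\<close>

definition inf_powers :: "real \<Rightarrow> nat \<Rightarrow> nat \<Rightarrow> (real \<Rightarrow> complex) set" where
  "inf_powers \<gamma> m n = {\<lambda>t. c * of_real (t powr (real j * \<gamma> + of_int l)) | c j l.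
     1 \<le> j \<and> j \<le> m \<and> l \<le> int n}"

lemma inf_powers_I:
  "1 \<le> j \<Longrightarrow> j \<le> m \<Longrightarrow> l \<le> int n \<Longrightarrow>
    (\<lambda>t. c * of_real (t powr (real j * \<gamma> + of_int l))) \<in> inf_powers \<gamma> m n"
  unfolding inf_powers_def by blast

lemma inf_powers_E:
  assumes "f \<in> inf_powers \<gamma> m n"
  obtains c j l where "f = (\<lambda>t. c * of_real (t powr (real j * \<gamma> + of_int l)))"
    "1 \<le> j" "j \<le> m" "l \<le> int n"
  using assms unfolding inf_powers_def by blast

text \<open>\<open>PH \<gamma> \<zeta> m n g\<close>: as \<open>t \<rightarrow> \<infinity>\<close>, \<open>g\<close> expands into a constant and terms
  \<open>t\<^sup>j\<^sup>\<gamma>\<^sup>+\<^sup>l\<close> and \<open>t\<^sup>j\<^sup>\<gamma>\<^sup>+\<^sup>l exp(2 i \<zeta> t)\<close> with \<open>j \<ge> 1\<close>; so \<open>h\<^sup>m\<^sup>\<gamma>\<^sup>+\<^sup>n g(s / h)\<close> involves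
  only powers \<open>h\<^sup>j\<^sup>\<gamma>\<^sup>+\<^sup>l\<close> with \<open>j, l \<ge> 0\<close>.\<close>

definition PH :: "real \<Rightarrow> real \<Rightarrow> nat \<Rightarrow> nat \<Rightarrow> (real \<Rightarrow> complex) \<Rightarrow> bool" where
  "PH \<gamma> \<zeta> m n g \<longleftrightarrow> continuous_on {0<..} g \<and> (\<exists>B. \<forall>t\<in>{0<..1}. norm (g t) \<le> B) \<and>
     (\<forall>L::nat. \<exists>c. \<exists>P\<in>sums_of (inf_powers \<gamma> m n). \<exists>Q\<in>sums_of (inf_powers \<gamma> m n). \<exists>C.
        \<forall>t\<ge>1. norm (g t - (c + P t + cis (2 * \<zeta> * t) * Q t)) \<le> C * t powr (- real L))"

lemma PH_one: "PH \<gamma> \<zeta> 0 0 (\<lambda>t. 1)"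
  unfolding PH_def
proof (intro conjI allI)
  show "\<exists>c. \<exists>P\<in>sums_of (inf_powers \<gamma> 0 0). \<exists>Q\<in>sums_of (inf_powers \<gamma> 0 0). \<exists>C.
        \<forall>t\<ge>1. norm (1 - (c + P t + cis (2 * \<zeta> * t) * Q t)) \<le> C * t powr (- real L)" for L
    by (intro exI[of _ 1] bexI[OF _ sums_of_zero] exI[of _ 0]) auto
qed auto

text \<open>Antidifferentiation at infinity up to a derivative error O(t^(-L-1)), which
  \<open>converges_at_infinity\<close> converts into a constant plus O(t^(-L)). The notion is
  additive in \<open>w\<close>, so integrands are treated term by term.\<close>

definition prim :: "real \<Rightarrow> real \<Rightarrow> nat \<Rightarrow> nat \<Rightarrow> real \<Rightarrow> (real \<Rightarrow> complex) \<Rightarrow> bool" where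
  "prim \<gamma> \<zeta> m n L w \<longleftrightarrow> (\<exists>P\<in>sums_of (inf_powers \<gamma> m n). \<exists>Q\<in>sums_of (inf_powers \<gamma> m n). \<exists>d C.
     \<forall>t\<ge>1. ((\<lambda>t. P t + cis (2 * \<zeta> * t) * Q t) has_vector_derivative d t) (at t) \<and>
       norm (d t - w t) \<le> C * t powr (- L - 1))"

lemma primI:
  assumes "P \<in> sums_of (inf_powers \<gamma> m n)" "Q \<in> sums_of (inf_powers \<gamma> m n)"
    "\<And>t. t \<ge> 1 \<Longrightarrow> ((\<lambda>t. P t + cis (2 * \<zeta> * t) * Q t) has_vector_derivative d t) (at t)"
    "\<And>t. t \<ge> 1 \<Longrightarrow> norm (d t - w t) \<le> C * t powr (- L - 1)"
  shows "prim \<gamma> \<zeta> m n L w"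
  unfolding prim_def
  by (rule bexI[OF _ assms(1)], rule bexI[OF _ assms(2)], rule exI[of _ d], rule exI[of _ C])
     (use assms(3,4) in blast)

lemma primE:
  assumes "prim \<gamma> \<zeta> m n L w"
  obtains P Q d C where "P \<in> sums_of (inf_powers \<gamma> m n)" "Q \<in> sums_of (inf_powers \<gamma> m n)"
    "\<forall>t\<ge>1. ((\<lambda>t. P t + cis (2 * \<zeta> * t) * Q t) has_vector_derivative d t) (at t)"
    "\<forall>t\<ge>1. norm (d t - w t) \<le> C * t powr (- L - 1)"
proof -
  from assms obtain P Q d C where "P \<in> sums_of (inf_powers \<gamma> m n)" "Q \<in> sums_of (inf_powers \<gamma> m n)"
    and *: "\<forall>t\<ge>1. ((\<lambda>t. P t + cis (2 * \<zeta> * t) * Q t) has_vector_derivative d t) (at t) \<and>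
       norm (d t - w t) \<le> C * t powr (- L - 1)"
    unfolding prim_def by (elim bexE exE)
  then show thesis by (intro that[of P Q d C]) auto
qed

lemma prim_small:
  assumes "\<And>t. t \<ge> 1 \<Longrightarrow> norm (w t) \<le> C * t powr (- L - 1)"
  shows "prim \<gamma> \<zeta> m n L w"
  by (rule primI[OF sums_of_zero sums_of_zero, where d = "\<lambda>t. 0" and C = C]) (use assms in auto)

lemma prim_add:
  assumes "prim \<gamma> \<zeta> m n L w" "prim \<gamma> \<zeta> m n L w'"
  shows "prim \<gamma> \<zeta> m n L (\<lambda>t. w t + w' t)"
proof -
  obtain P Q d C where 1: "P \<in> sums_of (inf_powers \<gamma> m n)" "Q \<in> sums_of (inf_powers \<gamma> m n)"
    "\<forall>t\<ge>1. ((\<lambda>t. P t + cis (2 * \<zeta> * t) * Q t) has_vector_derivative d t) (at t)"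
    "\<forall>t\<ge>1. norm (d t - w t) \<le> C * t powr (- L - 1)"
    using assms(1) by (rule primE)
  obtain P' Q' d' C' where 2: "P' \<in> sums_of (inf_powers \<gamma> m n)" "Q' \<in> sums_of (inf_powers \<gamma> m n)"
    "\<forall>t\<ge>1. ((\<lambda>t. P' t + cis (2 * \<zeta> * t) * Q' t) has_vector_derivative d' t) (at t)"
    "\<forall>t\<ge>1. norm (d' t - w' t) \<le> C' * t powr (- L - 1)"
    using assms(2) by (rule primE)
  show ?thesis
  proof (rule primI[OF sums_of_add[OF 1(1) 2(1)] sums_of_add[OF 1(2) 2(2)]])
    fix t :: real assume t: "t \<ge> 1"
    have "(\<lambda>t. P t + P' t + cis (2 * \<zeta> * t) * (Q t + Q' t))
      = (\<lambda>t. (P t + cis (2 * \<zeta> * t) * Q t) + (P' t + cis (2 * \<zeta> * t) * Q' t))"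
      by (simp add: fun_eq_iff algebra_simps)
    then show "((\<lambda>t. P t + P' t + cis (2 * \<zeta> * t) * (Q t + Q' t)) has_vector_derivative d t + d' t) (at t)"
      using has_vector_derivative_add[OF 1(3)[rule_format, OF t] 2(3)[rule_format, OF t]] by simp
    have "norm (d t + d' t - (w t + w' t)) \<le> norm (d t - w t) + norm (d' t - w' t)"
      by (rule norm_diff_triangle_ineq)
    also have "\<dots> \<le> (C + C') * t powr (- L - 1)"
      using 1(4)[rule_format, OF t] 2(4)[rule_format, OF t] by (simp add: distrib_right)
    finally show "norm (d t + d' t - (w t + w' t)) \<le> (C + C') * t powr (- L - 1)" .
  qed
qed

lemma prim_cong:
  assumes "prim \<gamma> \<zeta> m n L w" "\<And>t. t \<ge> 1 \<Longrightarrow> w t = w' t"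
  shows "prim \<gamma> \<zeta> m n L w'"
proof -
  obtain P Q d C where 1: "P \<in> sums_of (inf_powers \<gamma> m n)" "Q \<in> sums_of (inf_powers \<gamma> m n)"
    "\<forall>t\<ge>1. ((\<lambda>t. P t + cis (2 * \<zeta> * t) * Q t) has_vector_derivative d t) (at t)"
    "\<forall>t\<ge>1. norm (d t - w t) \<le> C * t powr (- L - 1)"
    using assms(1) by (rule primE)
  show ?thesis by (rule primI[OF 1(1,2) 1(3)[rule_format]]) (use 1(4) assms(2) in auto)
qed

lemma irrational_combination:
  assumes "\<gamma> \<notin> \<rat>" "1 \<le> (j::nat)"
  shows "real j * \<gamma> + of_int l \<noteq> 0"
proof
  assume "real j * \<gamma> + of_int l = 0"
  then have "\<gamma> = of_int (- l) / of_nat j" using assms(2) by (simp add: field_simps)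
  also have "\<dots> \<in> \<rat>" by (intro Rats_divide Rats_of_int Rats_of_nat)
  finally show False using assms(1) by contradiction
qed

text \<open>Irrationality acts here: the primitive divides by j \<gamma> + l, which is nonzero for
  \<open>j \<ge> 1\<close>.\<close>

lemma prim_power:
  assumes irr: "\<gamma> \<notin> \<rat>" and j: "1 \<le> j" "j \<le> m" "l \<le> int n"
  shows "prim \<gamma> \<zeta> m n L (\<lambda>t. c * of_real (t powr (real j * \<gamma> + of_int l - 1)))"
proof -
  define a where "a = real j * \<gamma> + of_int l"
  have a: "a \<noteq> 0" using irrational_combination[OF irr j(1)] by (simp add: a_def)
  have "(\<lambda>t. c / of_real a * of_real (t powr a)) \<in> sums_of (inf_powers \<gamma> m n)"
    unfolding a_def by (intro sums_of_gen inf_powers_I j)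
  then show ?thesis
  proof (rule primI[OF _ sums_of_zero, where C = 0])
    fix t :: real assume t: "t \<ge> 1"
    have "((\<lambda>t. c / of_real a * of_real (t powr a)) has_vector_derivative
        c / of_real a * of_real (a * t powr (a - 1))) (at t)"
      using t by (intro has_vector_derivative_mult_right has_vector_derivative_of_real_powr) auto
    then show "((\<lambda>t. c / of_real a * of_real (t powr a) + cis (2 * \<zeta> * t) * 0) has_vector_derivative
        c * of_real (t powr (a - 1))) (at t)"
      using a by simp
  qed (auto simp: a_def)
qed

text \<open>Integration by parts keeps the phase and lowers the exponent by 1, until the rest is
  O(t^(-L-1)). The division is by 2 i \<zeta>, so no exponent is exceptional.\<close>

lemma prim_oscillating:
  assumes zeta: "\<zeta> \<noteq> 0" and j: "1 \<le> j" "j \<le> m" "l \<le> int n"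
  shows "prim \<gamma> \<zeta> m n L (\<lambda>t. c * of_real (t powr (real j * \<gamma> + of_int l - 1)) * cis (2 * \<zeta> * t))"
proof -
  have small: "prim \<gamma> \<zeta> m n L (\<lambda>t. c * of_real (t powr (real j * \<gamma> + of_int l - 1)) * cis (2 * \<zeta> * t))"
    if "real j * \<gamma> + of_int l - 1 \<le> - L - 1" for c l
  proof (rule prim_small)
    fix t :: real assume t: "t \<ge> 1"
    then have "t powr (real j * \<gamma> + of_int l - 1) \<le> t powr (- L - 1)"
      using that by (intro powr_mono) auto
    then show "norm (c * of_real (t powr (real j * \<gamma> + of_int l - 1)) * cis (2 * \<zeta> * t))
        \<le> norm c * t powr (- L - 1)"
      by (simp add: norm_mult mult_left_mono)
  qed
  \<comment> \<open>\<open>N\<close> bounds the integrations by parts still to be done;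
    \<open>l\<close> and \<open>c\<close> change with each of them.\<close>
  have "\<And>l c. l \<le> int n \<Longrightarrow> real j * \<gamma> + of_int l - 1 - real N \<le> - L - 1 \<Longrightarrow>
      prim \<gamma> \<zeta> m n L (\<lambda>t. c * of_real (t powr (real j * \<gamma> + of_int l - 1)) * cis (2 * \<zeta> * t))" for N
  proof (induction N)
    case 0
    then show ?case by (intro small) auto
  next
    case (Suc N)
    define a where "a = real j * \<gamma> + of_int l - 1"
    have a1: "real j * \<gamma> + of_int (l - 1) = a" by (simp add: a_def)
    define k where "k = c / (2 * \<i> * of_real \<zeta>)"
    have k: "k * (2 * \<i> * of_real \<zeta>) = c" using zeta by (simp add: k_def)
    have "prim \<gamma> \<zeta> m n L (\<lambda>t. (- k * of_real a) * of_real (t powr (real j * \<gamma> + of_int (l - 1) - 1)) * cis (2 * \<zeta> * t))"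
      by (rule Suc.IH) (use Suc.prems in auto)
    moreover have "prim \<gamma> \<zeta> m n L (\<lambda>t. c * of_real (t powr a) * cis (2 * \<zeta> * t) +
        k * of_real a * of_real (t powr (a - 1)) * cis (2 * \<zeta> * t))"
    proof (rule primI[OF sums_of_zero])
      show "(\<lambda>t. k * of_real (t powr a)) \<in> sums_of (inf_powers \<gamma> m n)"
        unfolding a1[symmetric] by (intro sums_of_gen inf_powers_I) (use j Suc.prems in auto)
      fix t :: real assume t: "t \<ge> 1"
      have "((\<lambda>t. cis (2 * \<zeta> * t) * (k * of_real (t powr a))) has_vector_derivative
          cis (2 * \<zeta> * t) * (k * of_real (a * t powr (a - 1))) +
          (of_real (2 * \<zeta>) * \<i> * cis (2 * \<zeta> * t)) * (k * of_real (t powr a))) (at t)"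
        using t
        by (intro has_vector_derivative_mult has_vector_derivative_mult_right
            has_vector_derivative_of_real_powr has_vector_derivative_cis_phase)
           (auto intro!: derivative_eq_intros)
      also have "cis (2 * \<zeta> * t) * (k * of_real (a * t powr (a - 1))) +
          (of_real (2 * \<zeta>) * \<i> * cis (2 * \<zeta> * t)) * (k * of_real (t powr a)) =
          (k * (2 * \<i> * of_real \<zeta>)) * of_real (t powr a) * cis (2 * \<zeta> * t) +
          k * of_real a * of_real (t powr (a - 1)) * cis (2 * \<zeta> * t)"
        by (simp add: algebra_simps)
      finally show "((\<lambda>t. 0 + cis (2 * \<zeta> * t) * (k * of_real (t powr a))) has_vector_derivative
          c * of_real (t powr a) * cis (2 * \<zeta> * t) +
          k * of_real a * of_real (t powr (a - 1)) * cis (2 * \<zeta> * t)) (at t)"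
        unfolding k by simp
      show "norm (c * of_real (t powr a) * cis (2 * \<zeta> * t) +
          k * of_real a * of_real (t powr (a - 1)) * cis (2 * \<zeta> * t) -
          (c * of_real (t powr a) * cis (2 * \<zeta> * t) +
          k * of_real a * of_real (t powr (a - 1)) * cis (2 * \<zeta> * t))) \<le> 0 * t powr (- L - 1)"
        by simp
    qed
    ultimately show ?case
      by (rule prim_cong[OF prim_add]) (simp add: a1, simp add: a_def)
  qed
  moreover obtain N where "real j * \<gamma> + of_int l + L \<le> real N" by (meson real_arch_simple)
  then have "real j * \<gamma> + of_int l - 1 - real N \<le> - L - 1" by simp
  ultimately show ?thesis using j(3) by blast
qed

lemma norm_cis_mult [simp]: "norm (cis a * z) = norm z" "norm (z * cis a) = norm z"
  by (simp_all add: norm_mult)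

lemma inf_powers_bound:
  assumes "P \<in> sums_of (inf_powers \<gamma> m n)"
  shows "\<exists>C K. \<forall>t\<in>{0<..1}. norm (P t) \<le> C * t powr (- real K)"
  using assms
proof induction
  case sums_of_zero
  show ?case by (intro exI[of _ 0]) simp
next
  case (sums_of_gen f)
  then obtain c j l where f: "f = (\<lambda>t. c * of_real (t powr (real j * \<gamma> + of_int l)))"
    by (rule inf_powers_E)
  obtain K :: nat where K: "- (real j * \<gamma> + of_int l) \<le> real K" by (meson real_arch_simple)
  have "norm (f t) \<le> norm c * t powr (- real K)" if "t \<in> {0<..1}" for t
  proof -
    have "t powr (real j * \<gamma> + of_int l) \<le> t powr (- real K)"
      using that K by (intro powr_mono') auto
    then show ?thesis by (simp add: f norm_mult mult_left_mono)
  qed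
  then show ?case by blast
next
  case (sums_of_add f g)
  then obtain C K C' K' where *: "\<forall>t\<in>{0<..1}. norm (f t) \<le> C * t powr (- real K)"
    "\<forall>t\<in>{0<..1}. norm (g t) \<le> C' * t powr (- real K')" by blast
  have "norm (f t + g t) \<le> (\<bar>C\<bar> + \<bar>C'\<bar>) * t powr (- real (K + K'))" if t: "t \<in> {0<..1}" for t
  proof -
    have "norm (f t) \<le> \<bar>C\<bar> * t powr (- real (K + K'))"
      using t by (intro order_trans[OF *(1)[rule_format, OF t]] mult_mono powr_mono') auto
    moreover have "norm (g t) \<le> \<bar>C'\<bar> * t powr (- real (K + K'))"
      using t by (intro order_trans[OF *(2)[rule_format, OF t]] mult_mono powr_mono') auto
    ultimately show ?thesis using norm_triangle_ineq[of "f t" "g t"] by (simp add: distrib_right)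
  qed
  then show ?case by blast
qed

text \<open>For small t the function \<open>g\<close> is bounded while \<open>P\<close> and
  \<open>Q\<close> may blow up like t^(-K). The extra factor admits this growth, so the expansion at
  infinity can be used on all of t > 0 wherever flatness compensates it.\<close>

lemma PH_expansion_all:
  assumes "PH \<gamma> \<zeta> m n g"
  obtains c P Q C K where "P \<in> sums_of (inf_powers \<gamma> m n)" "Q \<in> sums_of (inf_powers \<gamma> m n)" "C \<ge> 0"
    "\<forall>t>0. norm (g t - (c + P t + cis (2 * \<zeta> * t) * Q t))
      \<le> C * t powr (- real L) * (1 + t powr (- real K))"
proof -
  obtain c P Q C where PQ: "P \<in> sums_of (inf_powers \<gamma> m n)" "Q \<in> sums_of (inf_powers \<gamma> m n)"
    and C: "\<forall>t\<ge>1. norm (g t - (c + P t + cis (2 * \<zeta> * t) * Q t)) \<le> C * t powr (- real L)"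
    using assms unfolding PH_def by blast
  obtain B where B: "\<forall>t\<in>{0<..1}. norm (g t) \<le> B" using assms unfolding PH_def by blast
  obtain C1 K1 where 1: "\<forall>t\<in>{0<..1}. norm (P t) \<le> C1 * t powr (- real K1)"
    using inf_powers_bound[OF PQ(1)] by blast
  obtain C2 K2 where 2: "\<forall>t\<in>{0<..1}. norm (Q t) \<le> C2 * t powr (- real K2)"
    using inf_powers_bound[OF PQ(2)] by blast
  define K where "K = K1 + K2"
  define D where "D = \<bar>C\<bar> + \<bar>B\<bar> + norm c + \<bar>C1\<bar> + \<bar>C2\<bar>"
  have CD: "C \<le> D"
    using abs_ge_self[of C] abs_ge_zero[of B] norm_ge_zero[of c] abs_ge_zero[of C1] abs_ge_zero[of C2]
    unfolding D_def by linarith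
  have D0: "D \<ge> 0" by (simp add: D_def)
  have "norm (g t - (c + P t + cis (2 * \<zeta> * t) * Q t)) \<le> D * t powr (- real L) * (1 + t powr (- real K))"
    if t: "t > 0" for t
  proof -
    show "norm (g t - (c + P t + cis (2 * \<zeta> * t) * Q t)) \<le> D * t powr (- real L) * (1 + t powr (- real K))"
    proof (cases "t \<ge> 1")
      case True
      have "norm (g t - (c + P t + cis (2 * \<zeta> * t) * Q t)) \<le> C * t powr (- real L)"
        using C True by blast
      also have "\<dots> \<le> D * t powr (- real L)" by (intro mult_right_mono CD) auto
      also have "\<dots> \<le> D * t powr (- real L) * (1 + t powr (- real K))"
        using D0 mult_left_mono[of 1 "1 + t powr (- real K)" "D * t powr (- real L)"] by simp
      finally show ?thesis .
    next
      case False
      then have t': "t \<in> {0<..1}" using t by auto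
      have K: "t powr (- real K) \<ge> 1" using powr_mono'[of "- real K" 0 t] t' by simp
      have "norm (g t - (c + P t + cis (2 * \<zeta> * t) * Q t)) \<le> norm (g t) + (norm c + norm (P t) + norm (Q t))"
        by (rule order_trans[OF norm_triangle_ineq4 add_left_mono],
            rule order_trans[OF norm_triangle_ineq], simp add: norm_triangle_ineq)
      moreover have "norm (g t) \<le> \<bar>B\<bar> * t powr (- real K)"
      proof -
        have "norm (g t) \<le> \<bar>B\<bar> * 1" using B[rule_format, OF t'] by simp
        also have "\<dots> \<le> \<bar>B\<bar> * t powr (- real K)" using K by (intro mult_left_mono) auto
        finally show ?thesis .
      qed
      moreover have "norm c \<le> norm c * t powr (- real K)"
        using mult_left_mono[OF K, of "norm c"] by simp
      moreover have "norm (P t) \<le> \<bar>C1\<bar> * t powr (- real K)"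
        using t' by (intro order_trans[OF 1[rule_format, OF t']] mult_mono powr_mono') (auto simp: K_def)
      moreover have "norm (Q t) \<le> \<bar>C2\<bar> * t powr (- real K)"
        using t' by (intro order_trans[OF 2[rule_format, OF t']] mult_mono powr_mono') (auto simp: K_def)
      ultimately have "norm (g t - (c + P t + cis (2 * \<zeta> * t) * Q t))
          \<le> (\<bar>B\<bar> + norm c + \<bar>C1\<bar> + \<bar>C2\<bar>) * t powr (- real K)"
        by (simp add: distrib_right)
      also have "\<dots> \<le> D * (1 + t powr (- real K))"
        by (intro mult_mono) (auto simp: D_def)
      also have "\<dots> \<le> D * t powr (- real L) * (1 + t powr (- real K))"
      proof -
        have "1 \<le> t powr (- real L)" using powr_mono'[of "- real L" 0 t] t' by simp
        then have "D * 1 \<le> D * t powr (- real L)" using D0 by (intro mult_left_mono) auto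
        then show ?thesis by (intro mult_right_mono) auto
      qed
      finally show ?thesis .
    qed
  qed
  then show thesis using PQ D0 by (intro that[of P Q D c K]) auto
qed

text \<open>The kernel exp(2 i \<zeta> t) turns the phases 0 and -\<zeta> of \<open>g\<close> into
  \<zeta> and 0: the constant and \<open>P\<close> become oscillating, and \<open>Q\<close> loses
  its phase. The nonoscillating integrands therefore come from \<open>Q\<close> alone, with
  exponents i \<gamma> + k - 1 where i >= 1, and these are never -1.\<close>

lemma PH_integral:
  assumes gamma: "\<gamma> > 0" and irr: "\<gamma> \<notin> \<rat>" and zeta: "\<zeta> \<noteq> 0" and g: "PH \<gamma> (-\<zeta>) m n g" and j: "1 \<le> j"
  shows "\<exists>G. PH \<gamma> \<zeta> (m + j) (n + l) G \<and> (G \<longlongrightarrow> 0) (at_right 0) \<and>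
    (\<forall>t>0. (G has_vector_derivative of_real (t powr (real j * \<gamma> + real l - 1)) * cis (2 * \<zeta> * t) * g t) (at t))"
proof -
  define a where "a = real j * \<gamma> + real l - 1"
  have "0 < 1 * \<gamma>" using gamma by simp
  also have "\<dots> \<le> real j * \<gamma>" using gamma j by (intro mult_right_mono) auto
  finally have a: "a > -1" by (simp add: a_def)
  define w where "w t = of_real (t powr a) * cis (2 * \<zeta> * t) * g t" for t
  define G where "G t = integral {0..t} w" for t
  have gc: "continuous_on {0<..} g" using g by (simp add: PH_def)
  have wc: "continuous_on {0<..} w"
    unfolding w_def using gc by (intro continuous_intros) auto
  have bd: "\<exists>C. \<forall>t\<in>{0<..T}. norm (w t) \<le> C * t powr a" for T
  proof -
    obtain B where B: "\<forall>t\<in>{0<..1}. norm (g t) \<le> B" using g unfolding PH_def by blast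
    have "compact (g ` {1..T})"
      by (intro compact_continuous_image continuous_on_subset[OF gc]) auto
    from compact_imp_bounded[OF this] obtain B' where B': "\<forall>t\<in>{1..T}. norm (g t) \<le> B'"
      by (auto simp: bounded_iff)
    have "norm (w t) \<le> (\<bar>B\<bar> + \<bar>B'\<bar>) * t powr a" if t: "t \<in> {0<..T}" for t
    proof -
      have "norm (g t) \<le> \<bar>B\<bar> + \<bar>B'\<bar>"
        using B[rule_format, of t] B'[rule_format, of t] t by (cases "t \<le> 1") auto
      then have "t powr a * norm (g t) \<le> t powr a * (\<bar>B\<bar> + \<bar>B'\<bar>)" by (intro mult_left_mono) auto
      then show ?thesis by (simp add: w_def norm_mult mult.commute)
    qed
    then show ?thesis by blast
  qed
  have anti: "continuous_on {0..T} G" "(G \<longlongrightarrow> 0) (at_right 0)"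
    "\<And>t. t \<in> {0<..T} \<Longrightarrow> (G has_vector_derivative w t) (at t within {0<..T})" if T: "T > 0" for T
  proof -
    obtain C where C: "\<And>t. t \<in> {0<..T} \<Longrightarrow> norm (w t) \<le> C * t powr a" using bd by blast
    have "continuous_on {0<..T} w" by (rule continuous_on_subset[OF wc]) auto
    note A = antiderivative_from_zero[OF T this a C]
    have "G = (\<lambda>t. integral {0..t} w)" by (simp add: fun_eq_iff G_def)
    then show "continuous_on {0..T} G" "(G \<longlongrightarrow> 0) (at_right 0)"
      "\<And>t. t \<in> {0<..T} \<Longrightarrow> (G has_vector_derivative w t) (at t within {0<..T})"
      using A by simp_all
  qed
  have der: "(G has_vector_derivative w t) (at t)" if t: "t > 0" for t
  proof -
    have "at t within {0<..t + 1} = at t" using t by (intro at_within_interior) auto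
    then show ?thesis using anti(3)[of "t + 1" t] t by simp
  qed
  have "PH \<gamma> \<zeta> (m + j) (n + l) G"
    unfolding PH_def
  proof (intro conjI allI)
    show "continuous_on {0<..} G"
      using der by (meson continuous_at_imp_continuous_on greaterThan_iff has_vector_derivative_continuous)
    have "compact (G ` {0..1})" by (intro compact_continuous_image anti) auto
    from compact_imp_bounded[OF this] obtain B where B: "\<forall>t\<in>{0..1}. norm (G t) \<le> B"
      by (auto simp: bounded_iff)
    then show "\<exists>B. \<forall>t\<in>{0<..1}. norm (G t) \<le> B" by (intro exI[of _ B]) auto
    fix L :: nat
    let ?I = "inf_powers \<gamma> (m + j) (n + l)"
    \<comment> \<open>Large enough to absorb the weight t^a and still leave the decay
      t^(-L-2).\<close>
    obtain L' :: nat where L': "real L + 2 + a \<le> real L'" by (meson real_arch_simple)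
    obtain c P Q C where PQ: "P \<in> sums_of (inf_powers \<gamma> m n)" "Q \<in> sums_of (inf_powers \<gamma> m n)"
      and C: "\<forall>t\<ge>1. norm (g t - (c + P t + cis (2 * (-\<zeta>) * t) * Q t)) \<le> C * t powr (- real L')"
      using g unfolding PH_def by blast
    have p1: "prim \<gamma> \<zeta> (m + j) (n + l) (real L + 1) (\<lambda>t. c * of_real (t powr a) * cis (2 * \<zeta> * t))"
      using prim_oscillating[OF zeta, of j "m + j" "int l" "n + l" \<gamma> "real L + 1" c] j
      by (simp add: a_def)
    have p2: "prim \<gamma> \<zeta> (m + j) (n + l) (real L + 1) (\<lambda>t. P t * of_real (t powr a) * cis (2 * \<zeta> * t))"
      using PQ(1)
    proof induction
      case sums_of_zero
      show ?case by (rule prim_small[where C = 0]) simp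
    next
      case (sums_of_gen f)
      then obtain c i k where f: "f = (\<lambda>t. c * of_real (t powr (real i * \<gamma> + of_int k)))"
        "1 \<le> i" "i \<le> m" "k \<le> int n" by (rule inf_powers_E)
      have "prim \<gamma> \<zeta> (m + j) (n + l) (real L + 1)
          (\<lambda>t. c * of_real (t powr (real (i + j) * \<gamma> + of_int (k + int l) - 1)) * cis (2 * \<zeta> * t))"
        by (rule prim_oscillating[OF zeta]) (use f in auto)
      then show ?case
        by (rule prim_cong) (simp add: f a_def algebra_simps flip: powr_add of_real_mult)
    next
      case (sums_of_add f g)
      show ?case by (rule prim_cong[OF prim_add[OF sums_of_add.IH]]) (simp add: algebra_simps)
    qed
    \<comment> \<open>The phases of kernel and integrand have cancelled; these are the terms that
      call for irrationality.\<close>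
    have p3: "prim \<gamma> \<zeta> (m + j) (n + l) (real L + 1) (\<lambda>t. Q t * of_real (t powr a))"
      using PQ(2)
    proof induction
      case sums_of_zero
      show ?case by (rule prim_small[where C = 0]) simp
    next
      case (sums_of_gen f)
      then obtain c i k where f: "f = (\<lambda>t. c * of_real (t powr (real i * \<gamma> + of_int k)))"
        "1 \<le> i" "i \<le> m" "k \<le> int n" by (rule inf_powers_E)
      have "prim \<gamma> \<zeta> (m + j) (n + l) (real L + 1)
          (\<lambda>t. c * of_real (t powr (real (i + j) * \<gamma> + of_int (k + int l) - 1)))"
        by (rule prim_power[OF irr]) (use f in auto)
      then show ?case
        by (rule prim_cong) (simp add: f a_def algebra_simps flip: powr_add of_real_mult)
    next
      case (sums_of_add f g)
      show ?case by (rule prim_cong[OF prim_add[OF sums_of_add.IH]]) (simp add: algebra_simps)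
    qed
    have p4: "prim \<gamma> \<zeta> (m + j) (n + l) (real L + 1)
        (\<lambda>t. of_real (t powr a) * cis (2 * \<zeta> * t) * (g t - (c + P t + cis (2 * (-\<zeta>) * t) * Q t)))"
    proof (rule prim_small)
      fix t :: real assume t: "t \<ge> 1"
      have "norm (of_real (t powr a) * cis (2 * \<zeta> * t) * (g t - (c + P t + cis (2 * (-\<zeta>) * t) * Q t)))
          \<le> t powr a * (\<bar>C\<bar> * t powr (- real L'))"
        using order_trans[OF C[rule_format, OF t] mult_right_mono[OF abs_ge_self]]
        by (simp add: norm_mult mult_left_mono)
      also have "\<dots> = \<bar>C\<bar> * t powr (a - real L')"
        by (simp add: powr_diff powr_minus field_simps)
      also have "\<dots> \<le> \<bar>C\<bar> * t powr (- (real L + 1) - 1)"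
        using t L' by (intro mult_left_mono powr_mono) auto
      finally show "norm (of_real (t powr a) * cis (2 * \<zeta> * t) * (g t - (c + P t + cis (2 * (-\<zeta>) * t) * Q t)))
          \<le> \<bar>C\<bar> * t powr (- (real L + 1) - 1)" .
    qed
    have "prim \<gamma> \<zeta> (m + j) (n + l) (real L + 1) w"
    proof (rule prim_cong[OF prim_add[OF prim_add[OF p1 p2] prim_add[OF p3 p4]]])
      fix t :: real
      have cc: "cis (2 * \<zeta> * t) * cis (2 * (-\<zeta>) * t) = 1" by (simp add: cis_mult)
      have "of_real (t powr a) * cis (2 * \<zeta> * t) * (c + P t + cis (2 * (-\<zeta>) * t) * Q t)
        = of_real (t powr a) * cis (2 * \<zeta> * t) * c + of_real (t powr a) * cis (2 * \<zeta> * t) * P t +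
          of_real (t powr a) * (cis (2 * \<zeta> * t) * cis (2 * (-\<zeta>) * t)) * Q t"
        by (simp only: distrib_left mult.assoc)
      then show "c * of_real (t powr a) * cis (2 * \<zeta> * t) + P t * of_real (t powr a) * cis (2 * \<zeta> * t) +
         (Q t * of_real (t powr a) +
          of_real (t powr a) * cis (2 * \<zeta> * t) * (g t - (c + P t + cis (2 * (-\<zeta>) * t) * Q t))) = w t"
        unfolding w_def right_diff_distrib cc by (simp add: mult.commute mult.left_commute)
    qed
    then obtain P' Q' d D where PQ': "P' \<in> sums_of ?I" "Q' \<in> sums_of ?I"
      "\<forall>t\<ge>1. ((\<lambda>t. P' t + cis (2 * \<zeta> * t) * Q' t) has_vector_derivative d t) (at t)"
      "\<forall>t\<ge>1. norm (d t - w t) \<le> D * t powr (- (real L + 1) - 1)"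
      by (rule primE)
    \<comment> \<open>Order \<open>L + 1\<close> in place of \<open>L\<close>, because convergence
      at infinity requires a positive order and \<open>L = 0\<close> is allowed.\<close>
    have "\<exists>c. \<forall>t\<ge>1. norm ((G t - (P' t + cis (2 * \<zeta> * t) * Q' t)) - c) \<le> D / (real L + 1) * t powr (- (real L + 1))"
    proof (rule converges_at_infinity)
      fix t :: real assume t: "t \<ge> 1"
      show "((\<lambda>t. G t - (P' t + cis (2 * \<zeta> * t) * Q' t)) has_vector_derivative w t - d t) (at t)"
        using t by (intro has_vector_derivative_diff der PQ'(3)[rule_format]) auto
      show "norm (w t - d t) \<le> D * t powr (- (real L + 1) - 1)"
        using PQ'(4)[rule_format, OF t] by (simp add: norm_minus_commute)
    qed simp
    then obtain c' where c': "\<And>t. t \<ge> 1 \<Longrightarrow> norm ((G t - (P' t + cis (2 * \<zeta> * t) * Q' t)) - c') \<le> D / (real L + 1) * t powr (- (real L + 1))"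
      by blast
    have "norm (G t - (c' + P' t + cis (2 * \<zeta> * t) * Q' t)) \<le> \<bar>D\<bar> / (real L + 1) * t powr (- real L)"
      if t: "t \<ge> 1" for t
    proof -
      have "norm (G t - (c' + P' t + cis (2 * \<zeta> * t) * Q' t)) \<le> D / (real L + 1) * t powr (- (real L + 1))"
        using c'[OF t] by (simp add: algebra_simps)
      also have "\<dots> \<le> \<bar>D\<bar> / (real L + 1) * t powr (- real L)"
        using t by (intro mult_mono divide_right_mono powr_mono) auto
      finally show ?thesis .
    qed
    then show "\<exists>c. \<exists>P\<in>sums_of ?I. \<exists>Q\<in>sums_of ?I. \<exists>C.
        \<forall>t\<ge>1. norm (G t - (c + P t + cis (2 * \<zeta> * t) * Q t)) \<le> C * t powr (- real L)"
      using PQ'(1,2) by blast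
  qed
  then show ?thesis
    using anti(2)[of 1] der unfolding w_def a_def by (intro exI[of _ G]) auto
qed

section \<open>Iterated oscillatory integrals\<close>

locale irrational_potential = potential +
  assumes irr: "\<gamma> \<notin> \<rat>"
begin

definition osc :: "nat \<Rightarrow> nat \<Rightarrow> complex \<Rightarrow> real \<Rightarrow> (real \<Rightarrow> real) \<Rightarrow> real \<times> real \<Rightarrow> complex" where
  "osc m n c e \<rho> = (\<lambda>(h, x). of_real (h powr (real m * \<gamma> + real n)) * c * cis (2 * e * (S x / h)) * of_real (\<rho> x))"

definition homog :: "nat \<Rightarrow> nat \<Rightarrow> complex \<Rightarrow> (real \<Rightarrow> complex) \<Rightarrow> real \<times> real \<Rightarrow> complex" where
  "homog m n c g = (\<lambda>(h, x). of_real (h powr (real m * \<gamma> + real n)) * c * g (S x / h))"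

text \<open>The two shapes reproduced by the iteration up to O(h^M): functions of S / h, which
  resolve the endpoint 0 on the scale h, and pure phases with flat amplitude, which do not feel
  it.\<close>

definition atoms :: "real \<Rightarrow> real \<Rightarrow> nat \<Rightarrow> (real \<times> real \<Rightarrow> complex) set" where
  "atoms \<zeta> N k = {homog m n c g | m n c g. PH \<gamma> \<zeta> m n g} \<union>
     {osc m n c e \<rho> | m n c e \<rho>. e \<in> {0, \<zeta>} \<and> flat b k N \<rho>}"

lemma atoms_homog: "PH \<gamma> \<zeta> m n g \<Longrightarrow> homog m n c g \<in> atoms \<zeta> N k"
  unfolding atoms_def by blast

lemma atoms_osc: "e \<in> {0, \<zeta>} \<Longrightarrow> flat b k N \<rho> \<Longrightarrow> osc m n c e \<rho> \<in> atoms \<zeta> N k"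
  unfolding atoms_def by blast

lemma atoms_cases:
  assumes "f \<in> atoms \<zeta> N k"
  obtains (homog) m n c g where "f = homog m n c g" "PH \<gamma> \<zeta> m n g"
  | (osc) m n c e \<rho> where "f = osc m n c e \<rho>" "e \<in> {0, \<zeta>}" "flat b k N \<rho>"
  using assms unfolding atoms_def by blast

lemma atoms_mono: "N \<le> N' \<Longrightarrow> atoms \<zeta> N' k \<subseteq> atoms \<zeta> N k"
  unfolding atoms_def using flat_weaken by blast

text \<open>An error \<open>O(h\<^sup>M x\<^sup>\<gamma>\<^sup>-\<^sup>1)\<close> in the derivative is integrable, hence \<open>O(h\<^sup>M)\<close> in the primitive.\<close>

definition solv :: "real \<Rightarrow> real \<Rightarrow> nat \<Rightarrow> nat \<Rightarrow> (real \<times> real \<Rightarrow> complex) \<Rightarrow> bool" where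
  "solv \<zeta> N k M w \<longleftrightarrow> (\<exists>A\<in>sums_of (atoms \<zeta> N k). \<exists>C. \<exists>d. \<forall>h\<in>{0<..1}.
     ((\<lambda>x. A (h, x)) \<longlongrightarrow> 0) (at_right 0) \<and>
     (\<forall>x\<in>{0<..b}. ((\<lambda>x. A (h, x)) has_vector_derivative d h x) (at x within {0<..b}) \<and>
        norm (d h x - w (h, x)) \<le> C * h ^ M * x powr (\<gamma> - 1)))"

lemma solvI:
  assumes "A \<in> sums_of (atoms \<zeta> N k)"
    and "\<And>h. h \<in> {0<..1} \<Longrightarrow> ((\<lambda>x. A (h, x)) \<longlongrightarrow> 0) (at_right 0)"
    and "\<And>h x. h \<in> {0<..1} \<Longrightarrow> x \<in> {0<..b} \<Longrightarrow>
      ((\<lambda>x. A (h, x)) has_vector_derivative d h x) (at x within {0<..b})"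
    and "\<And>h x. h \<in> {0<..1} \<Longrightarrow> x \<in> {0<..b} \<Longrightarrow>
      norm (d h x - w (h, x)) \<le> C * h ^ M * x powr (\<gamma> - 1)"
  shows "solv \<zeta> N k M w"
  unfolding solv_def
  by (rule bexI[OF _ assms(1)], rule exI[of _ C], rule exI[of _ d]) (use assms(2-4) in blast)

lemma solvE:
  assumes "solv \<zeta> N k M w"
  obtains A C d where "A \<in> sums_of (atoms \<zeta> N k)"
    "\<forall>h\<in>{0<..1}. ((\<lambda>x. A (h, x)) \<longlongrightarrow> 0) (at_right 0)"
    "\<forall>h\<in>{0<..1}. \<forall>x\<in>{0<..b}. ((\<lambda>x. A (h, x)) has_vector_derivative d h x) (at x within {0<..b})"
    "\<forall>h\<in>{0<..1}. \<forall>x\<in>{0<..b}. norm (d h x - w (h, x)) \<le> C * h ^ M * x powr (\<gamma> - 1)"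
proof -
  from assms obtain A C d where "A \<in> sums_of (atoms \<zeta> N k)" and "\<forall>h\<in>{0<..1}.
     ((\<lambda>x. A (h, x)) \<longlongrightarrow> 0) (at_right 0) \<and>
     (\<forall>x\<in>{0<..b}. ((\<lambda>x. A (h, x)) has_vector_derivative d h x) (at x within {0<..b}) \<and>
        norm (d h x - w (h, x)) \<le> C * h ^ M * x powr (\<gamma> - 1))"
    unfolding solv_def by (elim bexE exE)
  then show thesis by (intro that[of A d C]) auto
qed

lemma solv_cong:
  assumes "solv \<zeta> N k M w" "\<And>h x. h \<in> {0<..1} \<Longrightarrow> x \<in> {0<..b} \<Longrightarrow> w (h, x) = w' (h, x)"
  shows "solv \<zeta> N k M w'"
proof -
  obtain A C d where A: "A \<in> sums_of (atoms \<zeta> N k)"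
    "\<forall>h\<in>{0<..1}. ((\<lambda>x. A (h, x)) \<longlongrightarrow> 0) (at_right 0)"
    "\<forall>h\<in>{0<..1}. \<forall>x\<in>{0<..b}. ((\<lambda>x. A (h, x)) has_vector_derivative d h x) (at x within {0<..b})"
    "\<forall>h\<in>{0<..1}. \<forall>x\<in>{0<..b}. norm (d h x - w (h, x)) \<le> C * h ^ M * x powr (\<gamma> - 1)"
    using assms(1) by (rule solvE)
  show ?thesis
    by (rule solvI[OF A(1) A(2)[rule_format] A(3)[rule_format], where C = C])
       (use A(4) assms(2) in auto)
qed

lemma solv_add:
  assumes "solv \<zeta> N k M w" "solv \<zeta> N k M w'"
  shows "solv \<zeta> N k M (\<lambda>z. w z + w' z)"
proof -
  obtain A C d where A: "A \<in> sums_of (atoms \<zeta> N k)"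
    "\<forall>h\<in>{0<..1}. ((\<lambda>x. A (h, x)) \<longlongrightarrow> 0) (at_right 0)"
    "\<forall>h\<in>{0<..1}. \<forall>x\<in>{0<..b}. ((\<lambda>x. A (h, x)) has_vector_derivative d h x) (at x within {0<..b})"
    "\<forall>h\<in>{0<..1}. \<forall>x\<in>{0<..b}. norm (d h x - w (h, x)) \<le> C * h ^ M * x powr (\<gamma> - 1)"
    using assms(1) by (rule solvE)
  obtain A' C' d' where A': "A' \<in> sums_of (atoms \<zeta> N k)"
    "\<forall>h\<in>{0<..1}. ((\<lambda>x. A' (h, x)) \<longlongrightarrow> 0) (at_right 0)"
    "\<forall>h\<in>{0<..1}. \<forall>x\<in>{0<..b}. ((\<lambda>x. A' (h, x)) has_vector_derivative d' h x) (at x within {0<..b})"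
    "\<forall>h\<in>{0<..1}. \<forall>x\<in>{0<..b}. norm (d' h x - w' (h, x)) \<le> C' * h ^ M * x powr (\<gamma> - 1)"
    using assms(2) by (rule solvE)
  show ?thesis
  proof (rule solvI[OF sums_of_add[OF A(1) A'(1)]])
    fix h :: real assume h: "h \<in> {0<..1}"
    show "((\<lambda>x. A (h, x) + A' (h, x)) \<longlongrightarrow> 0) (at_right 0)"
      using tendsto_add[OF A(2)[rule_format, OF h] A'(2)[rule_format, OF h]] by simp
    fix x assume x: "x \<in> {0<..b}"
    show "((\<lambda>x. A (h, x) + A' (h, x)) has_vector_derivative d h x + d' h x) (at x within {0<..b})"
      by (intro has_vector_derivative_add A(3)[rule_format] A'(3)[rule_format] h x)
    have "norm (d h x + d' h x - (w (h, x) + w' (h, x)))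
        \<le> norm (d h x - w (h, x)) + norm (d' h x - w' (h, x))"
      by (rule norm_diff_triangle_ineq)
    also have "\<dots> \<le> (C + C') * h ^ M * x powr (\<gamma> - 1)"
      using A(4)[rule_format, OF h x] A'(4)[rule_format, OF h x] by (simp add: distrib_right)
    finally show "norm (d h x + d' h x - (w (h, x) + w' (h, x))) \<le> (C + C') * h ^ M * x powr (\<gamma> - 1)" .
  qed
qed

lemma solv_small:
  assumes "\<And>h x. h \<in> {0<..1} \<Longrightarrow> x \<in> {0<..b} \<Longrightarrow> norm (w (h, x)) \<le> C * h ^ M * x powr (\<gamma> - 1)"
  shows "solv \<zeta> N k M w"
  by (rule solvI[OF sums_of_zero, where d = "\<lambda>h x. 0" and C = C]) (use assms in auto)

lemma solv_exact:
  assumes "A \<in> sums_of (atoms \<zeta> N k)"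
    and "\<And>h. h \<in> {0<..1} \<Longrightarrow> ((\<lambda>x. A (h, x)) \<longlongrightarrow> 0) (at_right 0)"
    and "\<And>h x. h \<in> {0<..1} \<Longrightarrow> x \<in> {0<..b} \<Longrightarrow>
      ((\<lambda>x. A (h, x)) has_vector_derivative w (h, x)) (at x within {0<..b})"
  shows "solv \<zeta> N k M w"
  by (rule solvI[OF assms, where C = 0]) auto

lemma solv_sums_of:
  assumes "f \<in> sums_of G" "\<And>g. g \<in> G \<Longrightarrow> solv \<zeta> N k M (\<lambda>z. T z (g (\<pi> z)))"
    and "\<And>z. T z 0 = 0" "\<And>z u v. T z (u + v) = T z u + T z v"
  shows "solv \<zeta> N k M (\<lambda>z. T z (f (\<pi> z)))"
  using assms(1)
proof induction
  case sums_of_zero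
  show ?case by (rule solv_small[where C = 0]) (simp add: assms)
next
  case (sums_of_gen f)
  then show ?case by (rule assms)
next
  case (sums_of_add f g)
  show ?case by (rule solv_cong[OF solv_add[OF sums_of_add.IH]]) (simp add: assms)
qed

lemma S_over_h_deriv:
  "x \<in> {0<..b} \<Longrightarrow> ((\<lambda>x. S x / h) has_real_derivative p x / h) (at x within {0<..b})"
  by (rule DERIV_cdivide[OF S_deriv])

lemma phase_deriv:
  assumes "x \<in> {0<..b}"
  shows "((\<lambda>x. cis (2 * e * (S x / h))) has_vector_derivative
    of_real (2 * e * (p x / h)) * \<i> * cis (2 * e * (S x / h))) (at x within {0<..b})"
  by (intro has_vector_derivative_cis_phase DERIV_cmult S_over_h_deriv assms)

lemma osc_tendsto_0:
  assumes "flat b k N \<rho>" "N > 0"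
  shows "((\<lambda>x. osc m n c e \<rho> (h, x)) \<longlongrightarrow> 0) (at_right 0)"
proof -
  have "((\<lambda>x. norm (of_real (h powr (real m * \<gamma> + real n)) * c) * \<bar>\<rho> x\<bar>) \<longlongrightarrow>
      norm (of_real (h powr (real m * \<gamma> + real n)) * c) * \<bar>0\<bar>) (at_right 0)"
    by (intro tendsto_intros flat_tendsto_0[OF b assms])
  then have "((\<lambda>x. norm (osc m n c e \<rho> (h, x))) \<longlongrightarrow> 0) (at_right 0)"
    by (simp add: osc_def norm_mult mult.assoc)
  then show ?thesis by (simp add: tendsto_norm_zero_iff)
qed

lemma solv_nonosc:
  assumes rho: "flat b k N \<rho>" and N: "N \<ge> 0"
  shows "solv \<zeta> N k M (osc m n c 0 (\<lambda>x. p x * \<rho> x))"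
proof -
  define D where "D x = integral {0..x} (\<lambda>x. p x * \<rho> x)" for x
  have "flat b k (0 + N) (\<lambda>x. p x * \<rho> x)" by (intro flat_mult flat_p rho)
  then have fl: "flat b k N (\<lambda>x. p x * \<rho> x)" by simp
  obtain C where C: "\<And>x. x \<in> {0<..b} \<Longrightarrow> norm (p x * \<rho> x) \<le> C * x powr N"
    using flat_bound[OF fl] by (metis real_norm_def)
  have D: "D = (\<lambda>x. integral {0..x} (\<lambda>x. p x * \<rho> x))" by (simp add: D_def fun_eq_iff)
  have N1: "N > -1" using N by simp
  note A = antiderivative_from_zero[OF b flat_continuous[OF fl] N1 C, folded D]
  have Dd: "(D has_real_derivative p x * \<rho> x) (at x within {0<..b})" if "x \<in> {0<..b}" for x
    using A(2)[of x] that by (simp add: has_real_derivative_iff_has_vector_derivative)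
  have "(D \<longlongrightarrow> 0) (at_right 0)" using A(3) by simp
  then have "flat b (Suc k) (N + 1) D" by (rule flat_antiderivative[OF fl N1 _ Dd])
  then have fD: "flat b k (N + 1) D" by (rule flat_dec)
  show ?thesis
  proof (rule solv_exact)
    show "osc m n c 0 D \<in> sums_of (atoms \<zeta> N k)"
      by (intro sums_of_gen atoms_osc flat_weaken[OF fD]) auto
    show "((\<lambda>x. osc m n c 0 D (h, x)) \<longlongrightarrow> 0) (at_right 0)" for h
      by (rule osc_tendsto_0[OF fD]) (use N in auto)
    show "((\<lambda>x. osc m n c 0 D (h, x)) has_vector_derivative
        osc m n c 0 (\<lambda>x. p x * \<rho> x) (h, x)) (at x within {0<..b})" if "x \<in> {0<..b}" for h x
    proof -
      have "((\<lambda>x. of_real (h powr (real m * \<gamma> + real n)) * c * cis 0 * of_real (D x)) has_vector_derivative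
        of_real (h powr (real m * \<gamma> + real n)) * c * cis 0 * of_real (p x * \<rho> x)) (at x within {0<..b})"
        by (intro has_vector_derivative_mult_right has_vector_derivative_of_real Dd that)
      then show ?thesis by (simp add: osc_def)
    qed
  qed
qed

text \<open>Each integration by parts trades one Euler derivative and one order of flatness for a
  factor h; \<open>i\<close> counts the steps that can still be paid for. Flatness also makes the
  boundary term at 0 vanish.\<close>

lemma solv_osc_by_parts:
  assumes zeta: "\<zeta> \<noteq> 0" and N: "N \<ge> \<gamma>"
  shows "flat b (k + i) (N + real i) \<rho> \<Longrightarrow> M \<le> n + i \<Longrightarrow> solv \<zeta> N k M (osc m n c \<zeta> (\<lambda>x. p x * \<rho> x))"
proof (induction i arbitrary: \<rho> n c)
  case 0
  have "flat b k (0 + N) (\<lambda>x. p x * \<rho> x)" using 0 by (intro flat_mult flat_p) simp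
  then have "flat b k (\<gamma> - 1) (\<lambda>x. p x * \<rho> x)" by (rule flat_weaken) (use N in auto)
  then obtain C where C: "C > 0" "\<And>x. x \<in> {0<..b} \<Longrightarrow> \<bar>p x * \<rho> x\<bar> \<le> C * x powr (\<gamma> - 1)"
    using flat_bound by blast
  show ?case
  proof (rule solv_small)
    fix h x :: real assume h: "h \<in> {0<..1}" and x: "x \<in> {0<..b}"
    have "h powr (real m * \<gamma> + real n) \<le> h powr (real M)"
      using h gamma 0 by (intro powr_mono') (auto intro: order_trans[of _ "real n"])
    then have "h powr (real m * \<gamma> + real n) \<le> h ^ M"
      using h by (simp add: powr_realpow)
    then have "h powr (real m * \<gamma> + real n) * (norm c * \<bar>p x * \<rho> x\<bar>) \<le> h ^ M * (norm c * (C * x powr (\<gamma> - 1)))"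
      using C(2)[OF x] h by (intro mult_mono mult_left_mono) auto
    then show "norm (osc m n c \<zeta> (\<lambda>x. p x * \<rho> x) (h, x)) \<le> (norm c * C) * h ^ M * x powr (\<gamma> - 1)"
      by (simp add: osc_def norm_mult abs_mult mult_ac)
  qed
next
  case (Suc i)
  have "flat b (Suc (k + i)) (N + real (Suc i)) \<rho>" using Suc.prems(1) by simp
  then obtain d where d: "\<And>x. x \<in> {0<..b} \<Longrightarrow> (\<rho> has_real_derivative d x) (at x within {0<..b})"
    "flat b (k + i) (N + real (Suc i)) (\<lambda>x. x * d x)"
    by (rule flat_deriv) blast
  \<comment> \<open>The derivative of \<rho> with respect to \<open>S\<close>, as dS = p dx; its
    order is one lower.\<close>
  define \<rho>1 where "\<rho>1 x = d x / p x" for x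
  have "flat b (k + i) (N + real (Suc i) + (-1) + 0) (\<lambda>x. x * d x * (1 / x) * p x powr (-1))"
    by (intro flat_mult d flat_inverse_x flat_p_powr)
  then have "flat b (k + i) (N + real i) (\<lambda>x. x * d x * (1 / x) * p x powr (-1))" by simp
  then have r1: "flat b (k + i) (N + real i) \<rho>1"
  proof (rule flat_cong)
    show "x * d x * (1 / x) * p x powr (-1) = \<rho>1 x" if "x \<in> {0<..b}" for x
      using p_pos[of x] that by (simp add: \<rho>1_def powr_minus field_simps)
  qed
  define c' where "c' = c / (2 * \<i> * of_real \<zeta>)"
  have c': "c' * (2 * \<i> * of_real \<zeta>) = c" using zeta by (simp add: c'_def)
  have "solv \<zeta> N k M (\<lambda>z. osc m n c \<zeta> (\<lambda>x. p x * \<rho> x) z + osc m (Suc n) c' \<zeta> (\<lambda>x. p x * \<rho>1 x) z)"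
  proof (rule solv_exact)
    show "osc m (Suc n) c' \<zeta> \<rho> \<in> sums_of (atoms \<zeta> N k)"
      by (intro sums_of_gen atoms_osc flat_weaken[OF flat_le[OF Suc.prems(1)]]) auto
    show "((\<lambda>x. osc m (Suc n) c' \<zeta> \<rho> (h, x)) \<longlongrightarrow> 0) (at_right 0)" for h
      by (rule osc_tendsto_0[OF Suc.prems(1)]) (use N gamma in auto)
    fix h x :: real assume h: "h \<in> {0<..1}" and x: "x \<in> {0<..b}"
    let ?H = "complex_of_real (h powr (real m * \<gamma> + real (Suc n))) * c'"
    have hh: "h powr (real m * \<gamma> + real (Suc n)) = h powr (real m * \<gamma> + real n) * h"
    proof -
      have "h powr (real m * \<gamma> + real (Suc n)) = h powr (real m * \<gamma> + real n + 1)" by (simp add: algebra_simps)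
      then show ?thesis using h by (simp only: powr_add) simp
    qed
    have "((\<lambda>x. ?H * (cis (2 * \<zeta> * (S x / h)) * of_real (\<rho> x))) has_vector_derivative
       ?H * (cis (2 * \<zeta> * (S x / h)) * of_real (d x) +
         of_real (2 * \<zeta> * (p x / h)) * \<i> * cis (2 * \<zeta> * (S x / h)) * of_real (\<rho> x))) (at x within {0<..b})"
      by (intro has_vector_derivative_mult_right has_vector_derivative_mult phase_deriv
          has_vector_derivative_of_real d(1) x)
    also have "?H * (cis (2 * \<zeta> * (S x / h)) * of_real (d x) +
         of_real (2 * \<zeta> * (p x / h)) * \<i> * cis (2 * \<zeta> * (S x / h)) * of_real (\<rho> x)) =
       osc m n c \<zeta> (\<lambda>x. p x * \<rho> x) (h, x) + osc m (Suc n) c' \<zeta> (\<lambda>x. p x * \<rho>1 x) (h, x)"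
    proof -
      have "?H * (of_real (2 * \<zeta> * (p x / h)) * \<i> * cis (2 * \<zeta> * (S x / h)) * of_real (\<rho> x)) =
         of_real (h powr (real m * \<gamma> + real n)) * (c' * (2 * \<i> * of_real \<zeta>)) * cis (2 * \<zeta> * (S x / h)) * of_real (p x * \<rho> x)"
        unfolding hh using h by (simp add: field_simps)
      moreover have "d x = p x * \<rho>1 x" using p_pos[of x] x by (simp add: \<rho>1_def)
      ultimately show ?thesis unfolding c' by (simp add: osc_def distrib_left mult.assoc)
    qed
    finally show "((\<lambda>x. osc m (Suc n) c' \<zeta> \<rho> (h, x)) has_vector_derivative
       osc m n c \<zeta> (\<lambda>x. p x * \<rho> x) (h, x) + osc m (Suc n) c' \<zeta> (\<lambda>x. p x * \<rho>1 x) (h, x)) (at x within {0<..b})"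
      by (simp add: osc_def mult.assoc)
  qed
  moreover have "solv \<zeta> N k M (osc m (Suc n) (- c') \<zeta> (\<lambda>x. p x * \<rho>1 x))"
    by (rule Suc.IH[OF r1]) (use Suc.prems in auto)
  ultimately show ?case
    by (rule solv_cong[OF solv_add]) (simp add: osc_def)
qed

lemma solv_osc:
  assumes "\<zeta> \<noteq> 0" "N \<ge> \<gamma>" "e \<in> {0, \<zeta>}" "flat b (k + M) (N + real M) \<rho>"
  shows "solv \<zeta> N k M (osc m n c e (\<lambda>x. p x * \<rho> x))"
proof (cases "e = \<zeta>")
  case True
  then show ?thesis using solv_osc_by_parts[OF assms(1,2,4)] by simp
next
  case False
  then have "e = 0" using assms by auto
  moreover have "flat b k N \<rho>"
    by (rule flat_weaken[OF flat_le[OF assms(4)]]) auto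
  ultimately show ?thesis using solv_nonosc[of k N \<rho>] assms(2) gamma by simp
qed

text \<open>Substituting t = S / h reduces this to \<open>PH_integral\<close> without error;
  homogeneity of the density turns the prefactor h^(m \<gamma> + n) into h^((m + j) \<gamma> + n +
  l).\<close>

lemma solv_homog_power:
  assumes zeta: "\<zeta> \<noteq> 0" and g: "PH \<gamma> (-\<zeta>) m n g" and j: "1 \<le> j"
  shows "solv \<zeta> N k M (\<lambda>(h, x). homog m n c g (h, x) * cis (2 * \<zeta> * (S x / h)) *
    of_real (p x * S x powr (real j * \<gamma> + real l - 1)))"
proof -
  obtain G where G: "PH \<gamma> \<zeta> (m + j) (n + l) G" "(G \<longlongrightarrow> 0) (at_right 0)"
    "\<And>t. t > 0 \<Longrightarrow> (G has_vector_derivative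
      of_real (t powr (real j * \<gamma> + real l - 1)) * cis (2 * \<zeta> * t) * g t) (at t)"
    using PH_integral[OF gamma irr zeta g j, of l] by blast
  show ?thesis
  proof (rule solv_exact)
    show "homog (m + j) (n + l) c G \<in> sums_of (atoms \<zeta> N k)"
      by (intro sums_of_gen atoms_homog G)
    fix h :: real assume h: "h \<in> {0<..1}"
    have "filterlim (\<lambda>x. S x / h) (at_right 0) (at_right 0)"
      unfolding filterlim_at
    proof
      have "\<forall>\<^sub>F x in at_right 0. x \<in> {0<..b}"
        using b by (auto simp: eventually_at_right_field)
      then show "\<forall>\<^sub>F x in at_right 0. S x / h \<in> {0<..} \<and> S x / h \<noteq> 0"
      proof eventually_elim
        case (elim x)
        have "S x / h > 0" using S_pos[OF elim] h by simp
        then show ?case by auto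
      qed
      show "((\<lambda>x. S x / h) \<longlongrightarrow> 0) (at_right 0)"
        using tendsto_divide[OF S_lim tendsto_const[of h]] h by simp
    qed
    from filterlim_compose[OF G(2) this]
    have "((\<lambda>x. of_real (h powr (real (m + j) * \<gamma> + real (n + l))) * c * G (S x / h)) \<longlongrightarrow>
        of_real (h powr (real (m + j) * \<gamma> + real (n + l))) * c * 0) (at_right 0)"
      by (intro tendsto_intros)
    then show "((\<lambda>x. homog (m + j) (n + l) c G (h, x)) \<longlongrightarrow> 0) (at_right 0)"
      by (simp add: homog_def)
    fix x assume x: "x \<in> {0<..b}"
    define a where "a = real j * \<gamma> + real l - 1"
    have t: "S x / h > 0" using S_pos[OF x] h by auto
    have "((G \<circ> (\<lambda>x. S x / h)) has_vector_derivative (p x / h) *\<^sub>R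
        (of_real ((S x / h) powr a) * cis (2 * \<zeta> * (S x / h)) * g (S x / h))) (at x within {0<..b})"
      using S_over_h_deriv[OF x, of h] has_vector_derivative_at_within[OF G(3)[OF t]]
      by (intro vector_diff_chain_within) (auto simp: has_real_derivative_iff_has_vector_derivative a_def)
    from has_vector_derivative_mult_right[OF this, of "of_real (h powr (real (m + j) * \<gamma> + real (n + l))) * c"]
    have "((\<lambda>x. homog (m + j) (n + l) c G (h, x)) has_vector_derivative
        of_real (h powr (real (m + j) * \<gamma> + real (n + l))) * c * ((p x / h) *\<^sub>R
        (of_real ((S x / h) powr a) * cis (2 * \<zeta> * (S x / h)) * g (S x / h)))) (at x within {0<..b})"
      by (simp add: homog_def o_def)
    also have "of_real (h powr (real (m + j) * \<gamma> + real (n + l))) * c * ((p x / h) *\<^sub>R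
        (of_real ((S x / h) powr a) * cis (2 * \<zeta> * (S x / h)) * g (S x / h))) =
       of_real (h powr (real (m + j) * \<gamma> + real (n + l)) * (p x / h) * (S x / h) powr a) * c *
        cis (2 * \<zeta> * (S x / h)) * g (S x / h)"
      by (simp add: scaleR_conv_of_real)
    also have "h powr (real (m + j) * \<gamma> + real (n + l)) * (p x / h) * (S x / h) powr a =
       h powr (real m * \<gamma> + real n) * (p x * S x powr a)"
    proof -
      have "h powr (real (m + j) * \<gamma> + real (n + l)) = h powr ((real m * \<gamma> + real n) + a + 1)"
        by (simp add: a_def algebra_simps)
      also have "\<dots> = h powr (real m * \<gamma> + real n) * h powr a * h"
        using h by (simp only: powr_add) simp
      finally show ?thesis using h S_pos[OF x] by (simp add: powr_divide less_imp_le)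
    qed
    finally show "((\<lambda>x. homog (m + j) (n + l) c G (h, x)) has_vector_derivative
        (case (h, x) of (h, x) \<Rightarrow> homog m n c g (h, x) * cis (2 * \<zeta> * (S x / h)) *
        of_real (p x * S x powr (real j * \<gamma> + real l - 1)))) (at x within {0<..b})"
      unfolding a_def[symmetric] by (simp add: homog_def mult_ac)
  qed
qed

text \<open>The bounds on \<open>j\<close> and \<open>l\<close> pay off here: the power of h that is
  left has the nonnegative integer coefficients m - j and n - l.\<close>

lemma homog_inf_power:
  assumes "h > 0" "s > 0" "j \<le> m" "l \<le> int n"
  shows "h powr (real m * \<gamma> + real n) * (s / h) powr (real j * \<gamma> + of_int l) =
    h powr (real (m - j) * \<gamma> + real (nat (int n - l))) * s powr (real j * \<gamma> + of_int l)"
proof -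
  have "real m * \<gamma> + real n = (real (m - j) * \<gamma> + real (nat (int n - l))) + (real j * \<gamma> + of_int l)"
    using assms by (simp add: of_nat_diff algebra_simps)
  then have "h powr (real m * \<gamma> + real n) =
      h powr (real (m - j) * \<gamma> + real (nat (int n - l))) * h powr (real j * \<gamma> + of_int l)"
    by (simp only: powr_add)
  then show ?thesis using assms by (simp add: powr_divide)
qed

lemma flat_div_S: "flat b k N R \<Longrightarrow> flat b k (N - 1) (\<lambda>x. R x / S x)"
proof (rule flat_cong)
  assume "flat b k N R"
  from flat_mult[OF this flat_S_powr[of k "-1"]] show "flat b k (N - 1) (\<lambda>x. R x * S x powr (-1))"
    by simp
  show "R x * S x powr (-1) = R x / S x" if "x \<in> {0<..b}" for x
    using S_pos[OF that] by (simp add: powr_minus field_simps)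
qed

text \<open>Powers of S / h, possibly negative, are split into a power of h and a power of
  \<open>S\<close>, and the latter is absorbed by the flatness of \<open>R\<close>. The threshold is
  uniform in \<open>R\<close> and \<open>e\<close>, so that it can be fixed before the density is
  expanded.\<close>

lemma solv_inf_powers:
  assumes zeta: "\<zeta> \<noteq> 0" and N: "N \<ge> \<gamma>" and P: "P \<in> sums_of (inf_powers \<gamma> m n)"
  shows "\<exists>N0. \<forall>N'\<ge>N0. \<forall>R e. flat b (k + M) N' R \<longrightarrow> e \<in> {0, \<zeta>} \<longrightarrow>
    solv \<zeta> N k M (\<lambda>(h, x). of_real (h powr (real m * \<gamma> + real n)) * c * P (S x / h) *
      cis (2 * e * (S x / h)) * of_real (p x * (R x / S x)))"
  using P
proof induction
  case sums_of_zero
  show ?case by (intro exI[of _ 0] allI impI solv_small[where C = 0]) simp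
next
  case (sums_of_gen f)
  then obtain c' j l where f: "f = (\<lambda>t. c' * of_real (t powr (real j * \<gamma> + of_int l)))"
    "1 \<le> j" "j \<le> m" "l \<le> int n" by (rule inf_powers_E)
  define a where "a = real j * \<gamma> + of_int l"
  \<comment> \<open>The threshold covers the target order, \<open>M\<close> integrations by parts,
    the division by \<open>S\<close> and the exponent \<open>a\<close>.\<close>
  have "solv \<zeta> N k M (\<lambda>(h, x). of_real (h powr (real m * \<gamma> + real n)) * c * f (S x / h) *
      cis (2 * e * (S x / h)) * of_real (p x * (R x / S x)))"
    if N': "N' \<ge> N + real M + 1 - a" and R: "flat b (k + M) N' R" and e: "e \<in> {0, \<zeta>}" for N' R e
  proof -
    have "flat b (k + M) (a + (N' - 1)) (\<lambda>x. S x powr a * (R x / S x))"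
      by (intro flat_mult flat_S_powr flat_div_S R)
    then have "flat b (k + M) (N + real M) (\<lambda>x. S x powr a * (R x / S x))"
      by (rule flat_weaken) (use N' in auto)
    from solv_osc[OF zeta N e this]
    have "solv \<zeta> N k M (osc (m - j) (nat (int n - l)) (c * c') e (\<lambda>x. p x * (S x powr a * (R x / S x))))" .
    then show ?thesis
    proof (rule solv_cong)
      fix h x :: real assume h: "h \<in> {0<..1}" and x: "x \<in> {0<..b}"
      have "osc (m - j) (nat (int n - l)) (c * c') e (\<lambda>x. p x * (S x powr a * (R x / S x))) (h, x) =
        of_real (h powr (real (m - j) * \<gamma> + real (nat (int n - l))) * S x powr a) * (c * c') *
         cis (2 * e * (S x / h)) * of_real (p x * (R x / S x))"
        by (simp add: osc_def)
      also have "h powr (real (m - j) * \<gamma> + real (nat (int n - l))) * S x powr a =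
          h powr (real m * \<gamma> + real n) * (S x / h) powr a"
        unfolding a_def using homog_inf_power[of h "S x" j m l n] f h S_pos[OF x] by simp
      finally show "osc (m - j) (nat (int n - l)) (c * c') e (\<lambda>x. p x * (S x powr a * (R x / S x))) (h, x) =
        (case (h, x) of (h, x) \<Rightarrow> of_real (h powr (real m * \<gamma> + real n)) * c * f (S x / h) *
        cis (2 * e * (S x / h)) * of_real (p x * (R x / S x)))"
        by (simp add: f a_def)
    qed
  qed
  then show ?case by blast
next
  case (sums_of_add f g)
  then obtain N1 N2 where
    1: "\<forall>N'\<ge>N1. \<forall>R e. flat b (k + M) N' R \<longrightarrow> e \<in> {0, \<zeta>} \<longrightarrow>
    solv \<zeta> N k M (\<lambda>(h, x). of_real (h powr (real m * \<gamma> + real n)) * c * f (S x / h) *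
      cis (2 * e * (S x / h)) * of_real (p x * (R x / S x)))"
    and 2: "\<forall>N'\<ge>N2. \<forall>R e. flat b (k + M) N' R \<longrightarrow> e \<in> {0, \<zeta>} \<longrightarrow>
    solv \<zeta> N k M (\<lambda>(h, x). of_real (h powr (real m * \<gamma> + real n)) * c * g (S x / h) *
      cis (2 * e * (S x / h)) * of_real (p x * (R x / S x)))"
    by (elim exE)
  show ?case
  proof (intro exI[of _ "max N1 N2"] allI impI)
    fix N' R e assume *: "N' \<ge> max N1 N2" "flat b (k + M) N' R" "e \<in> {0, \<zeta>}"
    have "N' \<ge> N1" "N' \<ge> N2" using * by auto
    from solv_add[OF 1[rule_format, OF this(1) *(2,3)] 2[rule_format, OF this(2) *(2,3)]]
    show "solv \<zeta> N k M (\<lambda>(h, x). of_real (h powr (real m * \<gamma> + real n)) * c * (f (S x / h) + g (S x / h)) *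
      cis (2 * e * (S x / h)) * of_real (p x * (R x / S x)))"
      by (rule solv_cong) (simp add: algebra_simps)
  qed
qed

text \<open>Against a flat density \<open>g\<close> may be replaced by its expansion at infinity
  even for small S / h. The constant and \<open>P\<close> keep the phase of the kernel,
  \<open>Q\<close> loses it, and the remainder t^(-M) becomes h^M S^(-M) with the negative power
  absorbed by flatness.\<close>

lemma solv_homog_flat:
  assumes zeta: "\<zeta> \<noteq> 0" and N: "N \<ge> \<gamma>" and g: "PH \<gamma> (-\<zeta>) m n g"
  shows "\<exists>N'. \<forall>R. flat b (k + M) N' R \<longrightarrow>
    solv \<zeta> N k M (\<lambda>(h, x). homog m n c g (h, x) * cis (2 * \<zeta> * (S x / h)) * of_real (p x * (R x / S x)))"
proof -
  obtain c0 P Q D K where PQ: "P \<in> sums_of (inf_powers \<gamma> m n)" "Q \<in> sums_of (inf_powers \<gamma> m n)" "D \<ge> 0"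
    and D: "\<forall>t>0. norm (g t - (c0 + P t + cis (2 * (-\<zeta>) * t) * Q t))
      \<le> D * t powr (- real M) * (1 + t powr (- real K))"
    using g by (rule PH_expansion_all)
  obtain N1 where N1: "\<forall>N'\<ge>N1. \<forall>R e. flat b (k + M) N' R \<longrightarrow> e \<in> {0, \<zeta>} \<longrightarrow>
    solv \<zeta> N k M (\<lambda>(h, x). of_real (h powr (real m * \<gamma> + real n)) * c * P (S x / h) *
      cis (2 * e * (S x / h)) * of_real (p x * (R x / S x)))"
    using solv_inf_powers[OF zeta N PQ(1)] by (rule exE)
  obtain N2 where N2: "\<forall>N'\<ge>N2. \<forall>R e. flat b (k + M) N' R \<longrightarrow> e \<in> {0, \<zeta>} \<longrightarrow>
    solv \<zeta> N k M (\<lambda>(h, x). of_real (h powr (real m * \<gamma> + real n)) * c * Q (S x / h) *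
      cis (2 * e * (S x / h)) * of_real (p x * (R x / S x)))"
    using solv_inf_powers[OF zeta N PQ(2)] by (rule exE)
  \<comment> \<open>Beyond both thresholds; \<open>M\<close> and \<open>K\<close> pay for the
    negative powers of \<open>S\<close> in the remainder, and 1 for the division by
    \<open>S\<close>.\<close>
  define N' where "N' = \<bar>N1\<bar> + \<bar>N2\<bar> + N + real M + real K + 1"
  have "solv \<zeta> N k M (\<lambda>(h, x). homog m n c g (h, x) * cis (2 * \<zeta> * (S x / h)) * of_real (p x * (R x / S x)))"
    if R: "flat b (k + M) N' R" for R
  proof -
    have s1: "solv \<zeta> N k M (\<lambda>(h, x). of_real (h powr (real m * \<gamma> + real n)) * c * P (S x / h) *
      cis (2 * \<zeta> * (S x / h)) * of_real (p x * (R x / S x)))"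
      by (rule N1[rule_format, OF _ R]) (use N gamma in \<open>auto simp: N'_def\<close>)
    have s2: "solv \<zeta> N k M (\<lambda>(h, x). of_real (h powr (real m * \<gamma> + real n)) * c * Q (S x / h) *
      cis (2 * 0 * (S x / h)) * of_real (p x * (R x / S x)))"
      by (rule N2[rule_format, OF _ R]) (use N gamma in \<open>auto simp: N'_def\<close>)
    have "flat b (k + M) (N + real M) (\<lambda>x. R x / S x)"
      by (rule flat_weaken[OF flat_div_S[OF R]]) (simp add: N'_def)
    from solv_osc[OF zeta N _ this, of \<zeta> m n "c * c0"]
    have s3: "solv \<zeta> N k M (osc m n (c * c0) \<zeta> (\<lambda>x. p x * (R x / S x)))" by simp
    let ?err = "\<lambda>t. g t - (c0 + P t + cis (2 * (-\<zeta>) * t) * Q t)"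
    have s4: "solv \<zeta> N k M (\<lambda>(h, x). of_real (h powr (real m * \<gamma> + real n)) * c * ?err (S x / h) *
      cis (2 * \<zeta> * (S x / h)) * of_real (p x * (R x / S x)))"
    proof -
      define F where "F x = p x * (R x / S x) * S x powr (- real M) * (1 + S x powr (- real K))" for x
      have "flat b (k + M) (0 + (N' - 1) + (- real M) + (- real K)) F"
        unfolding F_def
        by (intro flat_mult flat_p flat_div_S R flat_S_powr flat_add flat_weaken[OF flat_const]) auto
      then have "flat b (k + M) (\<gamma> - 1) F"
        by (rule flat_weaken) (use N in \<open>auto simp: N'_def\<close>)
      then obtain C where C: "C > 0" "\<And>x. x \<in> {0<..b} \<Longrightarrow> \<bar>F x\<bar> \<le> C * x powr (\<gamma> - 1)"
        using flat_bound by blast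
      show ?thesis
      proof (rule solv_small)
        fix h x :: real assume h: "h \<in> {0<..1}" and x: "x \<in> {0<..b}"
        let ?t = "S x / h"
        have t: "?t > 0" using h S_pos[OF x] by auto
        have h1: "h powr (real m * \<gamma> + real n) \<le> 1"
          using h gamma powr_mono'[of 0 "real m * \<gamma> + real n" h] by simp
        have e1: "?t powr (- real M) = h ^ M * S x powr (- real M)"
          using h S_pos[OF x] by (simp add: powr_divide powr_minus powr_realpow field_simps)
        have "?t powr (- real K) = h ^ K * S x powr (- real K)"
          using h S_pos[OF x] by (simp add: powr_divide powr_minus powr_realpow field_simps)
        also have "\<dots> \<le> 1 * S x powr (- real K)"
          using h by (intro mult_right_mono power_le_one) auto
        finally have e2: "?t powr (- real K) \<le> S x powr (- real K)" by simp
        have "norm (of_real (h powr (real m * \<gamma> + real n)) * c * ?err ?t *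
            cis (2 * \<zeta> * (S x / h)) * of_real (p x * (R x / S x)))
          = h powr (real m * \<gamma> + real n) * norm c * norm (?err ?t) * \<bar>p x * (R x / S x)\<bar>"
          by (simp only: norm_mult norm_cis norm_of_real mult_1_right abs_of_nonneg[OF powr_ge_zero])
        also have "\<dots> \<le> 1 * norm c * (D * (h ^ M * S x powr (- real M)) * (1 + S x powr (- real K)))
             * \<bar>p x * (R x / S x)\<bar>"
        proof (intro mult_right_mono mult_mono)
          have "norm (?err ?t) \<le> D * ?t powr (- real M) * (1 + ?t powr (- real K))" by (rule D[rule_format, OF t])
          also have "\<dots> \<le> D * (h ^ M * S x powr (- real M)) * (1 + S x powr (- real K))"
            unfolding e1 using h PQ(3) e2 by (intro mult_left_mono) auto
          finally show "norm (?err ?t) \<le> D * (h ^ M * S x powr (- real M)) * (1 + S x powr (- real K))" .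
        qed (use h1 in auto)
        also have "\<dots> = norm c * D * h ^ M * \<bar>F x\<bar>"
          by (simp add: F_def abs_mult mult_ac)
        also have "\<dots> \<le> norm c * D * h ^ M * (C * x powr (\<gamma> - 1))"
          using C(2)[OF x] PQ(3) h by (intro mult_left_mono) auto
        finally show "norm (case (h, x) of (h, x) \<Rightarrow> of_real (h powr (real m * \<gamma> + real n)) * c * ?err (S x / h) *
            cis (2 * \<zeta> * (S x / h)) * of_real (p x * (R x / S x))) \<le> (norm c * D * C) * h ^ M * x powr (\<gamma> - 1)"
          by (simp only: prod.case mult_ac)
      qed
    qed
    show ?thesis
    proof (rule solv_cong[OF solv_add[OF solv_add[OF s1 s2] solv_add[OF s3 s4]]], goal_cases)
      case (1 h x)
      have cc: "cis (2 * (-\<zeta>) * (S x / h)) * cis (2 * \<zeta> * (S x / h)) = 1" by (simp add: cis_mult)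
      have "g (S x / h) * cis (2 * \<zeta> * (S x / h)) = P (S x / h) * cis (2 * \<zeta> * (S x / h)) +
        Q (S x / h) * (cis (2 * (-\<zeta>) * (S x / h)) * cis (2 * \<zeta> * (S x / h))) +
         c0 * cis (2 * \<zeta> * (S x / h)) + ?err (S x / h) * cis (2 * \<zeta> * (S x / h))"
        by (simp add: algebra_simps)
      then have eq: "g (S x / h) * cis (2 * \<zeta> * (S x / h)) = P (S x / h) * cis (2 * \<zeta> * (S x / h)) +
        Q (S x / h) + c0 * cis (2 * \<zeta> * (S x / h)) + ?err (S x / h) * cis (2 * \<zeta> * (S x / h))"
        unfolding cc by simp
      let ?H = "complex_of_real (h powr (real m * \<gamma> + real n))"
      let ?r = "complex_of_real (p x * (R x / S x))"
      have "?H * c * g (S x / h) * cis (2 * \<zeta> * (S x / h)) * ?r = ?H * c * (g (S x / h) * cis (2 * \<zeta> * (S x / h))) * ?r"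
        by (simp only: mult.assoc)
      also have "\<dots> = ?H * c * P (S x / h) * cis (2 * \<zeta> * (S x / h)) * ?r +
         ?H * c * Q (S x / h) * cis (2 * 0 * (S x / h)) * ?r +
        (?H * (c * c0) * cis (2 * \<zeta> * (S x / h)) * ?r + ?H * c * ?err (S x / h) * cis (2 * \<zeta> * (S x / h)) * ?r)"
        unfolding eq by (simp only: distrib_left distrib_right mult.assoc add.assoc) simp
      finally show ?case
        by (simp only: prod.case osc_def homog_def)
    qed
  qed
  then show ?thesis by blast
qed

text \<open>The flatness demanded of the remainder of S r depends on \<open>g\<close> and is fixed
  first; S r is then expanded that far. Its powers are integrated exactly, its remainder through the
  expansion of \<open>g\<close>.\<close>

lemma solv_homog:
  assumes zeta: "\<zeta> \<noteq> 0" and N: "N \<ge> \<gamma>" and g: "PH \<gamma> (-\<zeta>) m n g"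
  shows "solv \<zeta> N k M (\<lambda>(h, x). homog m n c g (h, x) * cis (2 * \<zeta> * (S x / h)) * of_real (p x * r x))"
proof -
  obtain N' where N': "\<forall>R. flat b (k + M) N' R \<longrightarrow>
    solv \<zeta> N k M (\<lambda>(h, x). homog m n c g (h, x) * cis (2 * \<zeta> * (S x / h)) * of_real (p x * (R x / S x)))"
    using solv_homog_flat[OF assms] by (rule exE)
  obtain P where P: "P \<in> sums_of {\<lambda>x. c * S x powr (real j * \<gamma> + real l) | c j l. j \<ge> 1}"
    "flat b (k + M) N' (\<lambda>x. S x * r x - P x)"
    using r_expansion[of "k + M" N'] by (rule bexE)
  note s1 = N'[rule_format, OF P(2)]
  have s2: "solv \<zeta> N k M (\<lambda>z. (\<lambda>(h, x) y. homog m n c g (h, x) * cis (2 * \<zeta> * (S x / h)) *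
      of_real (p x * (y / S x))) z (P (snd z)))"
    using P(1)
  proof (rule solv_sums_of)
    fix f assume "f \<in> {\<lambda>x. c * S x powr (real j * \<gamma> + real l) | c j l. j \<ge> 1}"
    then obtain c' j l where f: "f = (\<lambda>x. c' * S x powr (real j * \<gamma> + real l))" "1 \<le> j" by blast
    show "solv \<zeta> N k M (\<lambda>z. (\<lambda>(h, x) y. homog m n c g (h, x) * cis (2 * \<zeta> * (S x / h)) *
      of_real (p x * (y / S x))) z (f (snd z)))"
    proof (rule solv_cong[OF solv_homog_power[OF zeta g f(2), of N k M "c * of_real c'" l]])
      fix h x :: real assume x: "x \<in> {0<..b}"
      have e: "S x powr (real j * \<gamma> + real l - 1) = S x powr (real j * \<gamma> + real l) / S x"
        using S_pos[OF x] by (simp add: powr_diff)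
      show "(case (h, x) of (h, x) \<Rightarrow> homog m n (c * of_real c') g (h, x) * cis (2 * \<zeta> * (S x / h)) *
           of_real (p x * S x powr (real j * \<gamma> + real l - 1))) =
         (case (h, x) of (h, x) \<Rightarrow> \<lambda>y. homog m n c g (h, x) * cis (2 * \<zeta> * (S x / h)) *
           of_real (p x * (y / S x))) (f (snd (h, x)))"
        by (simp add: homog_def f e)
    qed
  qed (auto simp: distrib_left add_divide_distrib)
  show ?thesis
  proof (rule solv_cong[OF solv_add[OF s1 s2]])
    fix h x :: real assume x: "x \<in> {0<..b}"
    have "p x * r x = p x * ((S x * r x - P x) / S x) + p x * (P x / S x)"
      using S_pos[OF x] by (simp add: field_simps)
    then show "(case (h, x) of (h, x) \<Rightarrow> homog m n c g (h, x) * cis (2 * \<zeta> * (S x / h)) *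
         of_real (p x * ((S x * r x - P x) / S x))) +
       (case (h, x) of (h, x) \<Rightarrow> \<lambda>y. homog m n c g (h, x) * cis (2 * \<zeta> * (S x / h)) *
           of_real (p x * (y / S x))) (P (snd (h, x))) =
       (case (h, x) of (h, x) \<Rightarrow> homog m n c g (h, x) * cis (2 * \<zeta> * (S x / h)) * of_real (p x * r x))"
      by (simp only: prod.case snd_conv of_real_add distrib_left)
  qed
qed

text \<open>The price of one integration with accuracy h^M: \<open>M\<close> derivatives and
  \<open>M + 1\<close> orders of flatness, where the additional 1 compensates r = O(x^(\<gamma> -
  1)).\<close>

lemma solv_atoms:
  assumes zeta: "\<zeta> \<noteq> 0" and N: "N \<ge> \<gamma>" and f: "f \<in> sums_of (atoms (-\<zeta>) (N + real M + 1) (k + M))"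
  shows "solv \<zeta> N k M (\<lambda>(h, x). f (h, x) * cis (2 * \<zeta> * (S x / h)) * of_real (p x * r x))"
proof -
  have "solv \<zeta> N k M (\<lambda>z. (\<lambda>(h, x) y. y * cis (2 * \<zeta> * (S x / h)) * of_real (p x * r x)) z (f (id z)))"
    using f
  proof (rule solv_sums_of)
    fix g assume "g \<in> atoms (-\<zeta>) (N + real M + 1) (k + M)"
    then show "solv \<zeta> N k M (\<lambda>z. (\<lambda>(h, x) y. y * cis (2 * \<zeta> * (S x / h)) * of_real (p x * r x)) z (g (id z)))"
    proof (cases rule: atoms_cases)
      case (homog m n c g')
      show ?thesis
        by (rule solv_cong[OF solv_homog[OF zeta N homog(2), of k M c]]) (simp add: homog(1))
    next
      case (osc m n c e \<rho>)
      have "flat b (k + M) (\<gamma> - 1 + (N + real M + 1)) (\<lambda>x. r x * \<rho> x)"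
        by (intro flat_mult flat_r osc)
      then have "flat b (k + M) (N + real M) (\<lambda>x. r x * \<rho> x)"
        by (rule flat_weaken) (use gamma in auto)
      \<comment> \<open>The alternation of signs keeps two phases only; kernels of equal sign would
        accumulate harmonics.\<close>
      moreover have "e + \<zeta> \<in> {0, \<zeta>}" using osc(2) by auto
      ultimately have "solv \<zeta> N k M (osc m n c (e + \<zeta>) (\<lambda>x. p x * (r x * \<rho> x)))"
        by (intro solv_osc zeta N)
      then show ?thesis
      proof (rule solv_cong)
        fix h x :: real
        have "cis (2 * (e + \<zeta>) * (S x / h)) = cis (2 * e * (S x / h)) * cis (2 * \<zeta> * (S x / h))"
          by (simp add: cis_mult algebra_simps)
        then show "osc m n c (e + \<zeta>) (\<lambda>x. p x * (r x * \<rho> x)) (h, x) =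
          (case (h, x) of (h, x) \<Rightarrow> \<lambda>y. y * cis (2 * \<zeta> * (S x / h)) * of_real (p x * r x)) (g (id (h, x)))"
          by (simp only: osc(1) osc_def prod.case id_apply of_real_mult mult_ac)
      qed
    qed
  qed (auto simp: distrib_right)
  then show ?thesis by (rule solv_cong) simp
qed

text \<open>All orders \<open>N\<close>, \<open>k\<close>, \<open>M\<close> are demanded at once: an
  integration consumes flatness and derivatives, and this form lets it request more from its
  integrand.\<close>

definition expands :: "real \<Rightarrow> (real \<times> real \<Rightarrow> complex) \<Rightarrow> bool" where
  "expands \<zeta> f \<longleftrightarrow> (\<forall>N k M. \<exists>F\<in>sums_of (atoms \<zeta> (real N) k). \<exists>C. \<forall>h\<in>{0<..1}. \<forall>x\<in>{0<..b}.
     norm (f (h, x) - F (h, x)) \<le> C * h ^ M)"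

lemma expandsE:
  assumes "expands \<zeta> f"
  obtains F C where "F \<in> sums_of (atoms \<zeta> (real N) k)"
    "\<forall>h\<in>{0<..1}. \<forall>x\<in>{0<..b}. norm (f (h, x) - F (h, x)) \<le> C * h ^ M"
proof -
  have "\<exists>F\<in>sums_of (atoms \<zeta> (real N) k). \<exists>C. \<forall>h\<in>{0<..1}. \<forall>x\<in>{0<..b}.
     norm (f (h, x) - F (h, x)) \<le> C * h ^ M"
    using assms unfolding expands_def by (elim allE)
  then show thesis by (elim bexE exE) (rule that)
qed

lemma expands_one: "expands \<zeta> (\<lambda>z. 1)"
  unfolding expands_def
proof (intro allI)
  fix N k M
  show "\<exists>F\<in>sums_of (atoms \<zeta> (real N) k). \<exists>C. \<forall>h\<in>{0<..1}. \<forall>x\<in>{0<..b}.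
     norm (1 - F (h, x)) \<le> C * h ^ M"
  proof (rule bexI)
    show "homog 0 0 1 (\<lambda>t. 1) \<in> sums_of (atoms \<zeta> (real N) k)"
      by (intro sums_of_gen atoms_homog PH_one)
    show "\<exists>C. \<forall>h\<in>{0<..1}. \<forall>x\<in>{0<..b}. norm (1 - homog 0 0 1 (\<lambda>t. 1) (h, x)) \<le> C * h ^ M"
      by (intro exI[of _ 0]) (simp add: homog_def)
  qed
qed

text \<open>The exact integral and the approximate primitive both vanish at 0, and their derivatives
  differ by O(h^M x^(\<gamma> - 1)). The constant b^\<gamma> / \<gamma> arises from integrating
  x^(\<gamma> - 1).\<close>

lemma expands_integral:
  assumes zeta: "\<zeta> \<noteq> 0" and f: "expands (-\<zeta>) f"
    and lim: "\<And>h. h \<in> {0<..1} \<Longrightarrow> ((\<lambda>x. G (h, x)) \<longlongrightarrow> 0) (at_right 0)"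
    and der: "\<And>h x. h \<in> {0<..1} \<Longrightarrow> x \<in> {0<..b} \<Longrightarrow> ((\<lambda>x. G (h, x)) has_vector_derivative
      f (h, x) * cis (2 * \<zeta> * (S x / h)) * of_real (p x * r x)) (at x within {0<..b})"
  shows "expands \<zeta> G"
  unfolding expands_def
proof (intro allI)
  fix N k M :: nat
  obtain N1 :: nat where "max (real N) \<gamma> \<le> real N1" by (meson real_arch_simple)
  then have N1: "real N \<le> real N1" "\<gamma> \<le> real N1" by auto
  obtain F C where F: "F \<in> sums_of (atoms (-\<zeta>) (real (N1 + M + 1)) (k + M))"
    and C: "\<forall>h\<in>{0<..1}. \<forall>x\<in>{0<..b}. norm (f (h, x) - F (h, x)) \<le> C * h ^ M"
    using f by (rule expandsE)
  have "solv \<zeta> (real N1) k M (\<lambda>(h, x). F (h, x) * cis (2 * \<zeta> * (S x / h)) * of_real (p x * r x))"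
    by (rule solv_atoms[OF zeta N1(2)]) (use F in \<open>simp add: add.commute\<close>)
  then obtain A D d where A: "A \<in> sums_of (atoms \<zeta> (real N1) k)"
    "\<forall>h\<in>{0<..1}. ((\<lambda>x. A (h, x)) \<longlongrightarrow> 0) (at_right 0)"
    "\<forall>h\<in>{0<..1}. \<forall>x\<in>{0<..b}. ((\<lambda>x. A (h, x)) has_vector_derivative d h x) (at x within {0<..b})"
    "\<forall>h\<in>{0<..1}. \<forall>x\<in>{0<..b}. norm (d h x - (\<lambda>(h, x). F (h, x) * cis (2 * \<zeta> * (S x / h)) *
       of_real (p x * r x)) (h, x)) \<le> D * h ^ M * x powr (\<gamma> - 1)"
    by (rule solvE)
  have "flat b 0 (0 + (\<gamma> - 1)) (\<lambda>x. p x * r x)" by (intro flat_mult flat_p flat_r)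
  then obtain B where B: "B > 0" "\<And>x. x \<in> {0<..b} \<Longrightarrow> \<bar>p x * r x\<bar> \<le> B * x powr (0 + (\<gamma> - 1))"
    using flat_bound by blast
  have bound: "norm (G (h, x) - A (h, x)) \<le> (\<bar>C\<bar> * B + \<bar>D\<bar>) * b powr \<gamma> / \<gamma> * h ^ M"
    if h: "h \<in> {0<..1}" and x: "x \<in> {0<..b}" for h x
  proof -
    have "norm (G (h, x) - A (h, x)) \<le> (\<bar>C\<bar> * B + \<bar>D\<bar>) * h ^ M / ((\<gamma> - 1) + 1) * x powr ((\<gamma> - 1) + 1)"
    proof (rule bound_from_zero[where b = b])
      show "((\<lambda>x. G (h, x) - A (h, x)) \<longlongrightarrow> 0) (at_right 0)"
        using tendsto_diff[OF lim[OF h] A(2)[rule_format, OF h]] by simp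
      fix y assume y: "y \<in> {0<..b}"
      let ?w = "f (h, y) * cis (2 * \<zeta> * (S y / h)) * of_real (p y * r y)"
      let ?v = "F (h, y) * cis (2 * \<zeta> * (S y / h)) * of_real (p y * r y)"
      have "?w - ?v = (f (h, y) - F (h, y)) * cis (2 * \<zeta> * (S y / h)) * of_real (p y * r y)"
        by (simp add: algebra_simps)
      then have "norm (?w - ?v) = norm (f (h, y) - F (h, y)) * \<bar>p y * r y\<bar>"
        by (simp add: norm_mult abs_mult)
      also have "\<dots> \<le> (\<bar>C\<bar> * h ^ M) * (B * y powr (\<gamma> - 1))"
      proof (intro mult_mono)
        have "norm (f (h, y) - F (h, y)) \<le> C * h ^ M" using C h y by blast
        also have "\<dots> \<le> \<bar>C\<bar> * h ^ M" using h by (intro mult_right_mono) auto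
        finally show "norm (f (h, y) - F (h, y)) \<le> \<bar>C\<bar> * h ^ M" .
      qed (use B(2)[OF y] h in auto)
      finally have 1: "norm (?w - ?v) \<le> \<bar>C\<bar> * B * h ^ M * y powr (\<gamma> - 1)" by (simp add: mult_ac)
      have "norm (d h y - ?v) \<le> D * h ^ M * y powr (\<gamma> - 1)"
        using A(4)[rule_format, OF h y] by simp
      also have "\<dots> \<le> \<bar>D\<bar> * h ^ M * y powr (\<gamma> - 1)" using h by (intro mult_right_mono) auto
      finally have 2: "norm (d h y - ?v) \<le> \<bar>D\<bar> * h ^ M * y powr (\<gamma> - 1)" .
      have "norm (?w - d h y) \<le> norm (?w - ?v) + norm (d h y - ?v)"
        by (metis norm_triangle_sub dist_norm dist_triangle2)
      also have "\<dots> \<le> (\<bar>C\<bar> * B + \<bar>D\<bar>) * h ^ M * y powr (\<gamma> - 1)"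
        using 1 2 by (simp add: distrib_right)
      finally have "norm (?w - d h y) \<le> (\<bar>C\<bar> * B + \<bar>D\<bar>) * h ^ M * y powr (\<gamma> - 1)" .
      then show "\<exists>d. ((\<lambda>x. G (h, x) - A (h, x)) has_vector_derivative d) (at y within {0<..b}) \<and>
          norm d \<le> (\<bar>C\<bar> * B + \<bar>D\<bar>) * h ^ M * y powr (\<gamma> - 1)"
        using has_vector_derivative_diff[OF der[OF h y] A(3)[rule_format, OF h y]] by blast
    qed (use gamma x in auto)
    also have "\<dots> = (\<bar>C\<bar> * B + \<bar>D\<bar>) * h ^ M / \<gamma> * x powr \<gamma>" by simp
    also have "\<dots> \<le> (\<bar>C\<bar> * B + \<bar>D\<bar>) * h ^ M / \<gamma> * b powr \<gamma>"
      using x gamma B(1) h by (intro mult_left_mono powr_mono2) auto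
    finally show ?thesis by (simp add: mult_ac)
  qed
  have "A \<in> sums_of (atoms \<zeta> (real N) k)"
    by (rule sums_of_mono[OF A(1) atoms_mono[OF N1(1)]])
  then show "\<exists>F\<in>sums_of (atoms \<zeta> (real N) k). \<exists>C. \<forall>h\<in>{0<..1}. \<forall>x\<in>{0<..b}.
     norm (G (h, x) - F (h, x)) \<le> C * h ^ M"
    using bound by (intro bexI[of _ A] exI ballI)
qed

section \<open>Values at the right endpoint b\<close>

definition h_powers :: "(real \<Rightarrow> complex) set" where
  "h_powers = {\<lambda>h. c * of_real (h powr (real m * \<gamma> + real n)) | c m n. True}"

lemma h_powers_I: "(\<lambda>h. c * of_real (h powr (real m * \<gamma> + real n))) \<in> h_powers"
  unfolding h_powers_def by blast

lemma inf_powers_at_end: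
  assumes "P \<in> sums_of (inf_powers \<gamma> m n)" "s > 0"
  shows "\<exists>A\<in>sums_of h_powers. \<forall>h>0. of_real (h powr (real m * \<gamma> + real n)) * c * P (s / h) = A h"
  using assms(1)
proof induction
  case sums_of_zero
  show ?case by (intro bexI[OF _ sums_of.sums_of_zero]) simp
next
  case (sums_of_gen f)
  then obtain c' j l where f: "f = (\<lambda>t. c' * of_real (t powr (real j * \<gamma> + of_int l)))"
    "1 \<le> j" "j \<le> m" "l \<le> int n" by (rule inf_powers_E)
  let ?A = "\<lambda>h. (c * c' * of_real (s powr (real j * \<gamma> + of_int l))) *
    of_real (h powr (real (m - j) * \<gamma> + real (nat (int n - l))))"
  show ?case
  proof (intro bexI[of _ ?A] allI impI)
    fix h :: real assume h: "h > 0"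
    have "of_real (h powr (real m * \<gamma> + real n)) * c * f (s / h) =
       c * c' * of_real (h powr (real m * \<gamma> + real n) * (s / h) powr (real j * \<gamma> + of_int l))"
      by (simp add: f mult_ac)
    also have "h powr (real m * \<gamma> + real n) * (s / h) powr (real j * \<gamma> + of_int l) =
      h powr (real (m - j) * \<gamma> + real (nat (int n - l))) * s powr (real j * \<gamma> + of_int l)"
      by (rule homog_inf_power) (use h f assms in auto)
    finally show "of_real (h powr (real m * \<gamma> + real n)) * c * f (s / h) = ?A h"
      by (simp only: of_real_mult mult_ac)
  qed (intro sums_of.sums_of_gen h_powers_I)
next
  case (sums_of_add f g)
  then obtain A B where "A \<in> sums_of h_powers" "B \<in> sums_of h_powers"
    "\<forall>h>0. of_real (h powr (real m * \<gamma> + real n)) * c * f (s / h) = A h"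
    "\<forall>h>0. of_real (h powr (real m * \<gamma> + real n)) * c * g (s / h) = B h" by blast
  then show ?case
    by (intro bexI[OF _ sums_of.sums_of_add[of A _ B]]) (simp_all add: distrib_left)
qed

definition splits :: "real \<Rightarrow> nat \<Rightarrow> (real \<Rightarrow> complex) \<Rightarrow> bool" where
  "splits \<zeta> M f \<longleftrightarrow> (\<exists>A\<in>sums_of h_powers. \<exists>B\<in>sums_of h_powers. \<exists>C. \<forall>h\<in>{0<..1}.
     norm (f h - (A h + cis (2 * \<zeta> * (S b / h)) * B h)) \<le> C * h ^ M)"

lemma splitsI:
  assumes "A \<in> sums_of h_powers" "B \<in> sums_of h_powers"
    "\<And>h. h \<in> {0<..1} \<Longrightarrow> norm (f h - (A h + cis (2 * \<zeta> * (S b / h)) * B h)) \<le> C * h ^ M"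
  shows "splits \<zeta> M f"
  unfolding splits_def
  by (rule bexI[OF _ assms(1)], rule bexI[OF _ assms(2)], rule exI[of _ C]) (use assms(3) in blast)

lemma splits_add:
  assumes "splits \<zeta> M f" "splits \<zeta> M g" shows "splits \<zeta> M (\<lambda>h. f h + g h)"
proof -
  obtain A B C where 1: "A \<in> sums_of h_powers" "B \<in> sums_of h_powers"
    "\<forall>h\<in>{0<..1}. norm (f h - (A h + cis (2 * \<zeta> * (S b / h)) * B h)) \<le> C * h ^ M"
    using assms(1) unfolding splits_def by (elim bexE exE)
  obtain A' B' C' where 2: "A' \<in> sums_of h_powers" "B' \<in> sums_of h_powers"
    "\<forall>h\<in>{0<..1}. norm (g h - (A' h + cis (2 * \<zeta> * (S b / h)) * B' h)) \<le> C' * h ^ M"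
    using assms(2) unfolding splits_def by (elim bexE exE)
  show ?thesis
  proof (rule splitsI[OF sums_of_add[OF 1(1) 2(1)] sums_of_add[OF 1(2) 2(2)]])
    fix h :: real assume h: "h \<in> {0<..1}"
    have "norm (f h + g h - (A h + A' h + cis (2 * \<zeta> * (S b / h)) * (B h + B' h))) \<le>
      norm (f h - (A h + cis (2 * \<zeta> * (S b / h)) * B h)) + norm (g h - (A' h + cis (2 * \<zeta> * (S b / h)) * B' h))"
      using norm_triangle_ineq[of "f h - (A h + cis (2 * \<zeta> * (S b / h)) * B h)"
          "g h - (A' h + cis (2 * \<zeta> * (S b / h)) * B' h)"]
      by (simp add: algebra_simps)
    also have "\<dots> \<le> (C + C') * h ^ M"
      using 1(3)[rule_format, OF h] 2(3)[rule_format, OF h] by (simp add: distrib_right)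
    finally show "norm (f h + g h - (A h + A' h + cis (2 * \<zeta> * (S b / h)) * (B h + B' h))) \<le> (C + C') * h ^ M" .
  qed
qed

text \<open>At the fixed point b the argument S b / h tends to infinity as h tends to 0, so
  expansions at infinity turn into expansions in h. The bound for all t > 0 also covers those h in
  \<open>{0<..1}\<close> that exceed S b.\<close>

lemma atoms_split:
  assumes "F \<in> sums_of (atoms \<zeta> N k)"
  shows "splits \<zeta> M (\<lambda>h. F (h, b))"
  using assms
proof induction
  case sums_of_zero
  show ?case by (rule splitsI[OF sums_of.sums_of_zero sums_of.sums_of_zero, where C = 0]) simp
next
  case (sums_of_gen f)
  have s: "S b > 0" using S_pos[of b] b by simp
  from sums_of_gen show ?case
  proof (cases rule: atoms_cases)
    case (homog m n c g)
    obtain c0 P Q D K where PQ: "P \<in> sums_of (inf_powers \<gamma> m n)" "Q \<in> sums_of (inf_powers \<gamma> m n)" "D \<ge> 0"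
      and D: "\<forall>t>0. norm (g t - (c0 + P t + cis (2 * \<zeta> * t) * Q t))
        \<le> D * t powr (- real M) * (1 + t powr (- real K))"
      using homog(2) by (rule PH_expansion_all)
    obtain A where A: "A \<in> sums_of h_powers"
      "\<forall>h>0. of_real (h powr (real m * \<gamma> + real n)) * c * P (S b / h) = A h"
      using inf_powers_at_end[OF PQ(1) s] by (rule bexE)
    obtain B where B: "B \<in> sums_of h_powers"
      "\<forall>h>0. of_real (h powr (real m * \<gamma> + real n)) * c * Q (S b / h) = B h"
      using inf_powers_at_end[OF PQ(2) s] by (rule bexE)
    let ?A = "\<lambda>h. (c * c0) * of_real (h powr (real m * \<gamma> + real n)) + A h"
    show ?thesis
    proof (rule splitsI[of ?A B])
      show "?A \<in> sums_of h_powers" by (intro sums_of_add A(1) sums_of.sums_of_gen h_powers_I)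
      fix h :: real assume h: "h \<in> {0<..1}"
      let ?t = "S b / h" let ?H = "complex_of_real (h powr (real m * \<gamma> + real n))"
      let ?err = "g ?t - (c0 + P ?t + cis (2 * \<zeta> * ?t) * Q ?t)"
      have t: "?t > 0" using h s by auto
      have h0: "h > 0" using h by simp
      have h1: "h powr (real m * \<gamma> + real n) \<le> 1"
        using h gamma powr_mono'[of 0 "real m * \<gamma> + real n" h] by simp
      have e1: "?t powr (- real M) = h ^ M * S b powr (- real M)"
        using h s by (simp add: powr_divide powr_minus powr_realpow field_simps)
      have "?t powr (- real K) = h ^ K * S b powr (- real K)"
        using h s by (simp add: powr_divide powr_minus powr_realpow field_simps)
      also have "\<dots> \<le> 1 * S b powr (- real K)"
        using h by (intro mult_right_mono power_le_one) auto
      finally have e2: "?t powr (- real K) \<le> S b powr (- real K)" by simp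
      have "f (h, b) - (?A h + cis (2 * \<zeta> * ?t) * B h) = ?H * c * ?err"
        unfolding A(2)[rule_format, OF h0, symmetric] B(2)[rule_format, OF h0, symmetric]
        by (simp add: homog(1) homog_def algebra_simps)
      then have "norm (f (h, b) - (?A h + cis (2 * \<zeta> * ?t) * B h)) = h powr (real m * \<gamma> + real n) * norm c * norm ?err"
        by (simp add: norm_mult)
      also have "\<dots> \<le> 1 * norm c * (D * (h ^ M * S b powr (- real M)) * (1 + S b powr (- real K)))"
      proof (intro mult_mono)
        have "norm ?err \<le> D * ?t powr (- real M) * (1 + ?t powr (- real K))" by (rule D[rule_format, OF t])
        also have "\<dots> \<le> D * (h ^ M * S b powr (- real M)) * (1 + S b powr (- real K))"
          unfolding e1 using h PQ(3) e2 by (intro mult_left_mono) auto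
        finally show "norm ?err \<le> D * (h ^ M * S b powr (- real M)) * (1 + S b powr (- real K))" .
      qed (use h1 in auto)
      finally show "norm (f (h, b) - (?A h + cis (2 * \<zeta> * ?t) * B h)) \<le>
          (norm c * D * S b powr (- real M) * (1 + S b powr (- real K))) * h ^ M"
        by (simp add: mult_ac)
    qed (rule B(1))
  next
    case (osc m n c e \<rho>)
    let ?A = "\<lambda>h. (c * of_real (\<rho> b)) * of_real (h powr (real m * \<gamma> + real n))"
    have A: "?A \<in> sums_of h_powers" by (intro sums_of.sums_of_gen h_powers_I)
    show ?thesis
    proof (cases "e = 0")
      case True
      show ?thesis
        by (rule splitsI[OF A sums_of.sums_of_zero, where C = 0]) (simp add: osc(1) osc_def True)
    next
      case False
      then have "e = \<zeta>" using osc by auto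
      then show ?thesis
        by (intro splitsI[OF sums_of.sums_of_zero A, where C = 0]) (simp add: osc(1) osc_def)
    qed
  qed
next
  case (sums_of_add f g)
  then show ?case by (intro splits_add)
qed

lemma expands_split:
  assumes "expands \<zeta> f"
  shows "splits \<zeta> M (\<lambda>h. f (h, b))"
proof -
  \<comment> \<open>At a single point away from 0 only the error order \<open>M\<close> counts, so
    \<open>N = k = 0\<close> is taken.\<close>
  obtain F C where F: "F \<in> sums_of (atoms \<zeta> (real 0) 0)"
    "\<forall>h\<in>{0<..1}. \<forall>x\<in>{0<..b}. norm (f (h, x) - F (h, x)) \<le> C * h ^ M"
    using assms by (rule expandsE)
  have "splits \<zeta> M (\<lambda>h. f (h, b) - F (h, b))"
    by (rule splitsI[OF sums_of_zero sums_of_zero, where C = C]) (use F(2) b in auto)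
  from splits_add[OF this atoms_split[OF F(1)]] show ?thesis by simp
qed

end

section \<open>The Dyson series\<close>

context irrational_potential
begin

definition q :: "real \<Rightarrow> real" where "q x = p x * r x"

lemma flat_q: "flat b k (\<gamma> - 1) q"
  using flat_mult[OF flat_p flat_r, of k] unfolding q_def by simp

definition osc_int :: "real \<Rightarrow> real \<Rightarrow> (real \<Rightarrow> complex) \<Rightarrow> real \<Rightarrow> complex" where
  "osc_int \<zeta> h f x = integral {0..x} (\<lambda>y. f y * cis (2 * \<zeta> * (S y / h)) * of_real (q y))"

lemma q_bound: "\<exists>C>0. \<forall>x\<in>{0<..b}. \<bar>q x\<bar> \<le> C * x powr (\<gamma> - 1)"
  using flat_bound[OF flat_q] by metis

definition admissible :: "real \<Rightarrow> (real \<Rightarrow> complex) \<Rightarrow> bool" where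
  "admissible B f \<longleftrightarrow> continuous_on {0..b} f \<and> (\<forall>x\<in>{0..b}. norm (f x) \<le> B)"

lemma admissible_pos: "admissible B f \<Longrightarrow> B \<ge> 0"
  unfolding admissible_def using b by (metis atLeastAtMost_iff less_imp_le norm_ge_zero order_refl order_trans)

lemma osc_int_0 [simp]: "osc_int \<zeta> h f 0 = 0"
  by (simp add: osc_int_def)

text \<open>Fixing one constant makes all later bounds linear in the sup bound of the integrand with
  a common factor, as iteration requires.\<close>

definition q_const :: real where
  "q_const = (SOME C. C > 0 \<and> (\<forall>x\<in>{0<..b}. \<bar>q x\<bar> \<le> C * x powr (\<gamma> - 1)))"

lemma q_const: "q_const > 0" "x \<in> {0<..b} \<Longrightarrow> \<bar>q x\<bar> \<le> q_const * x powr (\<gamma> - 1)"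
proof -
  have "q_const > 0 \<and> (\<forall>x\<in>{0<..b}. \<bar>q x\<bar> \<le> q_const * x powr (\<gamma> - 1))"
    unfolding q_const_def by (rule someI_ex) (use q_bound in auto)
  then show "q_const > 0" "x \<in> {0<..b} \<Longrightarrow> \<bar>q x\<bar> \<le> q_const * x powr (\<gamma> - 1)" by auto
qed

lemma osc_integrand_bound:
  assumes f: "admissible B f" and x: "x \<in> {0<..b}"
  shows "norm (f x * cis (2 * \<zeta> * (S x / h)) * of_real (q x)) \<le> B * q_const * x powr (\<gamma> - 1)"
proof -
  have "norm (f x * cis (2 * \<zeta> * (S x / h)) * of_real (q x)) = norm (f x) * \<bar>q x\<bar>"
    by (simp add: norm_mult)
  also have "\<dots> \<le> B * (q_const * x powr (\<gamma> - 1))"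
    using f x q_const(2)[OF x] admissible_pos[OF f] by (intro mult_mono) (auto simp: admissible_def)
  finally show ?thesis by (simp add: mult.assoc)
qed

lemma osc_int_props:
  assumes f: "admissible B f" and h: "h > 0"
  shows osc_int_cont: "continuous_on {0..b} (osc_int \<zeta> h f)"
    and osc_int_deriv: "x \<in> {0<..b} \<Longrightarrow> (osc_int \<zeta> h f has_vector_derivative
      f x * cis (2 * \<zeta> * (S x / h)) * of_real (q x)) (at x within {0<..b})"
    and osc_int_lim: "(osc_int \<zeta> h f \<longlongrightarrow> 0) (at_right 0)"
    and osc_int_integrable: "(\<lambda>y. f y * cis (2 * \<zeta> * (S y / h)) * of_real (q y)) integrable_on {0..b}"
proof -
  let ?w = "\<lambda>y. f y * cis (2 * \<zeta> * (S y / h)) * of_real (q y)"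
  have fc: "continuous_on {0<..b} f" and Sc: "continuous_on {0<..b} S"
    using f S_cont unfolding admissible_def by (auto elim: continuous_on_subset)
  have w: "continuous_on {0<..b} ?w"
    using h by (intro continuous_intros fc Sc flat_continuous[OF flat_q]) auto
  have g: "\<gamma> - 1 > -1" using gamma by simp
  have eq: "osc_int \<zeta> h f = (\<lambda>x. integral {0..x} ?w)" by (simp add: osc_int_def fun_eq_iff)
  note A = antiderivative_from_zero[OF b w g osc_integrand_bound[OF f], folded eq]
  show "continuous_on {0..b} (osc_int \<zeta> h f)" "(osc_int \<zeta> h f \<longlongrightarrow> 0) (at_right 0)"
    "?w integrable_on {0..b}" by (rule A; assumption)+
  show "x \<in> {0<..b} \<Longrightarrow> (osc_int \<zeta> h f has_vector_derivative ?w x) (at x within {0<..b})"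
    by (rule A; assumption)
qed

text \<open>An upper bound for the integral of |q|, hence for the sup norm of \<open>osc_int\<close>
  as an operator.\<close>

definition Q :: real where "Q = q_const / \<gamma> * b powr \<gamma>"

lemma Q_pos: "Q > 0" using q_const(1) gamma b by (simp add: Q_def)

lemma primitive_bound:
  assumes lim: "(F \<longlongrightarrow> 0) (at_right 0)" and C: "C \<ge> 0"
    and der: "\<And>y. y \<in> {0<..b} \<Longrightarrow>
      \<exists>d. (F has_vector_derivative d) (at y within {0<..b}) \<and> norm d \<le> C * q_const * y powr (\<gamma> - 1)"
    and x: "x \<in> {0<..b}"
  shows "norm (F x) \<le> C * Q"
proof -
  have "norm (F x) \<le> C * q_const / ((\<gamma> - 1) + 1) * x powr ((\<gamma> - 1) + 1)"
    by (rule bound_from_zero[OF lim _ der x]) (use gamma in auto)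
  also have "\<dots> \<le> C * q_const / ((\<gamma> - 1) + 1) * b powr ((\<gamma> - 1) + 1)"
    using x gamma C q_const(1) by (intro mult_left_mono powr_mono2) auto
  finally show ?thesis by (simp add: Q_def)
qed

lemma osc_int_bound:
  assumes f: "admissible B f" and h: "h > 0" and x: "x \<in> {0..b}"
  shows "norm (osc_int \<zeta> h f x) \<le> B * Q"
proof (cases "x = 0")
  case True
  then show ?thesis using admissible_pos[OF f] Q_pos by simp
next
  case False
  then have x': "x \<in> {0<..b}" using x by auto
  show ?thesis
    by (rule primitive_bound[OF osc_int_lim[OF f h] admissible_pos[OF f] _ x'])
      (use osc_int_deriv[OF f h] osc_integrand_bound[OF f] in blast)
qed

lemma admissible_osc_int: "admissible B f \<Longrightarrow> h > 0 \<Longrightarrow> admissible (B * Q) (osc_int \<zeta> h f)"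
  unfolding admissible_def[of "B * Q"] using osc_int_cont osc_int_bound by blast

lemma osc_int_diff:
  assumes "admissible B f" "admissible D g" "h > 0" "x \<in> {0..b}"
  shows "osc_int \<zeta> h (\<lambda>x. f x - g x) x = osc_int \<zeta> h f x - osc_int \<zeta> h g x"
proof -
  have "(\<lambda>y. f y * cis (2 * \<zeta> * (S y / h)) * of_real (q y)) integrable_on {0..x}"
    "(\<lambda>y. g y * cis (2 * \<zeta> * (S y / h)) * of_real (q y)) integrable_on {0..x}"
    by (rule integrable_subinterval_real[OF osc_int_integrable[OF assms(1,3)]],
        use assms(4) in simp)
       (rule integrable_subinterval_real[OF osc_int_integrable[OF assms(2,3)]],
        use assms(4) in simp)
  then show ?thesis
    unfolding osc_int_def by (simp add: left_diff_distrib integral_diff)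
qed

lemma admissible_diff:
  assumes "admissible B f" "admissible D g" shows "admissible (B + D) (\<lambda>x. f x - g x)"
  using assms unfolding admissible_def
  by (auto intro!: continuous_on_diff order_trans[OF norm_triangle_ineq4] add_mono)

lemma admissible_const: "admissible (norm c) (\<lambda>x. c)"
  unfolding admissible_def by auto

text \<open>A decay exponent strictly below 1, so that the integral of y^(gamma0 - 2) over
  \<open>{h..x}\<close> is dominated by its lower end and has size h^(gamma0 - 1).\<close>

definition gamma0 :: real where "gamma0 = min \<gamma> (1 / 2)"

lemma gamma0: "gamma0 > 0" "gamma0 \<le> \<gamma>" "gamma0 < 1"
  using gamma by (auto simp: gamma0_def)

text \<open>Split at x = h. On \<open>{0..h}\<close> the absolute bound already gives h^gamma0; on
  \<open>{h..x}\<close> one integration by parts gives boundary terms h r and an integral of h r',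
  both of that size.\<close>

lemma osc_int_one_bound:
  assumes zeta: "\<bar>\<zeta>\<bar> = 1"
  shows "\<exists>C>0. \<forall>h\<in>{0<..1}. \<forall>x\<in>{0..b}. norm (osc_int \<zeta> h (\<lambda>_. 1) x) \<le> C * h powr gamma0"
proof -
  have r: "flat b (Suc 0) (gamma0 - 1) r"
    by (rule flat_weaken[OF flat_r]) (use gamma0 in auto)
  obtain Cr where Cr: "Cr > 0" "\<And>x. x \<in> {0<..b} \<Longrightarrow> \<bar>r x\<bar> \<le> Cr * x powr (gamma0 - 1)"
    using flat_bound[OF r] by blast
  obtain dr where dr: "\<And>x. x \<in> {0<..b} \<Longrightarrow> (r has_real_derivative dr x) (at x within {0<..b})"
    "flat b 0 (gamma0 - 1) (\<lambda>x. x * dr x)"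
    using r by (rule flat_deriv) blast
  obtain Cd where Cd: "Cd > 0" "\<And>x. x \<in> {0<..b} \<Longrightarrow> \<bar>x * dr x\<bar> \<le> Cd * x powr (gamma0 - 1)"
    using flat_bound[OF dr(2)] by blast
  have "flat b 0 (gamma0 - 1) q"
    by (rule flat_weaken[OF flat_q]) (use gamma0 in auto)
  then obtain Cq where Cq: "Cq > 0" "\<And>x. x \<in> {0<..b} \<Longrightarrow> \<bar>q x\<bar> \<le> Cq * x powr (gamma0 - 1)"
    using flat_bound by blast
  \<comment> \<open>Contributions of the interval \<open>{0..h}\<close>, of the boundary terms and
    of the integral of the derivative of \<open>r\<close>.\<close>
  define C where "C = Cq / gamma0 + Cr + Cd / (1 - gamma0)"
  have adm: "admissible 1 (\<lambda>_. 1)" using admissible_const[of 1] by simp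
  have small: "norm (osc_int \<zeta> h (\<lambda>_. 1) x) \<le> Cq / gamma0 * x powr gamma0"
    if h: "h > 0" and x: "x \<in> {0<..b}" for h x
  proof -
    have "norm (osc_int \<zeta> h (\<lambda>_. 1) x) \<le> Cq / ((gamma0 - 1) + 1) * x powr ((gamma0 - 1) + 1)"
    proof (rule bound_from_zero[OF osc_int_lim[OF adm h] _ _ x])
      fix y assume y: "y \<in> {0<..b}"
      have "norm (1 * cis (2 * \<zeta> * (S y / h)) * of_real (q y)) \<le> Cq * y powr (gamma0 - 1)"
        using Cq(2)[OF y] by simp
      then show "\<exists>d. (osc_int \<zeta> h (\<lambda>_. 1) has_vector_derivative d) (at y within {0<..b}) \<and>
          norm d \<le> Cq * y powr (gamma0 - 1)"
        using osc_int_deriv[OF adm h y, of \<zeta>] by blast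
    qed (use gamma0 in auto)
    then show ?thesis by simp
  qed
  have "norm (osc_int \<zeta> h (\<lambda>_. 1) x) \<le> C * h powr gamma0" if h: "h \<in> {0<..1}" and x: "x \<in> {0..b}" for h x
  proof -
    have C1: "Cq / gamma0 \<le> C" and Cp: "C > 0" "Cr + Cd / (1 - gamma0) \<ge> 0"
      using Cr Cd Cq gamma0 by (simp_all add: C_def add_pos_pos)
    consider "x = 0" | "0 < x" "x \<le> h" | "h < x" using x by force
    then show ?thesis
    proof cases
      case 1
      then show ?thesis using Cp by simp
    next
      case 2
      have "norm (osc_int \<zeta> h (\<lambda>_. 1) x) \<le> Cq / gamma0 * x powr gamma0"
        by (rule small) (use h x 2 in auto)
      also have "\<dots> \<le> C * h powr gamma0"
        using 2 gamma0 C1 Cp Cq by (intro mult_mono powr_mono2) auto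
      finally show ?thesis .
    next
      case 3
      \<comment> \<open>With p = S' and q = p r, the product \<open>c\<close> exp(2 i \<zeta> S / h)
        has derivative p exp(2 i \<zeta> S / h).\<close>
      define c where "c = complex_of_real h / (2 * \<i> * of_real \<zeta>)"
      have z: "\<zeta> \<noteq> 0" using zeta by auto
      have nc: "norm c = h / 2" using zeta h by (simp add: c_def norm_divide norm_mult)
      have hb: "h \<in> {0<..b}" using 3 h x by auto
      have xb: "x \<in> {0<..b}" using 3 h x by auto
      let ?e = "\<lambda>y. cis (2 * \<zeta> * (S y / h))"
      \<comment> \<open>Subtracting the boundary term leaves a function whose derivative involves
        \<open>dr\<close> only.\<close>
      define Y where "Y y = osc_int \<zeta> h (\<lambda>_. 1) y - c * (?e y * of_real (r y))" for y
      have Yd: "(Y has_vector_derivative - (c * (?e y * of_real (dr y)))) (at y within {0<..b})"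
        if y: "y \<in> {0<..b}" for y
      proof -
        have "(Y has_vector_derivative 1 * ?e y * of_real (q y) -
            c * (?e y * of_real (dr y) + of_real (2 * \<zeta> * (p y / h)) * \<i> * ?e y * of_real (r y))) (at y within {0<..b})"
          unfolding Y_def using h
          by (intro has_vector_derivative_diff has_vector_derivative_mult_right has_vector_derivative_mult
              osc_int_deriv[OF adm] phase_deriv has_vector_derivative_of_real dr(1) y) auto
        moreover have "c * (of_real (2 * \<zeta> * (p y / h)) * \<i> * ?e y * of_real (r y)) = ?e y * of_real (q y)"
          using z h by (simp add: c_def q_def field_simps)
        ultimately show ?thesis by (simp add: distrib_left)
      qed
      have Ybound: "norm (Y x - Y h) \<le> Cd / (1 - gamma0) * h powr gamma0 / 2"
      proof -
        let ?\<phi> = "\<lambda>y. - (h / 2 * Cd / (1 - gamma0)) * y powr (gamma0 - 1)"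
        have "norm (Y x - Y h) \<le> ?\<phi> x - ?\<phi> h"
        proof (rule differentiable_bound_general[where f' = "\<lambda>y. - (c * (?e y * of_real (dr y)))"
              and \<phi>' = "\<lambda>y. h / 2 * Cd * y powr (gamma0 - 2)"])
          show "continuous_on {h..x} Y"
          proof (rule continuous_on_subset)
            show "continuous_on {0<..b} Y"
              using Yd by (meson continuous_on_eq_continuous_within has_vector_derivative_continuous)
            show "{h..x} \<subseteq> {0<..b}" using h x by auto
          qed
          show "continuous_on {h..x} ?\<phi>" using h by (intro continuous_intros) auto
          fix y assume y: "h < y" "y < x"
          then have yb: "y \<in> {0<..b}" using h x by auto
          have "at y within {0<..b} = at y" using y h x by (intro at_within_interior) auto
          then show "(Y has_vector_derivative - (c * (?e y * of_real (dr y)))) (at y)"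
            using Yd[OF yb] by simp
          have "((\<lambda>y. y powr (gamma0 - 1)) has_real_derivative (gamma0 - 1) * y powr (gamma0 - 1 - 1)) (at y)"
            using yb by (intro has_real_derivative_powr) auto
          from DERIV_cmult[OF this, of "- (h / 2 * Cd / (1 - gamma0))"]
          have "(?\<phi> has_real_derivative
              - (h / 2 * Cd / (1 - gamma0)) * ((gamma0 - 1) * y powr (gamma0 - 1 - 1))) (at y)" .
          also have "- (h / 2 * Cd / (1 - gamma0)) * ((gamma0 - 1) * y powr (gamma0 - 1 - 1)) =
              (- (h / 2 * Cd / (1 - gamma0)) * (- (1 - gamma0))) * y powr (gamma0 - 2)"
            by (simp only: minus_diff_eq mult.assoc diff_diff_eq one_add_one)
          also have "- (h / 2 * Cd / (1 - gamma0)) * (- (1 - gamma0)) = h / 2 * Cd"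
          proof -
            have "- (a / d) * (- d) = a" if "d \<noteq> 0" for a d :: real using that by simp
            then show ?thesis using gamma0(3) by (metis diff_gt_0_iff_gt less_irrefl)
          qed
          finally show "(?\<phi> has_vector_derivative h / 2 * Cd * y powr (gamma0 - 2)) (at y)"
            unfolding has_real_derivative_iff_has_vector_derivative[symmetric] .
          have "y * \<bar>dr y\<bar> \<le> Cd * y powr (gamma0 - 1)" using Cd(2)[OF yb] yb by (simp add: abs_mult)
          also have "\<dots> = y * (Cd * y powr (gamma0 - 2))"
            using yb by (simp add: powr_diff power2_eq_square)
          finally have "\<bar>dr y\<bar> \<le> Cd * y powr (gamma0 - 2)" using yb by simp
          then show "norm (- (c * (?e y * of_real (dr y)))) \<le> h / 2 * Cd * y powr (gamma0 - 2)"
          proof -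
            have "h / 2 * \<bar>dr y\<bar> \<le> h / 2 * (Cd * y powr (gamma0 - 2))"
              using h \<open>\<bar>dr y\<bar> \<le> Cd * y powr (gamma0 - 2)\<close> by (intro mult_left_mono) auto
            then show ?thesis by (simp add: norm_mult nc mult.assoc)
          qed
        qed (use 3 in auto)
        also have "\<dots> \<le> (h / 2 * Cd / (1 - gamma0)) * h powr (gamma0 - 1)"
          using h Cd(1) gamma0(3) by simp
        also have "\<dots> = Cd / (1 - gamma0) * h powr gamma0 / 2"
          using h by (simp add: powr_diff)
        finally show ?thesis .
      qed
      have rb: "norm (c * (?e y * of_real (r y))) \<le> Cr * h powr gamma0 / 2" if y: "h \<le> y" "y \<le> x" for y
      proof -
        have yb: "y \<in> {0<..b}" using h x y by auto
        have "norm (c * (?e y * of_real (r y))) = h / 2 * \<bar>r y\<bar>" by (simp add: norm_mult nc)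
        also have "\<dots> \<le> h / 2 * (Cr * y powr (gamma0 - 1))"
          using Cr(2)[OF yb] h by (intro mult_left_mono) auto
        also have "\<dots> \<le> h / 2 * (Cr * h powr (gamma0 - 1))"
          using y h gamma0 Cr(1) by (intro mult_left_mono powr_mono2') auto
        also have "\<dots> = Cr * h powr gamma0 / 2" using h by (simp add: powr_diff)
        finally show ?thesis .
      qed
      have "osc_int \<zeta> h (\<lambda>_. 1) x = (Y x - Y h) + c * (?e x * of_real (r x)) - c * (?e h * of_real (r h))
          + osc_int \<zeta> h (\<lambda>_. 1) h"
        by (simp add: Y_def)
      moreover have "norm (y1 + y2 - y3 + y4) \<le> norm y1 + norm y2 + norm y3 + norm y4" for y1 y2 y3 y4 :: complex
        by (intro order_trans[OF norm_triangle_ineq] add_mono order_trans[OF norm_triangle_ineq4] order_refl)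
      ultimately have "norm (osc_int \<zeta> h (\<lambda>_. 1) x) \<le> norm (Y x - Y h) + norm (c * (?e x * of_real (r x))) +
          norm (c * (?e h * of_real (r h))) + norm (osc_int \<zeta> h (\<lambda>_. 1) h)"
        by (simp only:)
      also have "\<dots> \<le> Cd / (1 - gamma0) * h powr gamma0 / 2 + Cr * h powr gamma0 / 2 +
          Cr * h powr gamma0 / 2 + Cq / gamma0 * h powr gamma0"
        using 3 h by (intro add_mono Ybound rb small[OF _ hb]) auto
      also have "\<dots> \<le> C * h powr gamma0"
      proof -
        have "0 \<le> Cd / (1 - gamma0) * h powr gamma0" using Cd(1) gamma0(3) by simp
        moreover have "y1 / 2 + y2 / 2 + y2 / 2 + y3 \<le> y3 + y2 + y1" if "0 \<le> y1" for y1 y2 y3 :: real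
          using that by simp
        ultimately show ?thesis unfolding C_def distrib_right by blast
      qed
      finally show ?thesis .
    qed
  qed
  moreover have "C > 0" using Cr Cd Cq gamma0 by (simp add: C_def add_pos_pos)
  ultimately show ?thesis by blast
qed

text \<open>Integration by parts against \<open>osc_int \<zeta> h 1 = O(h powr gamma0)\<close> turns the second
  iterate into a contraction for small \<open>h\<close>.\<close>

lemma osc_int_twice_bound:
  assumes zeta: "\<bar>\<zeta>\<bar> = 1"
  shows "\<exists>C>0. \<forall>h\<in>{0<..1}. \<forall>B f. admissible B f \<longrightarrow>
    admissible (C * h powr gamma0 * B) (osc_int \<zeta> h (osc_int (-\<zeta>) h f))"
proof -
  obtain C where C: "C > 0" "\<And>h x. h \<in> {0<..1} \<Longrightarrow> x \<in> {0..b} \<Longrightarrow>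
      norm (osc_int \<zeta> h (\<lambda>_. 1) x) \<le> C * h powr gamma0"
    using osc_int_one_bound[OF zeta] by blast
  have adm: "admissible 1 (\<lambda>_. 1)" using admissible_const[of 1] by simp
  have "admissible ((2 * C * Q) * h powr gamma0 * B) (osc_int \<zeta> h (osc_int (-\<zeta>) h f))"
    if h1: "h \<in> {0<..1}" and f: "admissible B f" for h B f
  proof -
    have h: "h > 0" using h1 by simp
    let ?w = "osc_int (-\<zeta>) h f" and ?X = "osc_int \<zeta> h (\<lambda>_. 1)"
    note w = admissible_osc_int[OF f h, of "-\<zeta>"]
    have B: "B \<ge> 0" by (rule admissible_pos[OF f])
    \<comment> \<open>By the product rule the derivative of \<open>F\<close> contains the small
      factor \<open>?X\<close> and no longer \<open>?w\<close>; the bounds for \<open>F\<close> and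
      for \<open>?X * ?w\<close> together give the factor 2.\<close>
    define F where "F x = osc_int \<zeta> h ?w x - ?X x * ?w x" for x
    have "norm (osc_int \<zeta> h ?w x) \<le> (2 * C * Q) * h powr gamma0 * B" if x: "x \<in> {0..b}" for x
    proof (cases "x = 0")
      case True
      then show ?thesis using C Q_pos B by simp
    next
      case False
      then have x: "x \<in> {0<..b}" "x \<in> {0..b}" using x by auto
      have "norm (F x) \<le> (C * h powr gamma0 * B) * Q"
      proof (rule primitive_bound[OF _ _ _ x(1)])
        show "(F \<longlongrightarrow> 0) (at_right 0)"
          unfolding F_def
          using tendsto_diff[OF osc_int_lim[OF w h, of \<zeta>]
              tendsto_mult[OF osc_int_lim[OF adm h, of \<zeta>] osc_int_lim[OF f h, of "-\<zeta>"]]] by simp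
        show "0 \<le> C * h powr gamma0 * B" using C B by simp
        fix y assume y: "y \<in> {0<..b}"
        let ?e = "cis (2 * \<zeta> * (S y / h))" and ?e' = "cis (2 * (-\<zeta>) * (S y / h))"
        have "(F has_vector_derivative (?w y * ?e * of_real (q y) -
            (?X y * (f y * ?e' * of_real (q y)) + (1 * ?e * of_real (q y)) * ?w y))) (at y within {0<..b})"
          unfolding F_def
          by (intro has_vector_derivative_diff has_vector_derivative_mult osc_int_deriv[OF w h y]
              osc_int_deriv[OF adm h y] osc_int_deriv[OF f h y])
        moreover have "?w y * ?e * of_real (q y) -
            (?X y * (f y * ?e' * of_real (q y)) + (1 * ?e * of_real (q y)) * ?w y) =
            - (?X y * (f y * ?e' * of_real (q y)))"
          by (simp add: mult_ac)
        ultimately have "(F has_vector_derivative - (?X y * (f y * ?e' * of_real (q y)))) (at y within {0<..b})"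
          by simp
        moreover have "norm (- (?X y * (f y * ?e' * of_real (q y)))) \<le> C * h powr gamma0 * B * q_const * y powr (\<gamma> - 1)"
        proof -
          have "norm (?X y) * norm (f y * ?e' * of_real (q y)) \<le>
              (C * h powr gamma0) * (B * q_const * y powr (\<gamma> - 1))"
            using C y h1 by (intro mult_mono osc_integrand_bound[OF f]) auto
          then show ?thesis by (simp only: norm_minus_cancel norm_mult mult.assoc)
        qed
        ultimately show "\<exists>d. (F has_vector_derivative d) (at y within {0<..b}) \<and>
            norm d \<le> C * h powr gamma0 * B * q_const * y powr (\<gamma> - 1)" by blast
      qed
      moreover have "norm (?X x * ?w x) \<le> (C * h powr gamma0) * (B * Q)"
        unfolding norm_mult using C x h1 h by (intro mult_mono osc_int_bound[OF f]) auto
      moreover have "norm (osc_int \<zeta> h ?w x) \<le> norm (F x) + norm (?X x * ?w x)"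
        using norm_triangle_ineq[of "F x" "?X x * ?w x"] by (simp add: F_def)
      ultimately show ?thesis by (simp add: algebra_simps)
    qed
    then show ?thesis
      unfolding admissible_def using osc_int_cont[OF w h] by blast
  qed
  then show ?thesis using C(1) Q_pos by (intro exI[of _ "2 * C * Q"]) auto
qed

text \<open>The even Picard iterates of the system for (u, v) with initial value (1, 0) contribute
  to u; the odd ones, \<open>osc_int (-1) h (dyson j h)\<close>, form the v component.\<close>

primrec dyson :: "nat \<Rightarrow> real \<Rightarrow> real \<Rightarrow> complex" where
  "dyson 0 h = (\<lambda>x. 1)"
| "dyson (Suc j) h = osc_int 1 h (osc_int (-1) h (dyson j h))"

lemma dyson_bounds:
  obtains C where "C > 0" "\<And>h B f. h \<in> {0<..1} \<Longrightarrow> admissible B f \<Longrightarrow>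
      admissible (C * h powr gamma0 * B) (osc_int 1 h (osc_int (-1) h f))"
    "\<And>h j. h \<in> {0<..1} \<Longrightarrow> admissible ((C * h powr gamma0) ^ j) (dyson j h)"
proof -
  obtain C where C: "C > 0" "\<And>h B f. h \<in> {0<..1} \<Longrightarrow> admissible B f \<Longrightarrow>
      admissible (C * h powr gamma0 * B) (osc_int 1 h (osc_int (-1) h f))"
    using osc_int_twice_bound[of 1] by auto
  have "admissible ((C * h powr gamma0) ^ j) (dyson j h)" if h: "h \<in> {0<..1}" for h j
  proof (induction j)
    case 0
    show ?case using admissible_const[of 1] by simp
  next
    case (Suc j)
    show ?case using C(2)[OF h Suc] by simp
  qed
  then show thesis using that[of C] C by blast
qed

text \<open>The constant 1 expands for either sign and consecutive kernels have opposite signs, so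
  \<open>expands_integral\<close> applies at every step.\<close>

lemma dyson_expands:
  shows "expands 1 (\<lambda>(h, x). dyson j h x)"
    and "expands (-1) (\<lambda>(h, x). osc_int (-1) h (dyson j h) x)"
proof -
  obtain C where C: "\<And>h j. h \<in> {0<..1} \<Longrightarrow> admissible ((C * h powr gamma0) ^ j) (dyson j h)"
    using dyson_bounds by metis
  have step: "expands \<zeta> (\<lambda>(h, x). osc_int \<zeta> h (f h) x)"
    if ex: "expands (-\<zeta>) (\<lambda>(h, x). f h x)" and z: "\<zeta> \<noteq> 0"
      and adm: "\<And>h. h \<in> {0<..1} \<Longrightarrow> admissible (B h) (f h)" for \<zeta> f B
  proof (rule expands_integral[OF z ex])
    show "((\<lambda>x. case (h, x) of (h, x) \<Rightarrow> osc_int \<zeta> h (f h) x) \<longlongrightarrow> 0) (at_right 0)"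
      if "h \<in> {0<..1}" for h
      using osc_int_lim[OF adm[OF that]] that by simp
    show "((\<lambda>x. case (h, x) of (h, x) \<Rightarrow> osc_int \<zeta> h (f h) x) has_vector_derivative
        (case (h, x) of (h, x) \<Rightarrow> f h x) * cis (2 * \<zeta> * (S x / h)) * of_real (p x * r x)) (at x within {0<..b})"
      if "h \<in> {0<..1}" "x \<in> {0<..b}" for h x
    proof -
      have "h > 0" using that by simp
      from osc_int_deriv[OF adm[OF that(1)] this that(2), where \<zeta> = \<zeta>]
      show ?thesis by (simp add: q_def)
    qed
  qed
  have step1: "expands (-1) (\<lambda>(h, x). osc_int (-1) h (dyson j h) x)"
    if "expands 1 (\<lambda>(h, x). dyson j h x)" for j
    by (rule step[where B = "\<lambda>h. (C * h powr gamma0) ^ j"]) (use that C in auto)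
  show *: "expands 1 (\<lambda>(h, x). dyson j h x)"
  proof (induction j)
    case 0
    show ?case using expands_one by (simp add: case_prod_unfold)
  next
    case (Suc j)
    have "expands 1 (\<lambda>(h, x). osc_int 1 h (osc_int (-1) h (dyson j h)) x)"
      by (rule step[where B = "\<lambda>h. (C * h powr gamma0) ^ j * Q"])
         (use step1[OF Suc] C admissible_osc_int in auto)
    then show ?case by simp
  qed
  show "expands (-1) (\<lambda>(h, x). osc_int (-1) h (dyson j h) x)" by (rule step1[OF *])
qed

section \<open>Summation of the Dyson series\<close>

definition sol :: "real \<Rightarrow> real \<Rightarrow> complex" where "sol h x = (\<Sum>j. dyson j h x)"

lemma osc_int_dyson_sum:
  assumes h: "h \<in> {0<..1}" and x: "x \<in> {0..b}"
  shows "osc_int \<zeta> h (\<lambda>x. \<Sum>j<J. dyson j h x) x = (\<Sum>j<J. osc_int \<zeta> h (dyson j h) x) \<and>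
    (\<exists>B. admissible B (\<lambda>x. \<Sum>j<J. dyson j h x))"
proof (induction J)
  case 0
  show ?case using admissible_const[of 0] by (auto simp: osc_int_def)
next
  case (Suc J)
  obtain C where C: "\<And>h j. h \<in> {0<..1} \<Longrightarrow> admissible ((C * h powr gamma0) ^ j) (dyson j h)"
    using dyson_bounds by metis
  obtain B where B: "admissible B (\<lambda>x. \<Sum>j<J. dyson j h x)" using Suc by blast
  note 0 = admissible_const[of 0] and d = C[OF h, of J]
  have h0: "h > 0" using h by simp
  note m = admissible_diff[OF 0 d]
  have "osc_int \<zeta> h (\<lambda>x. (\<Sum>j<J. dyson j h x) - (0 - dyson J h x)) x =
      (\<Sum>j<J. osc_int \<zeta> h (dyson j h) x) - (osc_int \<zeta> h (\<lambda>_. 0) x - osc_int \<zeta> h (dyson J h) x)"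
    using osc_int_diff[OF B m h0 x] osc_int_diff[OF 0 d h0 x] Suc by simp
  moreover have "osc_int \<zeta> h (\<lambda>_. 0) x = 0" by (simp add: osc_int_def)
  ultimately show ?case using admissible_diff[OF B m] by auto
qed

lemma sol_props:
  "\<exists>C>0. \<forall>h\<in>{0<..1}. C * h powr gamma0 \<le> 1 / 2 \<longrightarrow>
    (\<forall>J. admissible (2 * (C * h powr gamma0) ^ J) (\<lambda>x. sol h x - (\<Sum>j<J. dyson j h x))) \<and>
    admissible 2 (sol h) \<and>
    (\<forall>x\<in>{0..b}. sol h x = 1 + osc_int 1 h (osc_int (-1) h (sol h)) x)"
proof -
  obtain C where C: "C > 0" "\<And>h B f. h \<in> {0<..1} \<Longrightarrow> admissible B f \<Longrightarrow>
      admissible (C * h powr gamma0 * B) (osc_int 1 h (osc_int (-1) h f))"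
    "\<And>h j. h \<in> {0<..1} \<Longrightarrow> admissible ((C * h powr gamma0) ^ j) (dyson j h)"
    using dyson_bounds by blast
  have tail: "admissible (2 * (C * h powr gamma0) ^ J) (\<lambda>x. sol h x - (\<Sum>j<J. dyson j h x))"
    and sums: "x \<in> {0..b} \<Longrightarrow> (\<lambda>j. dyson j h x) sums sol h x"
    if h: "h \<in> {0<..1}" and \<kappa>: "C * h powr gamma0 \<le> 1 / 2" for h J x
  proof -
    define \<kappa> where "\<kappa> = C * h powr gamma0"
    have k: "0 \<le> \<kappa>" "\<kappa> \<le> 1 / 2" using C(1) \<open>C * h powr gamma0 \<le> 1 / 2\<close> by (auto simp: \<kappa>_def)
    have bd: "norm (dyson j h x) \<le> \<kappa> ^ j" if "x \<in> {0..b}" for j x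
      using C(3)[OF h, of j] that by (auto simp: admissible_def \<kappa>_def)
    have sk: "summable (\<lambda>j. \<kappa> ^ j)" using k by (intro summable_geometric) auto
    have sm: "summable (\<lambda>j. dyson j h x)" if "x \<in> {0..b}" for x
      by (rule summable_comparison_test'[OF sk bd[OF that]])
    show "x \<in> {0..b} \<Longrightarrow> (\<lambda>j. dyson j h x) sums sol h x"
      unfolding sol_def by (rule summable_sums[OF sm])
    have "uniform_limit {0..b} (\<lambda>n x. \<Sum>j<n. dyson j h x) (\<lambda>x. \<Sum>j. dyson j h x) sequentially"
      by (rule Weierstrass_m_test[OF _ sk]) (use bd in auto)
    moreover have "continuous_on {0..b} (\<lambda>x. \<Sum>j<n. dyson j h x)" for n
      using C(3)[OF h] by (intro continuous_on_sum) (auto simp: admissible_def)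
    ultimately have "continuous_on {0..b} (sol h)"
      unfolding sol_def by (intro uniform_limit_theorem[where F = sequentially]) auto
    then have "continuous_on {0..b} (\<lambda>x. sol h x - (\<Sum>j<J. dyson j h x))"
      using C(3)[OF h] by (intro continuous_intros) (auto simp: admissible_def)
    moreover have "norm (sol h x - (\<Sum>j<J. dyson j h x)) \<le> 2 * \<kappa> ^ J" if x: "x \<in> {0..b}" for x
    proof -
      have "sol h x - (\<Sum>j<J. dyson j h x) = (\<Sum>j. dyson (j + J) h x)"
        unfolding sol_def using suminf_minus_initial_segment[OF sm[OF x], of J] by simp
      also have "norm \<dots> \<le> (\<Sum>j. \<kappa> ^ (j + J))"
        using bd[OF x] sk by (intro norm_suminf_le[OF _ summable_ignore_initial_segment])
      also have "\<dots> = (\<Sum>j. \<kappa> ^ j) * \<kappa> ^ J"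
        using sk by (simp add: power_add suminf_mult2)
      also have "\<dots> \<le> 2 * \<kappa> ^ J"
      proof (intro mult_right_mono)
        have "(\<Sum>j. \<kappa> ^ j) = 1 / (1 - \<kappa>)" using k by (intro suminf_geometric) auto
        also have "\<dots> \<le> 2" using k by (simp add: pos_divide_le_eq)
        finally show "(\<Sum>j. \<kappa> ^ j) \<le> 2" .
      qed (use k in auto)
      finally show ?thesis .
    qed
    ultimately show "admissible (2 * (C * h powr gamma0) ^ J) (\<lambda>x. sol h x - (\<Sum>j<J. dyson j h x))"
      unfolding admissible_def \<kappa>_def by blast
  qed
  have adm: "admissible 2 (sol h)" if h: "h \<in> {0<..1}" and \<kappa>: "C * h powr gamma0 \<le> 1 / 2" for h
    using tail[OF that, of 0] by simp
  have eq: "sol h x = 1 + osc_int 1 h (osc_int (-1) h (sol h)) x"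
    if h: "h \<in> {0<..1}" and \<kappa>: "C * h powr gamma0 \<le> 1 / 2" and x: "x \<in> {0..b}" for h x
  proof -
    have h0: "h > 0" using h by simp
    let ?T = "\<lambda>f. osc_int 1 h (osc_int (-1) h f)"
    let ?s = "\<lambda>J x. \<Sum>j<J. dyson j h x"
    \<comment> \<open>The double integral shifts the Dyson index by one. Applied to the partial sums
      and controlled on the tail, it produces the integral equation in the limit.\<close>
    have bd: "norm (?T (sol h) x - (\<Sum>j<J. dyson (Suc j) h x)) \<le> (1 / 2) ^ J" for J
    proof -
      obtain B where B: "admissible B (?s J)" using osc_int_dyson_sum[OF h x] by blast
      have eq1: "osc_int (-1) h (?s J) y = (\<Sum>j<J. osc_int (-1) h (dyson j h) y)" if "y \<in> {0..b}" for y
        using osc_int_dyson_sum[OF h that] by blast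
      have Ts: "?T (?s J) x = (\<Sum>j<J. ?T (dyson j h) x)"
      proof -
        have sumT: "osc_int 1 h (\<lambda>y. \<Sum>j<J. osc_int (-1) h (dyson j h) y) x = (\<Sum>j<J. ?T (dyson j h) x)"
        proof -
          have "(\<lambda>y. osc_int (-1) h (dyson j h) y * cis (2 * 1 * (S y / h)) * of_real (q y)) integrable_on {0..x}" for j
            by (rule integrable_subinterval_real[OF osc_int_integrable[OF admissible_osc_int[OF C(3)[OF h] h0] h0]])
               (use x in simp)
          then show ?thesis
            unfolding osc_int_def[of 1] by (simp add: sum_distrib_right integral_sum)
        qed
        have "?T (?s J) x = osc_int 1 h (\<lambda>y. \<Sum>j<J. osc_int (-1) h (dyson j h) y) x"
          unfolding osc_int_def[of 1] using x by (intro integral_cong) (simp add: eq1)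
        then show ?thesis using sumT by simp
      qed
      let ?d = "\<lambda>x. sol h x - ?s J x"
      note ad = tail[OF h \<kappa>, of J]
      have "?T ?d x = ?T (sol h) x - ?T (?s J) x"
      proof -
        have "?T ?d x = osc_int 1 h (\<lambda>y. osc_int (-1) h (sol h) y - osc_int (-1) h (?s J) y) x"
          unfolding osc_int_def[of 1]
          by (intro integral_cong) (use x osc_int_diff[OF adm[OF h \<kappa>] B h0] in auto)
        also have "\<dots> = ?T (sol h) x - ?T (?s J) x"
          by (rule osc_int_diff[OF admissible_osc_int[OF adm[OF h \<kappa>] h0] admissible_osc_int[OF B h0] h0 x])
        finally show ?thesis .
      qed
      moreover have "norm (?T ?d x) \<le> C * h powr gamma0 * (2 * (C * h powr gamma0) ^ J)"
        using C(2)[OF h ad] x by (auto simp: admissible_def)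
      moreover have "C * h powr gamma0 * (2 * (C * h powr gamma0) ^ J) \<le> (1 / 2) * (2 * (1 / 2) ^ J)"
        using \<kappa> C(1) by (intro mult_mono power_mono) auto
      ultimately show ?thesis using Ts by simp
    qed
    have "(\<lambda>J. ?T (sol h) x - (\<Sum>j<J. dyson (Suc j) h x)) \<longlonglongrightarrow> 0"
      by (rule Lim_null_comparison[OF always_eventually[OF allI[OF bd]]]) (simp add: LIMSEQ_realpow_zero)
    from tendsto_diff[OF tendsto_const[of "?T (sol h) x"] this]
    have "(\<lambda>j. dyson (Suc j) h x) sums ?T (sol h) x"
      by (simp add: sums_def)
    moreover have "(\<lambda>j. dyson (Suc j) h x) sums (sol h x - 1)"
      using sums[OF h \<kappa> x] sums_Suc_iff[of "\<lambda>j. dyson j h x" "sol h x - 1"]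
      by (simp del: dyson.simps(2))
    ultimately have "?T (sol h) x = sol h x - 1" by (rule sums_unique2)
    then show ?thesis by simp
  qed
  show ?thesis using C(1) tail adm eq by blast
qed

end

context irrational_potential
begin

section \<open>Asymptotics of the Dyson solution at b\<close>

lemma splits_sum:
  "(\<And>j. j < J \<Longrightarrow> splits \<zeta> M (f j)) \<Longrightarrow> splits \<zeta> M (\<lambda>h. \<Sum>j<(J::nat). f j h)"
proof (induction J)
  case 0
  show ?case by (rule splitsI[OF sums_of_zero sums_of_zero, where C = 0]) simp
next
  case (Suc J)
  have "splits \<zeta> M (\<lambda>h. (\<Sum>j<J. f j h) + f J h)"
    by (intro splits_add Suc) (auto intro: Suc.prems)
  then show ?case by simp
qed

definition ev_splits :: "real \<Rightarrow> (real \<Rightarrow> complex) \<Rightarrow> bool" where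
  "ev_splits \<zeta> f \<longleftrightarrow> (\<forall>M. \<exists>A\<in>sums_of h_powers. \<exists>B\<in>sums_of h_powers. \<exists>C. \<forall>\<^sub>F h in at_right 0.
     norm (f h - (A h + cis (2 * \<zeta> * (S b / h)) * B h)) \<le> C * h ^ M)"

lemma ev_splitsI:
  assumes "\<And>M. \<exists>g C. splits \<zeta> M g \<and> (\<forall>\<^sub>F h in at_right 0. norm (f h - g h) \<le> C * h ^ M)"
  shows "ev_splits \<zeta> f"
  unfolding ev_splits_def
proof
  fix M
  obtain g C where g: "splits \<zeta> M g" "\<forall>\<^sub>F h in at_right 0. norm (f h - g h) \<le> C * h ^ M"
    using assms[of M] by (elim exE conjE) (rule that)
  obtain A B C' where A: "A \<in> sums_of h_powers" "B \<in> sums_of h_powers"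
    "\<forall>h\<in>{0<..1}. norm (g h - (A h + cis (2 * \<zeta> * (S b / h)) * B h)) \<le> C' * h ^ M"
    using g(1) unfolding splits_def by (elim bexE exE)
  have "\<forall>\<^sub>F h in at_right 0. norm (f h - (A h + cis (2 * \<zeta> * (S b / h)) * B h)) \<le> (C + C') * h ^ M"
    using g(2) eventually_unit
  proof eventually_elim
    case (elim h)
    have "norm (f h - (A h + cis (2 * \<zeta> * (S b / h)) * B h)) \<le>
        norm (f h - g h) + norm (g h - (A h + cis (2 * \<zeta> * (S b / h)) * B h))"
    proof -
      have "norm (x - z) \<le> norm (x - y) + norm (y - z)" for x y z :: complex
        using norm_triangle_ineq[of "x - y" "y - z"] by simp
      then show ?thesis .
    qed
    then show ?case using elim(1) A(3)[rule_format, OF elim(2)] by (simp add: distrib_right)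
  qed
  then show "\<exists>A\<in>sums_of h_powers. \<exists>B\<in>sums_of h_powers. \<exists>C. \<forall>\<^sub>F h in at_right 0.
     norm (f h - (A h + cis (2 * \<zeta> * (S b / h)) * B h)) \<le> C * h ^ M"
    using A(1,2) by (intro bexI exI)
qed

definition sol' :: "real \<Rightarrow> real \<Rightarrow> complex" where "sol' h = osc_int (-1) h (sol h)"

text \<open>The first J terms leave an error O(h^(J gamma0)), so J gamma0 >= M suffices, and
  finitely many splittings add up. The limits serve to identify the constant terms of the
  expansions.\<close>

lemma sol_asymptotics:
  shows "ev_splits 1 (\<lambda>h. sol h b)" and "ev_splits (-1) (\<lambda>h. sol' h b)"
    and "((\<lambda>h. sol h b) \<longlongrightarrow> 1) (at_right 0)" and "((\<lambda>h. sol' h b) \<longlongrightarrow> 0) (at_right 0)"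
    and "\<forall>\<^sub>F h in at_right 0. h \<in> {0<..1} \<and> admissible 2 (sol h) \<and>
      (\<forall>x\<in>{0..b}. sol h x = 1 + osc_int 1 h (sol' h) x)"
proof -
  obtain C where C1: "C > 0" and C': "\<forall>h\<in>{0<..1}. C * h powr gamma0 \<le> 1 / 2 \<longrightarrow>
    (\<forall>J. admissible (2 * (C * h powr gamma0) ^ J) (\<lambda>x. sol h x - (\<Sum>j<J. dyson j h x))) \<and>
    admissible 2 (sol h) \<and>
    (\<forall>x\<in>{0..b}. sol h x = 1 + osc_int 1 h (osc_int (-1) h (sol h)) x)"
    using sol_props by (elim exE conjE) (rule that)
  have C2: "admissible (2 * (C * h powr gamma0) ^ J) (\<lambda>x. sol h x - (\<Sum>j<J. dyson j h x))"
    and C3: "admissible 2 (sol h)"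
    and C4: "x \<in> {0..b} \<Longrightarrow> sol h x = 1 + osc_int 1 h (osc_int (-1) h (sol h)) x"
    if "h \<in> {0<..1}" "C * h powr gamma0 \<le> 1 / 2" for h J x
    using C'[rule_format, OF that] by blast+
  note C = C1 C2 C3 C4
  have half: "\<forall>\<^sub>F h in at_right 0. C * h powr gamma0 < 1 / 2"
    by (rule order_tendstoD(2)[OF powr_tendsto_0[OF gamma0(1)]]) simp
  have ev: "\<forall>\<^sub>F h in at_right 0. h \<in> {0<..1} \<and> C * h powr gamma0 \<le> 1 / 2"
    using eventually_unit half by eventually_elim auto
  show "\<forall>\<^sub>F h in at_right 0. h \<in> {0<..1} \<and> admissible 2 (sol h) \<and>
      (\<forall>x\<in>{0..b}. sol h x = 1 + osc_int 1 h (sol' h) x)"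
    using ev by eventually_elim (use C(3,4) in \<open>auto simp: sol'_def\<close>)
  have small: "(C * h powr gamma0) ^ J \<le> C ^ J * h ^ M"
    if "h \<in> {0<..1}" "real M \<le> real J * gamma0" for h J M
  proof -
    have "(C * h powr gamma0) ^ J = C ^ J * h powr (real J * gamma0)"
      using that by (simp add: power_mult_distrib powr_powr mult.commute flip: powr_realpow)
    also have "\<dots> \<le> C ^ J * h powr (real M)"
      using that C(1) by (intro mult_left_mono powr_mono') auto
    finally show ?thesis using that by (simp add: powr_realpow)
  qed
  have exJ: "\<exists>J. real M \<le> real J * gamma0" for M
    using gamma0(1) by (meson ex_less_of_nat_mult less_imp_le)
  have sol'_bound: "norm (sol' h b - (\<Sum>j<J. osc_int (-1) h (dyson j h) b)) \<le> 2 * (C * h powr gamma0) ^ J * Q"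
    if h: "h \<in> {0<..1}" "C * h powr gamma0 \<le> 1 / 2" for h J
  proof -
    have h0: "h > 0" and bb: "b \<in> {0..b}" using h b by auto
    obtain B where B: "admissible B (\<lambda>x. \<Sum>j<J. dyson j h x)"
      "osc_int (-1) h (\<lambda>x. \<Sum>j<J. dyson j h x) b = (\<Sum>j<J. osc_int (-1) h (dyson j h) b)"
      using osc_int_dyson_sum[OF h(1) bb, of "-1" J] by blast
    have "sol' h b - (\<Sum>j<J. osc_int (-1) h (dyson j h) b) = osc_int (-1) h (\<lambda>x. sol h x - (\<Sum>j<J. dyson j h x)) b"
      using osc_int_diff[OF C(3)[OF h] B(1) h0 bb, of "-1"] B(2) by (simp add: sol'_def)
    then show ?thesis using osc_int_bound[OF C(2)[OF h, of J] h0 bb, of "-1"] by simp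
  qed
  show "ev_splits 1 (\<lambda>h. sol h b)"
  proof (rule ev_splitsI)
    fix M
    obtain J where J: "real M \<le> real J * gamma0" using exJ by blast
    have "splits 1 M (\<lambda>h. \<Sum>j<J. dyson j h b)"
      by (rule splits_sum) (use expands_split[OF dyson_expands(1), of M] in simp)
    moreover have "\<forall>\<^sub>F h in at_right 0. norm (sol h b - (\<Sum>j<J. dyson j h b)) \<le> (2 * C ^ J) * h ^ M"
      using ev
    proof eventually_elim
      case (elim h)
      have "norm (sol h b - (\<Sum>j<J. dyson j h b)) \<le> 2 * (C * h powr gamma0) ^ J"
        using C(2)[of h J] elim b by (auto simp: admissible_def)
      also have "\<dots> \<le> 2 * (C ^ J * h ^ M)" using small[OF _ J] elim by (intro mult_left_mono) auto
      finally show ?case by simp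
    qed
    ultimately show "\<exists>g C. splits 1 M g \<and> (\<forall>\<^sub>F h in at_right 0. norm (sol h b - g h) \<le> C * h ^ M)"
      by blast
  qed
  show "ev_splits (-1) (\<lambda>h. sol' h b)"
  proof (rule ev_splitsI)
    fix M
    obtain J where J: "real M \<le> real J * gamma0" using exJ by blast
    have "splits (-1) M (\<lambda>h. \<Sum>j<J. osc_int (-1) h (dyson j h) b)"
      by (rule splits_sum) (use expands_split[OF dyson_expands(2), of M] in simp)
    moreover have "\<forall>\<^sub>F h in at_right 0. norm (sol' h b - (\<Sum>j<J. osc_int (-1) h (dyson j h) b)) \<le> (2 * C ^ J * Q) * h ^ M"
      using ev
    proof eventually_elim
      case (elim h)
      have "norm (sol' h b - (\<Sum>j<J. osc_int (-1) h (dyson j h) b)) \<le> 2 * (C * h powr gamma0) ^ J * Q"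
        using sol'_bound elim by blast
      also have "\<dots> \<le> 2 * (C ^ J * h ^ M) * Q"
        using small[OF _ J] elim Q_pos by (intro mult_left_mono mult_right_mono) auto
      finally show ?case by (simp add: mult_ac)
    qed
    ultimately show "\<exists>g C. splits (-1) M g \<and> (\<forall>\<^sub>F h in at_right 0. norm (sol' h b - g h) \<le> C * h ^ M)"
      by blast
  qed
  have "((\<lambda>h. sol h b - 1) \<longlongrightarrow> 0) (at_right 0)"
  proof (rule Lim_null_comparison)
    show "\<forall>\<^sub>F h in at_right 0. norm (sol h b - 1) \<le> (2 * C) * h powr gamma0"
      using ev
    proof eventually_elim
      case (elim h)
      have "norm (sol h b - (\<Sum>j<1. dyson j h b)) \<le> 2 * (C * h powr gamma0) ^ 1"
        using C(2)[of h 1] elim b by (simp add: admissible_def)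
      then show ?case by simp
    qed
  qed (rule powr_tendsto_0[OF gamma0(1)])
  then show "((\<lambda>h. sol h b) \<longlongrightarrow> 1) (at_right 0)" by (simp add: LIM_zero_iff)
  obtain D where D: "D > 0" "\<And>h x. h \<in> {0<..1} \<Longrightarrow> x \<in> {0..b} \<Longrightarrow>
      norm (osc_int (-1) h (\<lambda>_. 1) x) \<le> D * h powr gamma0"
    using osc_int_one_bound[of "-1"] by auto
  show "((\<lambda>h. sol' h b) \<longlongrightarrow> 0) (at_right 0)"
  proof (rule Lim_null_comparison)
    show "\<forall>\<^sub>F h in at_right 0. norm (sol' h b) \<le> (2 * C * Q + D) * h powr gamma0"
      using ev
    proof eventually_elim
      case (elim h)
      have "norm (sol' h b - (\<Sum>j<1. osc_int (-1) h (dyson j h) b)) \<le> 2 * (C * h powr gamma0) ^ 1 * Q"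
        using sol'_bound elim by blast
      then have "norm (sol' h b - osc_int (-1) h (\<lambda>_. 1) b) \<le> 2 * C * h powr gamma0 * Q" by simp
      moreover have "norm (osc_int (-1) h (\<lambda>_. 1) b) \<le> D * h powr gamma0" using D(2) elim b by auto
      moreover have "norm (sol' h b) \<le> norm (sol' h b - osc_int (-1) h (\<lambda>_. 1) b) + norm (osc_int (-1) h (\<lambda>_. 1) b)"
        using norm_triangle_ineq[of "sol' h b - osc_int (-1) h (\<lambda>_. 1) b" "osc_int (-1) h (\<lambda>_. 1) b"] by simp
      ultimately show ?case by (simp add: algebra_simps)
    qed
  qed (rule powr_tendsto_0[OF gamma0(1)])
qed

section \<open>From the Schroedinger equation to the first-order system\<close>

lemma constant_from_zero:
  fixes F :: "real \<Rightarrow> complex"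
  assumes "continuous_on {0..b} F"
    and "\<And>x. x \<in> {0<..b} \<Longrightarrow> (F has_vector_derivative 0) (at x within {0<..b})"
  shows "F b = F 0"
proof -
  \<comment> \<open>The coefficient q may be singular at 0, so no derivative is available there;
    continuity links the value at 0 to the half-open interval.\<close>
  have "(F \<longlongrightarrow> F 0) (at 0 within {0..b})" using assms(1) b by (auto simp: continuous_on_def)
  then have "(F \<longlongrightarrow> F 0) (at_right 0)" using b by (simp add: at_within_Icc_at_right)
  then have lim: "((\<lambda>x. F x - F 0) \<longlongrightarrow> 0) (at_right 0)" by (simp add: LIM_zero_iff)
  have "norm (F b - F 0) \<le> 0 / (0 + 1) * b powr (0 + 1)"
  proof (rule bound_from_zero[OF lim])
    fix y assume "y \<in> {0<..b}"
    from has_vector_derivative_diff[OF assms(2)[OF this] has_vector_derivative_const[of "F 0"]]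
    show "\<exists>d. ((\<lambda>x. F x - F 0) has_vector_derivative d) (at y within {0<..b}) \<and> norm d \<le> 0 * y powr 0"
      by (intro exI[of _ 0]) simp
  qed (use b in auto)
  then show ?thesis by simp
qed

text \<open>For \<zeta> = 1 and -1 these are the two waves of the overview. Powers of E - V replace
  those of p so that real and imaginary contributions are literally the entries of
  \<open>scaled_data\<close>.\<close>

definition wave :: "real \<Rightarrow> real \<Rightarrow> (real \<Rightarrow> complex) \<Rightarrow> (real \<Rightarrow> complex) \<Rightarrow> real \<Rightarrow> complex" where
  "wave \<zeta> h \<phi> d\<phi> x = of_real ((E - V x) powr (1/4)) * \<phi> x +
     \<i> * of_real \<zeta> * (of_real ((E - V x) powr (- 1/4) * h) * d\<phi> x)"

text \<open>The weights p^(1/2) and p^(-1/2) have logarithmic derivatives q and -q. This opposite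
  sign exchanges the two waves and produces the coupling, while the equation itself gives the
  diagonal term, a pure phase rate.\<close>

lemma wave_deriv:
  assumes sch: "schrodinger_solution V b E h \<phi> d\<phi>" and h: "h > 0" and zeta: "\<zeta> = 1 \<or> \<zeta> = -1"
    and x: "x \<in> {0<..b}"
  shows "(wave \<zeta> h \<phi> d\<phi> has_vector_derivative
    - (\<i> * of_real \<zeta> * of_real (p x / h)) * wave \<zeta> h \<phi> d\<phi> x + of_real (q x) * wave (-\<zeta>) h \<phi> d\<phi> x)
    (at x within {0<..b})"
proof -
  obtain dd where dd: "\<And>x. x \<in> {0..b} \<Longrightarrow> (\<phi> has_vector_derivative d\<phi> x) (at x within {0..b})"
    "\<And>x. x \<in> {0..b} \<Longrightarrow> (d\<phi> has_vector_derivative dd x) (at x within {0..b})"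
    "\<And>x. x \<in> {0..b} \<Longrightarrow> - (of_real (h^2) * dd x) + of_real (V x) * \<phi> x = of_real E * \<phi> x"
    using sch unfolding schrodinger_solution_def by blast
  have xb: "x \<in> {0..b}" using x by auto
  have sub: "{0<..b} \<subseteq> {0..b}" by auto
  have EV: "E - V x > 0" by (rule E_V_pos[OF xb])
  have px: "p x > 0" by (rule p_pos[OF xb])
  have P: "(E - V y) powr a = p y powr (2 * a)" if "y \<in> {0<..b}" for y a
    using p_powr[of y "2 * a"] that by simp
  have pd: "((\<lambda>y. p y powr a) has_real_derivative 2 * a * q x * p x powr a) (at x within {0<..b})" for a
  proof -
    have "((\<lambda>y. p y powr a) has_real_derivative a * p x powr (a - 1) * (2 * p x * (p x * r x))) (at x within {0<..b})"
      using px by (auto intro!: derivative_eq_intros p_deriv[OF x])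
    moreover have "a * p x powr (a - 1) * (2 * p x * (p x * r x)) = 2 * a * q x * (p x powr (a - 1) * p x)"
      by (simp add: q_def)
    moreover have "p x powr (a - 1) * p x = p x powr a" using px by (simp add: powr_diff)
    ultimately show ?thesis by simp
  qed
  define f where "f y = of_real (p y powr (1/2)) * \<phi> y" for y
  define g where "g y = of_real (p y powr (-1/2)) * d\<phi> y" for y
  have fd: "(f has_vector_derivative of_real (p x powr (1/2)) * d\<phi> x + of_real (q x * p x powr (1/2)) * \<phi> x) (at x within {0<..b})"
    unfolding f_def using pd[of "1/2"] has_vector_derivative_within_subset[OF dd(1)[OF xb] sub]
    by (intro has_vector_derivative_mult has_vector_derivative_of_real) auto
  have gd: "(g has_vector_derivative of_real (p x powr (-1/2)) * dd x + of_real (- q x * p x powr (-1/2)) * d\<phi> x) (at x within {0<..b})"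
    unfolding g_def using pd[of "-1/2"] has_vector_derivative_within_subset[OF dd(2)[OF xb] sub]
    by (intro has_vector_derivative_mult has_vector_derivative_of_real) auto
  have w: "wave \<xi> h \<phi> d\<phi> y = f y + \<i> * of_real \<xi> * of_real h * g y" if "y \<in> {0<..b}" for y \<xi>
    unfolding wave_def f_def g_def P[OF that] by (simp add: mult_ac)
  have "((\<lambda>y. f y + \<i> * of_real \<zeta> * of_real h * g y) has_vector_derivative
     (of_real (p x powr (1/2)) * d\<phi> x + of_real (q x * p x powr (1/2)) * \<phi> x) + \<i> * of_real \<zeta> * of_real h *
     (of_real (p x powr (-1/2)) * dd x + of_real (- q x * p x powr (-1/2)) * d\<phi> x)) (at x within {0<..b})"
    by (intro has_vector_derivative_add has_vector_derivative_mult_right fd gd)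
  then have "(wave \<zeta> h \<phi> d\<phi> has_vector_derivative
     (of_real (p x powr (1/2)) * d\<phi> x + of_real (q x * p x powr (1/2)) * \<phi> x) + \<i> * of_real \<zeta> * of_real h *
     (of_real (p x powr (-1/2)) * dd x + of_real (- q x * p x powr (-1/2)) * d\<phi> x)) (at x within {0<..b})"
    by (rule has_vector_derivative_transform[OF x w, rotated])
  moreover have "(of_real (p x powr (1/2)) * d\<phi> x + of_real (q x * p x powr (1/2)) * \<phi> x) + \<i> * of_real \<zeta> * of_real h *
     (of_real (p x powr (-1/2)) * dd x + of_real (- q x * p x powr (-1/2)) * d\<phi> x) =
     - (\<i> * of_real \<zeta> * of_real (p x / h)) * wave \<zeta> h \<phi> d\<phi> x + of_real (q x) * wave (-\<zeta>) h \<phi> d\<phi> x"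
  proof -
    define s where "s = p x powr (1/2)"
    define t where "t = p x powr (-1/2)"
    have s: "p x * t = s"
    proof -
      have "p x * t = p x powr (1 + - 1/2)" unfolding powr_add t_def using px by simp
      then show ?thesis by (simp add: s_def)
    qed
    have z2: "of_real \<zeta> * of_real \<zeta> = (1::complex)" using zeta by auto
    have "of_real (h^2) * dd x = - (of_real (p x * p x) * \<phi> x)"
    proof -
      have "E = V x + p x * p x" using EV by (simp add: p_def)
      then have "complex_of_real E = of_real (V x) + of_real (p x * p x)"
        by (simp only: of_real_add[symmetric])
      with dd(3)[OF xb] show ?thesis by algebra
    qed
    then have ddx: "of_real h * dd x = - (of_real (p x * p x / h) * \<phi> x)"
      using h by (simp add: power2_eq_square field_simps)
    have "\<i> * of_real \<zeta> * of_real h * (of_real t * dd x) = \<i> * of_real \<zeta> * of_real t * (of_real h * dd x)"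
      by simp
    also have "\<dots> = - (\<i> * of_real \<zeta> * of_real (p x / h) * (of_real (p x * t) * \<phi> x))"
      unfolding ddx by (simp add: algebra_simps)
    finally have 1: "\<i> * of_real \<zeta> * of_real h * (of_real t * dd x) = - (\<i> * of_real \<zeta> * of_real (p x / h) * (of_real s * \<phi> x))"
      unfolding s .
    have "- (\<i> * of_real \<zeta> * of_real (p x / h)) * (\<i> * of_real \<zeta> * of_real h * (of_real t * d\<phi> x)) =
        (of_real \<zeta> * of_real \<zeta>) * (of_real (p x * t) * d\<phi> x)"
      using h by (simp add: field_simps)
    then have 2: "- (\<i> * of_real \<zeta> * of_real (p x / h)) * (\<i> * of_real \<zeta> * of_real h * (of_real t * d\<phi> x)) = of_real s * d\<phi> x"
      unfolding z2 s by simp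
    show ?thesis
      unfolding w[OF x] f_def g_def s_def[symmetric] t_def[symmetric]
      using 1 2 by (simp add: algebra_simps)
  qed
  ultimately show ?thesis by simp
qed

lemma wave_cont:
  assumes sch: "schrodinger_solution V b E h \<phi> d\<phi>"
  shows "continuous_on {0..b} (wave \<zeta> h \<phi> d\<phi>)"
proof -
  have c: "continuous_on {0..b} \<phi>" "continuous_on {0..b} d\<phi>"
    using sch unfolding schrodinger_solution_def
    by (meson continuous_on_eq_continuous_within has_vector_derivative_continuous)+
  have "E - V x \<noteq> 0" if "x \<in> {0..b}" for x using E_V_pos[OF that] by simp
  then show ?thesis
    unfolding wave_def by (intro continuous_intros c V_cont) auto
qed

text \<open>Both solutions \<open>(sol, sol')\<close> and \<open>(cnj sol', cnj sol)\<close> of the first-order system have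
  constant Wronskian with the interaction-picture wave of \<open>\<phi>\<close>.\<close>

lemma transfer:
  assumes h: "h \<in> {0<..1}" and adm: "admissible 2 (sol h)"
    and eq: "\<forall>x\<in>{0..b}. sol h x = 1 + osc_int 1 h (sol' h) x"
    and sch: "schrodinger_solution V b E h \<phi> d\<phi>"
  shows "wave 1 h \<phi> d\<phi> 0 = cis (S b / h) * cnj (sol h b) * wave 1 h \<phi> d\<phi> b
      - cis (- (S b / h)) * cnj (sol' h b) * wave (-1) h \<phi> d\<phi> b"
    and "wave (-1) h \<phi> d\<phi> 0 = cis (- (S b / h)) * sol h b * wave (-1) h \<phi> d\<phi> b
      - cis (S b / h) * sol' h b * wave 1 h \<phi> d\<phi> b"
proof -
  have h0: "h > 0" using h by simp
  note adm' = admissible_osc_int[OF adm h0, of "-1", folded sol'_def]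
  let ?e = "\<lambda>x. cis (2 * 1 * (S x / h)) * of_real (q x)"
  let ?e' = "\<lambda>x. cis (2 * (-1) * (S x / h)) * of_real (q x)"
  have Vd: "(sol' h has_vector_derivative sol h x * ?e' x) (at x within {0<..b})" if "x \<in> {0<..b}" for x
    using osc_int_deriv[OF adm h0 that, where \<zeta> = "-1"] by (simp add: sol'_def mult.assoc)
  have Ud: "(sol h has_vector_derivative sol' h x * ?e x) (at x within {0<..b})" if x: "x \<in> {0<..b}" for x
  proof -
    have "((\<lambda>x. 1 + osc_int 1 h (sol' h) x) has_vector_derivative 0 + sol' h x * cis (2 * 1 * (S x / h)) * of_real (q x)) (at x within {0<..b})"
      by (intro has_vector_derivative_add has_vector_derivative_const osc_int_deriv[OF adm' h0 x])
    then show ?thesis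
      using has_vector_derivative_transform[OF x, of "sol h" "\<lambda>x. 1 + osc_int 1 h (sol' h) x"] eq
      by (simp add: mult.assoc)
  qed
  define u where "u \<zeta> x = cis (\<zeta> * (S x / h)) * wave \<zeta> h \<phi> d\<phi> x" for \<zeta> x
  have ud: "(u \<zeta> has_vector_derivative cis (2 * \<zeta> * (S x / h)) * of_real (q x) * u (-\<zeta>) x) (at x within {0<..b})"
    if x: "x \<in> {0<..b}" and z: "\<zeta> = 1 \<or> \<zeta> = -1" for x \<zeta>
  proof -
    have "(u \<zeta> has_vector_derivative cis (\<zeta> * (S x / h)) *
      (- (\<i> * of_real \<zeta> * of_real (p x / h)) * wave \<zeta> h \<phi> d\<phi> x + of_real (q x) * wave (-\<zeta>) h \<phi> d\<phi> x) +
      of_real (\<zeta> * (p x / h)) * \<i> * cis (\<zeta> * (S x / h)) * wave \<zeta> h \<phi> d\<phi> x) (at x within {0<..b})"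
      unfolding u_def
      by (intro has_vector_derivative_mult has_vector_derivative_cis_phase DERIV_cmult S_over_h_deriv x
          wave_deriv[OF sch h0 z x])
    moreover have "cis (\<zeta> * (S x / h)) *
      (- (\<i> * of_real \<zeta> * of_real (p x / h)) * wave \<zeta> h \<phi> d\<phi> x + of_real (q x) * wave (-\<zeta>) h \<phi> d\<phi> x) +
      of_real (\<zeta> * (p x / h)) * \<i> * cis (\<zeta> * (S x / h)) * wave \<zeta> h \<phi> d\<phi> x =
      cis (\<zeta> * (S x / h)) * of_real (q x) * wave (-\<zeta>) h \<phi> d\<phi> x"
      by (simp add: algebra_simps)
    moreover have "cis (\<zeta> * (S x / h)) = cis (2 * \<zeta> * (S x / h)) * cis (-\<zeta> * (S x / h))"
      by (simp add: cis_mult)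
    ultimately show ?thesis by (simp add: u_def mult_ac)
  qed
  have uc: "continuous_on {0..b} (u \<zeta>)" for \<zeta>
    unfolding u_def using h0 by (intro continuous_intros wave_cont[OF sch] S_cont) auto
  have Uc: "continuous_on {0..b} (sol h)" "continuous_on {0..b} (sol' h)"
    using adm adm' by (auto simp: admissible_def)
  have cc: "cnj (?e x) = ?e' x" "cnj (?e' x) = ?e x" for x by (simp_all add: cis_cnj)
  have z: "(1::real) = 1 \<or> (1::real) = -1" "(-1::real) = 1 \<or> (-1::real) = -1" by auto
  \<comment> \<open>With these initial values each Wronskian at 0 is the wave itself.\<close>
  have s0: "sol h 0 = 1" "sol' h 0 = 0" using eq b by (auto simp: sol'_def)
  have u0: "u \<zeta> 0 = wave \<zeta> h \<phi> d\<phi> 0" for \<zeta> by (simp add: u_def S_0)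
  have "(\<lambda>x. u 1 x * cnj (sol h x) - u (-1) x * cnj (sol' h x)) b =
      (\<lambda>x. u 1 x * cnj (sol h x) - u (-1) x * cnj (sol' h x)) 0"
  proof (rule constant_from_zero)
    show "continuous_on {0..b} (\<lambda>x. u 1 x * cnj (sol h x) - u (-1) x * cnj (sol' h x))"
      by (intro continuous_intros uc Uc)
    fix x assume x: "x \<in> {0<..b}"
    have "((\<lambda>x. u 1 x * cnj (sol h x) - u (-1) x * cnj (sol' h x)) has_vector_derivative
      (u 1 x * cnj (sol' h x * ?e x) + (cis (2 * 1 * (S x / h)) * of_real (q x) * u (-1) x) * cnj (sol h x)) -
      (u (-1) x * cnj (sol h x * ?e' x) + (cis (2 * (-1) * (S x / h)) * of_real (q x) * u (- (-1)) x) * cnj (sol' h x))) (at x within {0<..b})"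
      by (intro has_vector_derivative_diff has_vector_derivative_mult has_vector_derivative_cnj ud Ud Vd x z)
    moreover have "(u 1 x * cnj (sol' h x * ?e x) + (cis (2 * 1 * (S x / h)) * of_real (q x) * u (-1) x) * cnj (sol h x)) -
      (u (-1) x * cnj (sol h x * ?e' x) + (cis (2 * (-1) * (S x / h)) * of_real (q x) * u (- (-1)) x) * cnj (sol' h x)) = 0"
      unfolding complex_cnj_mult[of "sol' h x"] complex_cnj_mult[of "sol h x"] cc by (simp add: mult_ac)
    ultimately show "((\<lambda>x. u 1 x * cnj (sol h x) - u (-1) x * cnj (sol' h x)) has_vector_derivative 0) (at x within {0<..b})"
      by simp
  qed
  then show "wave 1 h \<phi> d\<phi> 0 = cis (S b / h) * cnj (sol h b) * wave 1 h \<phi> d\<phi> b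
      - cis (- (S b / h)) * cnj (sol' h b) * wave (-1) h \<phi> d\<phi> b"
    by (simp add: s0 u0) (simp add: u_def mult_ac)
  have "(\<lambda>x. u (-1) x * sol h x - u 1 x * sol' h x) b = (\<lambda>x. u (-1) x * sol h x - u 1 x * sol' h x) 0"
  proof (rule constant_from_zero)
    show "continuous_on {0..b} (\<lambda>x. u (-1) x * sol h x - u 1 x * sol' h x)"
      by (intro continuous_intros uc Uc)
    fix x assume x: "x \<in> {0<..b}"
    have "((\<lambda>x. u (-1) x * sol h x - u 1 x * sol' h x) has_vector_derivative
      (u (-1) x * (sol' h x * ?e x) + (cis (2 * (-1) * (S x / h)) * of_real (q x) * u (- (-1)) x) * sol h x) -
      (u 1 x * (sol h x * ?e' x) + (cis (2 * 1 * (S x / h)) * of_real (q x) * u (-1) x) * sol' h x)) (at x within {0<..b})"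
      by (intro has_vector_derivative_diff has_vector_derivative_mult ud Ud Vd x z)
    moreover have "(u (-1) x * (sol' h x * ?e x) + (cis (2 * (-1) * (S x / h)) * of_real (q x) * u (- (-1)) x) * sol h x) -
      (u 1 x * (sol h x * ?e' x) + (cis (2 * 1 * (S x / h)) * of_real (q x) * u (-1) x) * sol' h x) = 0"
      by (simp add: mult_ac)
    ultimately show "((\<lambda>x. u (-1) x * sol h x - u 1 x * sol' h x) has_vector_derivative 0) (at x within {0<..b})"
      by simp
  qed
  then show "wave (-1) h \<phi> d\<phi> 0 = cis (- (S b / h)) * sol h b * wave (-1) h \<phi> d\<phi> b
      - cis (S b / h) * sol' h b * wave 1 h \<phi> d\<phi> b"
    by (simp add: s0 u0) (simp add: u_def mult_ac)
qed

end

section \<open>Coefficients of asymptotic expansions\<close>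

definition trunc :: "real set \<Rightarrow> real \<Rightarrow> (real \<Rightarrow> 'a::real_normed_vector) \<Rightarrow> real \<Rightarrow> 'a" where
  "trunc A N a h = (\<Sum>\<alpha>\<in>{\<alpha>\<in>A. \<alpha> < N}. (h powr \<alpha>) *\<^sub>R a \<alpha>)"

definition has_asymp :: "real set \<Rightarrow> (real \<Rightarrow> 'a::real_normed_vector) \<Rightarrow> (real \<Rightarrow> 'a) \<Rightarrow> bool" where
  "has_asymp A F a \<longleftrightarrow> (\<forall>N\<ge>0. \<exists>C. \<forall>\<^sub>F h in at_right 0. norm (F h - trunc A N a h) \<le> C * h powr N)"

lemma asymp_expansion_iff: "asymp_expansion A F \<longleftrightarrow> exponent_set A \<and> (\<exists>a. has_asymp A F a)"
  by (simp add: asymp_expansion_def has_asymp_def trunc_def)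

lemma finite_exponents_below: "exponent_set A \<Longrightarrow> finite {\<alpha>\<in>A. \<alpha> < N}"
proof -
  assume A: "exponent_set A"
  then obtain m where "\<And>x. x \<in> A \<Longrightarrow> m \<le> x" by (auto simp: exponent_set_def bdd_below_def)
  then have sub: "{\<alpha>\<in>A. \<alpha> < N} \<subseteq> A \<inter> {m..N}" by auto
  have "finite (A \<inter> {m..N})" using A by (simp add: exponent_set_def)
  then show ?thesis by (rule finite_subset[OF sub])
qed

lemma trunc_diff_bound:
  assumes A: "exponent_set A" and "N \<le> M" and h: "h \<in> {0<..1}"
  shows "norm (trunc A M a h - trunc A N a h) \<le> (\<Sum>\<alpha>\<in>{\<alpha>\<in>A. \<alpha> < M}. norm (a \<alpha>)) * h powr N"
proof -
  let ?J = "{\<alpha>\<in>A. \<alpha> < M} - {\<alpha>\<in>A. \<alpha> < N}"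
  note fin = finite_exponents_below[OF A]
  have "trunc A M a h - trunc A N a h = (\<Sum>\<alpha>\<in>?J. (h powr \<alpha>) *\<^sub>R a \<alpha>)"
    unfolding trunc_def using assms(2) by (subst sum_diff[OF fin]) auto
  also have "norm \<dots> \<le> (\<Sum>\<alpha>\<in>?J. norm (a \<alpha>) * h powr N)"
    using h by (intro sum_norm_le) (auto simp: mult.commute intro!: mult_left_mono powr_mono')
  also have "\<dots> \<le> (\<Sum>\<alpha>\<in>{\<alpha>\<in>A. \<alpha> < M}. norm (a \<alpha>) * h powr N)"
    by (intro sum_mono2 fin) auto
  finally show ?thesis by (simp add: sum_distrib_right)
qed

text \<open>A real order N is reached by rounding up; the surplus terms have exponents at least N
  and are O(h^N).\<close>

lemma has_asymp_natI:
  assumes A: "exponent_set A"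
    and F: "\<And>N::nat. \<exists>C. \<forall>\<^sub>F h in at_right 0. norm (F h - trunc A (real N) a h) \<le> C * h ^ N"
  shows "has_asymp A F a"
  unfolding has_asymp_def
proof (intro allI impI)
  fix N :: real assume "N \<ge> 0"
  obtain n :: nat where n: "N \<le> real n" by (meson real_arch_simple)
  obtain C where C: "\<forall>\<^sub>F h in at_right 0. norm (F h - trunc A (real n) a h) \<le> C * h ^ n"
    using F by blast
  let ?D = "\<Sum>\<alpha>\<in>{\<alpha>\<in>A. \<alpha> < real n}. norm (a \<alpha>)"
  have "\<forall>\<^sub>F h in at_right 0. norm (F h - trunc A N a h) \<le> (\<bar>C\<bar> + ?D) * h powr N"
    using C eventually_unit
  proof eventually_elim
    case (elim h)
    have "norm (F h - trunc A (real n) a h) \<le> \<bar>C\<bar> * h ^ n"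
      using elim by (intro order_trans[OF elim(1)] mult_right_mono) auto
    also have "\<dots> \<le> \<bar>C\<bar> * h powr N"
      using elim(2) n powr_mono'[of N "real n" h] by (intro mult_left_mono) (auto simp: powr_realpow)
    finally have "norm (F h - trunc A (real n) a h) \<le> \<bar>C\<bar> * h powr N" .
    moreover have "norm (trunc A (real n) a h - trunc A N a h) \<le> ?D * h powr N"
      by (rule trunc_diff_bound[OF A n elim(2)])
    moreover have "norm (F h - trunc A N a h) \<le>
        norm (F h - trunc A (real n) a h) + norm (trunc A (real n) a h - trunc A N a h)"
      using norm_triangle_ineq[of "F h - trunc A (real n) a h" "trunc A (real n) a h - trunc A N a h"] by simp
    ultimately show ?case by (simp add: distrib_right)
  qed
  then show "\<exists>C. \<forall>\<^sub>F h in at_right 0. norm (F h - trunc A N a h) \<le> C * h powr N" by blast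
qed

lemma asymp_expansion_add:
  assumes "asymp_expansion A F" "asymp_expansion A G"
  shows "asymp_expansion A (\<lambda>h. F h + G h)"
proof -
  obtain a b where ab: "has_asymp A F a" "has_asymp A G b" and A: "exponent_set A"
    using assms by (auto simp: asymp_expansion_iff)
  have "has_asymp A (\<lambda>h. F h + G h) (\<lambda>\<alpha>. a \<alpha> + b \<alpha>)"
    unfolding has_asymp_def
  proof (intro allI impI)
    fix N :: real assume N: "N \<ge> 0"
    obtain C D where C: "\<forall>\<^sub>F h in at_right 0. norm (F h - trunc A N a h) \<le> C * h powr N"
      and D: "\<forall>\<^sub>F h in at_right 0. norm (G h - trunc A N b h) \<le> D * h powr N"
      using ab N unfolding has_asymp_def by meson
    have "\<forall>\<^sub>F h in at_right 0. norm (F h + G h - trunc A N (\<lambda>\<alpha>. a \<alpha> + b \<alpha>) h) \<le> (C + D) * h powr N"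
      using C D
    proof eventually_elim
      case (elim h)
      have "trunc A N (\<lambda>\<alpha>. a \<alpha> + b \<alpha>) h = trunc A N a h + trunc A N b h"
        by (simp add: trunc_def scaleR_right_distrib sum.distrib)
      then show ?case
        using elim norm_diff_triangle_ineq[of "F h" "G h" "trunc A N a h" "trunc A N b h"]
        by (simp add: distrib_right)
    qed
    then show "\<exists>C. \<forall>\<^sub>F h in at_right 0. norm (F h + G h - trunc A N (\<lambda>\<alpha>. a \<alpha> + b \<alpha>) h) \<le> C * h powr N"
      by blast
  qed
  then show ?thesis using A by (auto simp: asymp_expansion_iff)
qed

lemma asymp_expansion_linear:
  assumes "asymp_expansion A F" and T: "bounded_linear T"
  shows "asymp_expansion A (\<lambda>h. T (F h))"
proof -
  obtain a where a: "has_asymp A F a" and A: "exponent_set A"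
    using assms by (auto simp: asymp_expansion_iff)
  interpret T: bounded_linear T by (rule T)
  obtain K where K: "K > 0" "\<And>x. norm (T x) \<le> norm x * K" using T.pos_bounded by blast
  have "has_asymp A (\<lambda>h. T (F h)) (\<lambda>\<alpha>. T (a \<alpha>))"
    unfolding has_asymp_def
  proof (intro allI impI)
    fix N :: real assume N: "N \<ge> 0"
    obtain C where C: "\<forall>\<^sub>F h in at_right 0. norm (F h - trunc A N a h) \<le> C * h powr N"
      using a N unfolding has_asymp_def by meson
    have "\<forall>\<^sub>F h in at_right 0. norm (T (F h) - trunc A N (\<lambda>\<alpha>. T (a \<alpha>)) h) \<le> (C * K) * h powr N"
      using C
    proof eventually_elim
      case (elim h)
      have "T (F h) - trunc A N (\<lambda>\<alpha>. T (a \<alpha>)) h = T (F h - trunc A N a h)"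
        by (simp add: trunc_def T.diff T.sum T.scaleR)
      then have "norm (T (F h) - trunc A N (\<lambda>\<alpha>. T (a \<alpha>)) h) \<le> norm (F h - trunc A N a h) * K"
        using K(2) by simp
      also have "\<dots> \<le> C * h powr N * K" using elim K(1) by (intro mult_right_mono) auto
      finally show ?case by (simp add: mult_ac)
    qed
    then show "\<exists>C. \<forall>\<^sub>F h in at_right 0. norm (T (F h) - trunc A N (\<lambda>\<alpha>. T (a \<alpha>)) h) \<le> C * h powr N"
      by blast
  qed
  then show ?thesis using A by (auto simp: asymp_expansion_iff)
qed

lemma asymp_expansion_minus: "asymp_expansion A F \<Longrightarrow> asymp_expansion A (\<lambda>h. - F h)"
  by (rule asymp_expansion_linear[OF _ bounded_linear_minus[OF bounded_linear_ident]])

lemma asymp_expansion_diff: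
  "asymp_expansion A F \<Longrightarrow> asymp_expansion A G \<Longrightarrow> asymp_expansion A (\<lambda>h. F h - G h)"
  using asymp_expansion_add[OF _ asymp_expansion_minus, of A F G] by simp

text \<open>The formal series is grouped into blocks of exponents in [n, n + 1), and the n-th block
  is switched on only for h below a cutoff. The series then converges, and for small h its first
  blocks are intact.\<close>

lemma borel_summation:
  fixes a :: "real \<Rightarrow> 'a::banach"
  assumes A: "exponent_set A" and pos: "A \<subseteq> {0..}"
  shows "\<exists>F. has_asymp A F a"
proof -
  define P where "P n = trunc A (real n) a" for n
  define D where "D n = (\<Sum>\<alpha>\<in>{\<alpha>\<in>A. \<alpha> < real (Suc n)}. norm (a \<alpha>))" for n
  have D0: "D n \<ge> 0" for n by (simp add: D_def sum_nonneg)
  have PD: "norm (P (Suc n) h - P n h) \<le> D n * h ^ n" if "h \<in> {0<..1}" for n h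
    using trunc_diff_bound[OF A, of "real n" "real (Suc n)" h a] that
    by (simp add: P_def D_def powr_realpow del: of_nat_Suc)
  have P0: "P 0 h = 0" for h
  proof -
    have "{\<alpha>\<in>A. \<alpha> < real 0} = {}" using pos by auto
    then show ?thesis by (simp only: P_def trunc_def sum.empty)
  qed
  \<comment> \<open>Below this cutoff one factor h outweighs the size \<open>D n\<close> of the
    block and leaves 2^(-n).\<close>
  define \<eta> where "\<eta> n = 1 / (2 ^ n * (D n + 1))" for n
  have \<eta>: "\<eta> n > 0" for n using D0[of n] by (simp add: \<eta>_def)
  define t where "t n h = (if h < \<eta> n then P (Suc n) h - P n h else 0)" for n h
  define F where "F h = (\<Sum>n. t n h)" for h
  have t: "norm (t n h) \<le> (1 / 2) ^ n * (h ^ n / h)" if h: "h \<in> {0<..1}" for n h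
  proof (cases "h < \<eta> n")
    case True
    have "D n * h \<le> D n * \<eta> n" using True D0 by (intro mult_left_mono) auto
    also have "\<dots> \<le> (1 / 2) ^ n"
      using D0[of n] by (simp add: \<eta>_def power_divide divide_simps mult_left_le_one_le)
    finally have "D n * h * (h ^ n / h) \<le> (1 / 2) ^ n * (h ^ n / h)"
      using h by (intro mult_right_mono) auto
    then show ?thesis using PD[OF h, of n] True h by (simp add: t_def)
  next
    case False
    then show ?thesis using h by (simp add: t_def)
  qed
  have half: "summable (\<lambda>n. (1 / 2 :: real) ^ n)" by (intro summable_geometric) auto
  \<comment> \<open>One factor h has been spent on convergence, so the partial sum runs one block
    further than the error order.\<close>
  have tail: "norm (F h - P (Suc N) h) \<le> 2 * h ^ N" if h: "h \<in> {0<..1}" and small: "\<forall>n\<in>{..<Suc N}. h < \<eta> n" for h N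
  proof -
    have bd: "norm (t (n + Suc N) h) \<le> (1 / 2) ^ n * h ^ N" for n
    proof -
      have "norm (t (n + Suc N) h) \<le> (1 / 2) ^ (n + Suc N) * (h ^ (n + Suc N) / h)" by (rule t[OF h])
      also have "\<dots> \<le> (1 / 2) ^ n * h ^ N"
      proof (intro mult_mono)
        show "(1 / 2 :: real) ^ (n + Suc N) \<le> (1 / 2) ^ n" by (intro power_decreasing) auto
        have "h ^ (n + Suc N) / h = h ^ (n + N)" using h by simp
        also have "\<dots> \<le> h ^ N" using h by (intro power_decreasing) auto
        finally show "h ^ (n + Suc N) / h \<le> h ^ N" .
      qed (use h in auto)
      finally show ?thesis .
    qed
    have sm: "summable (\<lambda>n. (1 / 2) ^ n * h ^ N)" using half by (rule summable_mult2)
    have "summable (\<lambda>n. t (n + Suc N) h)" by (rule summable_comparison_test'[OF sm bd])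
    then have st: "summable (\<lambda>n. t n h)"
      using summable_iff_shift[of "\<lambda>n. t n h" "Suc N"] by blast
    have "(\<Sum>n<Suc N. t n h) = (\<Sum>n<Suc N. P (Suc n) h - P n h)"
      using small by (intro sum.cong) (auto simp: t_def)
    also have "\<dots> = P (Suc N) h" using sum_lessThan_telescope[of "\<lambda>n. P n h" "Suc N"] P0 by simp
    finally have "F h - P (Suc N) h = (\<Sum>n. t (n + Suc N) h)"
      unfolding F_def using suminf_minus_initial_segment[OF st, of "Suc N"] by simp
    also have "norm \<dots> \<le> (\<Sum>n. (1 / 2) ^ n * h ^ N)"
      by (rule norm_suminf_le[OF bd sm])
    also have "\<dots> = 2 * h ^ N"
      using suminf_mult2[OF half, of "h ^ N"] suminf_geometric[of "1 / 2 :: real"] by simp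
    finally show ?thesis .
  qed
  have "has_asymp A F a"
  proof (rule has_asymp_natI[OF A])
    fix N :: nat
    have ev: "\<forall>\<^sub>F h in at_right 0. \<forall>n\<in>{..<Suc N}. h < \<eta> n"
      using \<eta> by (intro eventually_ball_finite) (auto simp: eventually_at_right_field)
    have "\<forall>\<^sub>F h in at_right 0. norm (F h - trunc A (real N) a h) \<le> (2 + D N) * h ^ N"
      using ev eventually_unit
    proof eventually_elim
      case (elim h)
      have "norm (F h - P N h) \<le> norm (F h - P (Suc N) h) + norm (P (Suc N) h - P N h)"
        using norm_triangle_ineq[of "F h - P (Suc N) h" "P (Suc N) h - P N h"] by simp
      then show ?case using tail[OF elim(2,1)] PD[OF elim(2), of N] by (simp add: P_def distrib_right)
    qed
    then show "\<exists>C. \<forall>\<^sub>F h in at_right 0. norm (F h - trunc A (real N) a h) \<le> C * h ^ N" by blast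
  qed
  then show ?thesis by blast
qed

text \<open>Along h = |s| / (2 pi n) the phase is 1, and along h = |s| / (2 pi (n + 1/2)) it is -1;
  hence a + b = 0 and a - b = 0.\<close>

lemma oscillating_limit_zero:
  assumes s: "s \<noteq> 0" and lim: "((\<lambda>h. a + cis (s / h) * b) \<longlongrightarrow> 0) (at_right 0)"
  shows "a = 0 \<and> b = 0"
proof -
  have top: "((\<lambda>x. a + cis (s * x) * b) \<longlongrightarrow> 0) at_top"
    using filterlim_compose[OF lim filterlim_inverse_at_right_top] by (simp add: divide_inverse)
  have seq: "(\<lambda>n. a + cis (s * (2 * pi / \<bar>s\<bar> * (d + real n))) * b) \<longlonglongrightarrow> 0" for d
  proof -
    have "filterlim (\<lambda>n. 2 * pi / \<bar>s\<bar> * (d + real n)) at_top sequentially"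
      using s by (intro filterlim_tendsto_pos_mult_at_top[OF tendsto_const]
          filterlim_tendsto_add_at_top[OF tendsto_const] filterlim_real_sequentially) auto
    from filterlim_compose[OF top this] show ?thesis .
  qed
  have sgn: "s * (2 * pi / \<bar>s\<bar> * y) = 2 * pi * y \<or> s * (2 * pi / \<bar>s\<bar> * y) = - (2 * pi * y)" for y
    using s by (cases "s > 0") (auto simp: field_simps)
  have cis1: "cis (s * (2 * pi / \<bar>s\<bar> * (0 + real n))) = 1" for n
  proof -
    have "cis (2 * pi * real n) = 1" using cis_multiple_2pi[of "real n"] by simp
    then show ?thesis using sgn[of "0 + real n"] by (auto simp: cis_cnj[symmetric])
  qed
  have cis2: "cis (s * (2 * pi / \<bar>s\<bar> * (1 / 2 + real n))) = - 1" for n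
  proof -
    have "2 * pi * (1 / 2 + real n) = pi + 2 * pi * real n" by (simp add: algebra_simps)
    then have "cis (2 * pi * (1 / 2 + real n)) = cis pi * cis (2 * pi * real n)"
      by (simp only: cis_mult)
    also have "\<dots> = - 1" using cis_multiple_2pi[of "real n"] by simp
    finally show ?thesis
      using sgn[of "1 / 2 + real n"] by (auto simp: cis_cnj[symmetric])
  qed
  have "a + b = 0" using seq[of 0] unfolding cis1 by (simp add: LIMSEQ_const_iff)
  moreover have "a - b = 0" using seq[of "1 / 2"] unfolding cis2 by (simp add: LIMSEQ_const_iff)
  ultimately show ?thesis by (simp add: eq_neg_iff_add_eq_0)
qed

text \<open>Dividing by the smallest power of h leaves its two coefficients and terms tending to 0;
  they vanish by \<open>oscillating_limit_zero\<close>, and the remaining exponents follow in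
  increasing order.\<close>

lemma oscillating_coefficients_zero:
  fixes a b :: "real \<Rightarrow> complex"
  assumes s: "s \<noteq> 0" and "finite I" "\<And>\<alpha>. \<alpha> \<in> I \<Longrightarrow> \<alpha> < M"
    and "\<forall>\<^sub>F h in at_right 0. norm ((\<Sum>\<alpha>\<in>I. (h powr \<alpha>) *\<^sub>R a \<alpha>) +
      cis (s / h) * (\<Sum>\<alpha>\<in>I. (h powr \<alpha>) *\<^sub>R b \<alpha>)) \<le> C * h powr M"
  shows "\<forall>\<alpha>\<in>I. a \<alpha> = 0 \<and> b \<alpha> = 0"
  using assms(2-4)
proof (induction I rule: finite_linorder_min_induct)
  case empty
  show ?case by simp
next
  case (insert m I)
  have m: "m \<notin> I" using insert.hyps by auto
  have lim: "((\<lambda>h. a m + cis (s / h) * b m) \<longlongrightarrow> 0) (at_right 0)"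
  proof (rule Lim_null_comparison)
    let ?g = "\<lambda>h. C * h powr (M - m) + (\<Sum>\<alpha>\<in>I. (norm (a \<alpha>) + norm (b \<alpha>)) * h powr (\<alpha> - m))"
    show "\<forall>\<^sub>F h in at_right 0. norm (a m + cis (s / h) * b m) \<le> ?g h"
      using insert.prems(2) eventually_unit
    proof eventually_elim
      case (elim h)
      have h: "h > 0" using elim by simp
      let ?r = "(\<Sum>\<alpha>\<in>I. (h powr \<alpha>) *\<^sub>R a \<alpha>) + cis (s / h) * (\<Sum>\<alpha>\<in>I. (h powr \<alpha>) *\<^sub>R b \<alpha>)"
      have "(h powr m) *\<^sub>R (a m + cis (s / h) * b m) + ?r =
        (\<Sum>\<alpha>\<in>insert m I. (h powr \<alpha>) *\<^sub>R a \<alpha>) + cis (s / h) * (\<Sum>\<alpha>\<in>insert m I. (h powr \<alpha>) *\<^sub>R b \<alpha>)"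
        using m insert.hyps(1) by (simp add: algebra_simps)
      then have "norm ((h powr m) *\<^sub>R (a m + cis (s / h) * b m) + ?r) \<le> C * h powr M"
        using elim(1) by simp
      moreover have "norm ?r \<le> (\<Sum>\<alpha>\<in>I. (norm (a \<alpha>) + norm (b \<alpha>)) * h powr \<alpha>)"
      proof -
        have "norm ?r \<le> norm (\<Sum>\<alpha>\<in>I. (h powr \<alpha>) *\<^sub>R a \<alpha>) + norm (\<Sum>\<alpha>\<in>I. (h powr \<alpha>) *\<^sub>R b \<alpha>)"
          by (rule order_trans[OF norm_triangle_ineq]) simp
        also have "\<dots> \<le> (\<Sum>\<alpha>\<in>I. norm (a \<alpha>) * h powr \<alpha>) + (\<Sum>\<alpha>\<in>I. norm (b \<alpha>) * h powr \<alpha>)"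
          by (intro add_mono sum_norm_le) (auto simp: mult.commute)
        finally show ?thesis by (simp add: sum.distrib distrib_right)
      qed
      moreover have "norm (x :: complex) \<le> norm (x + y) + norm y" for x y
        using norm_triangle_ineq4[of "x + y" y] by simp
      ultimately have "norm ((h powr m) *\<^sub>R (a m + cis (s / h) * b m)) \<le>
          C * h powr M + (\<Sum>\<alpha>\<in>I. (norm (a \<alpha>) + norm (b \<alpha>)) * h powr \<alpha>)"
        by (meson add_mono order_trans)
      then have "h powr m * norm (a m + cis (s / h) * b m) \<le>
          C * h powr M + (\<Sum>\<alpha>\<in>I. (norm (a \<alpha>) + norm (b \<alpha>)) * h powr \<alpha>)" by simp
      also have "\<dots> = h powr m * ?g h"
      proof -
        have "h powr m * h powr (x - m) = h powr x" for x by (simp flip: powr_add)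
        then show ?thesis
          by (simp only: distrib_left sum_distrib_left mult.left_commute[of "h powr m"])
      qed
      finally show ?case using h by simp
    qed
    have "(?g \<longlongrightarrow> 0 + (\<Sum>\<alpha>\<in>I. 0)) (at_right 0)"
    proof (intro tendsto_add tendsto_sum powr_tendsto_0)
      show "0 < M - m" using insert.prems(1)[of m] by simp
      show "0 < \<alpha> - m" if "\<alpha> \<in> I" for \<alpha> using insert.hyps(2) that by simp
    qed
    then show "(?g \<longlongrightarrow> 0) (at_right 0)" by simp
  qed
  have z: "a m = 0" "b m = 0" using oscillating_limit_zero[OF s lim] by auto
  have "\<forall>\<alpha>\<in>I. a \<alpha> = 0 \<and> b \<alpha> = 0"
  proof (rule insert.IH)
    show "\<alpha> < M" if "\<alpha> \<in> I" for \<alpha> using insert.prems(1) that by simp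
    show "\<forall>\<^sub>F h in at_right 0. norm ((\<Sum>\<alpha>\<in>I. (h powr \<alpha>) *\<^sub>R a \<alpha>) +
      cis (s / h) * (\<Sum>\<alpha>\<in>I. (h powr \<alpha>) *\<^sub>R b \<alpha>)) \<le> C * h powr M"
      using insert.prems(2) m insert.hyps(1) z by simp
  qed
  then show ?case using z by auto
qed

lemma trunc_add: "trunc A N (\<lambda>\<alpha>. a \<alpha> + b \<alpha>) h = trunc A N a h + trunc A N b h"
  by (simp add: trunc_def scaleR_right_distrib sum.distrib)

lemma trunc_diff: "trunc A N (\<lambda>\<alpha>. a \<alpha> - b \<alpha>) h = trunc A N a h - trunc A N b h"
  by (simp add: trunc_def scaleR_right_diff_distrib sum_subtractf)

lemma has_asymp_limit:
  assumes A: "exponent_set A" "A \<subseteq> {0..}" "0 \<in> A" and F: "has_asymp A F a"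
  shows "(F \<longlongrightarrow> a 0) (at_right 0)"
proof -
  obtain C where C: "\<forall>\<^sub>F h in at_right 0. norm (F h - trunc A 1 a h) \<le> C * h powr 1"
    using F unfolding has_asymp_def by (meson zero_le_one)
  have "((\<lambda>h. F h - trunc A 1 a h) \<longlongrightarrow> 0) (at_right 0)"
    by (rule Lim_null_comparison[OF C powr_tendsto_0]) simp
  moreover have "((\<lambda>h. trunc A 1 a h) \<longlongrightarrow> a 0) (at_right 0)"
  proof -
    let ?I = "{\<alpha>\<in>A. \<alpha> < 1}"
    have fin: "finite ?I" and 0: "0 \<in> ?I" using finite_exponents_below[OF A(1)] A(3) by auto
    have "((\<lambda>h. a 0 + (\<Sum>\<alpha>\<in>?I - {0}. (h powr \<alpha>) *\<^sub>R a \<alpha>)) \<longlongrightarrow> a 0 + (\<Sum>\<alpha>\<in>?I - {0}. 0 *\<^sub>R a \<alpha>)) (at_right 0)"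
    proof (intro tendsto_intros)
      fix \<alpha> assume "\<alpha> \<in> ?I - {0}"
      then have "\<alpha> > 0" using A(2) by force
      then show "((\<lambda>h. h powr \<alpha>) \<longlongrightarrow> 0) (at_right 0)" using powr_tendsto_0[of \<alpha> 1] by simp
    qed
    moreover have "\<forall>\<^sub>F h in at_right 0. a 0 + (\<Sum>\<alpha>\<in>?I - {0}. (h powr \<alpha>) *\<^sub>R a \<alpha>) = trunc A 1 a h"
      using eventually_unit
    proof eventually_elim
      case (elim h)
      then show ?case unfolding trunc_def using sum.remove[OF fin 0, of "\<lambda>\<alpha>. (h powr \<alpha>) *\<^sub>R a \<alpha>"] by simp
    qed
    ultimately show ?thesis by (auto elim: Lim_transform_eventually)
  qed
  ultimately have "((\<lambda>h. (F h - trunc A 1 a h) + trunc A 1 a h) \<longlongrightarrow> 0 + a 0) (at_right 0)"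
    by (rule tendsto_add)
  then show ?thesis by simp
qed

lemma has_asymp_remove_0:
  assumes A: "exponent_set A" "0 \<in> A" and F: "has_asymp A F a"
  shows "has_asymp (A - {0}) (\<lambda>h. F h - a 0) a"
proof (rule has_asymp_natI)
  show A': "exponent_set (A - {0})"
    using A(1) unfolding exponent_set_def by (auto intro: bdd_below_mono finite_subset[rotated])
  fix N :: nat
  \<comment> \<open>Order \<open>Suc N\<close>, so that the exponent 0 lies below the cut even for
    \<open>N = 0\<close>.\<close>
  obtain C where C: "\<forall>\<^sub>F h in at_right 0. norm (F h - trunc A (real (Suc N)) a h) \<le> C * h powr real (Suc N)"
    using F unfolding has_asymp_def by (meson of_nat_0_le_iff)
  let ?D = "\<Sum>\<alpha>\<in>{\<alpha>\<in>A - {0}. \<alpha> < real (Suc N)}. norm (a \<alpha>)"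
  have "\<forall>\<^sub>F h in at_right 0. norm (F h - a 0 - trunc (A - {0}) (real N) a h) \<le> (\<bar>C\<bar> + ?D) * h ^ N"
    using C eventually_unit
  proof eventually_elim
    case (elim h)
    have h: "h > 0" "h \<le> 1" using elim by auto
    let ?I = "{\<alpha>\<in>A. \<alpha> < real (Suc N)}"
    have fin: "finite ?I" and 0: "0 \<in> ?I" using finite_exponents_below[OF A(1)] A(2) by auto
    have "?I - {0} = {\<alpha>\<in>A - {0}. \<alpha> < real (Suc N)}" by auto
    then have "trunc A (real (Suc N)) a h = a 0 + trunc (A - {0}) (real (Suc N)) a h"
      unfolding trunc_def using sum.remove[OF fin 0, of "\<lambda>\<alpha>. (h powr \<alpha>) *\<^sub>R a \<alpha>"] h by simp
    then have "norm (F h - a 0 - trunc (A - {0}) (real (Suc N)) a h) \<le> C * h powr real (Suc N)"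
      using elim(1) by (simp add: algebra_simps)
    also have "\<dots> \<le> \<bar>C\<bar> * h powr real N"
      using h by (intro mult_mono powr_mono') auto
    finally have "norm (F h - a 0 - trunc (A - {0}) (real (Suc N)) a h) \<le> \<bar>C\<bar> * h ^ N"
      using h by (simp add: powr_realpow)
    moreover have "norm (trunc (A - {0}) (real (Suc N)) a h - trunc (A - {0}) (real N) a h) \<le> ?D * h powr real N"
      by (rule trunc_diff_bound[OF A' _ elim(2)]) simp
    moreover have "norm (x - z) \<le> norm (x - y) + norm (y - z)" for x y z :: 'a
      using norm_triangle_ineq[of "x - y" "y - z"] by simp
    ultimately have "norm (F h - a 0 - trunc (A - {0}) (real N) a h) \<le> \<bar>C\<bar> * h ^ N + ?D * h powr real N"
      by (meson add_mono order_trans)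
    then show ?case using h by (simp add: powr_realpow distrib_right)
  qed
  then show "\<exists>C. \<forall>\<^sub>F h in at_right 0. norm (F h - a 0 - trunc (A - {0}) (real N) a h) \<le> C * h ^ N"
    by blast
qed

text \<open>The coefficients found for different orders \<open>N\<close> agree by uniqueness; Borel summation of
  the \<open>b\<close> series then turns the order-by-order splitting into an exact one.\<close>

lemma exact_splitting:
  fixes f :: "real \<Rightarrow> complex"
  assumes A: "exponent_set A" "A \<subseteq> {0..}" "0 \<in> A" and s: "s \<noteq> 0"
    and f: "\<And>N::nat. \<exists>a b C. \<forall>\<^sub>F h in at_right 0.
      norm (f h - (trunc A (real N) a h + cis (s / h) * trunc A (real N) b h)) \<le> C * h ^ N"
    and lim: "(f \<longlongrightarrow> v) (at_right 0)"
  obtains F G where "\<And>h. f h = v + F h + cis (s / h) * G h"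
    "asymp_expansion (A - {0}) F" "asymp_expansion (A - {0}) G"
proof -
  have "\<forall>N::nat. \<exists>t. \<forall>\<^sub>F h in at_right 0. norm (f h - (trunc A (real N) (fst t) h +
      cis (s / h) * trunc A (real N) (fst (snd t)) h)) \<le> snd (snd t) * h ^ N"
  proof
    fix N :: nat
    obtain a b C where "\<forall>\<^sub>F h in at_right 0.
      norm (f h - (trunc A (real N) a h + cis (s / h) * trunc A (real N) b h)) \<le> C * h ^ N"
      using f[of N] by (elim exE)
    then show "\<exists>t. \<forall>\<^sub>F h in at_right 0. norm (f h - (trunc A (real N) (fst t) h +
      cis (s / h) * trunc A (real N) (fst (snd t)) h)) \<le> snd (snd t) * h ^ N"
      by (intro exI[of _ "(a, b, C)"]) simp
  qed
  from choice[OF this] obtain T where T: "\<forall>N::nat. \<forall>\<^sub>F h in at_right 0.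
      norm (f h - (trunc A (real N) (fst (T N)) h + cis (s / h) * trunc A (real N) (fst (snd (T N))) h))
      \<le> snd (snd (T N)) * h ^ N"
    by (elim exE)
  define a where "a N = fst (T N)" for N
  define b where "b N = fst (snd (T N))" for N
  define C where "C N = snd (snd (T N))" for N
  note abC = T[folded a_def b_def C_def]
  have agree: "a N \<alpha> = a M \<alpha> \<and> b N \<alpha> = b M \<alpha>"
    if NM: "N \<le> M" and \<alpha>: "\<alpha> \<in> A" "\<alpha> < real N" for N M :: nat and \<alpha>
  proof -
    let ?Da = "\<Sum>\<alpha>\<in>{\<alpha>\<in>A. \<alpha> < real M}. norm (a M \<alpha>)"
    let ?Db = "\<Sum>\<alpha>\<in>{\<alpha>\<in>A. \<alpha> < real M}. norm (b M \<alpha>)"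
    have "\<forall>\<^sub>F h in at_right 0. norm (trunc A (real N) (\<lambda>\<alpha>. a N \<alpha> - a M \<alpha>) h +
        cis (s / h) * trunc A (real N) (\<lambda>\<alpha>. b N \<alpha> - b M \<alpha>) h)
      \<le> (\<bar>C N\<bar> + \<bar>C M\<bar> + ?Da + ?Db) * h powr real N"
      using abC[rule_format, of N] abC[rule_format, of M] eventually_unit
    proof eventually_elim
      case (elim h)
      have h: "h > 0" "h \<le> 1" using elim by auto
      let ?e = "cis (s / h)"
      define X where "X = f h - (trunc A (real N) (a N) h + ?e * trunc A (real N) (b N) h)"
      define Y where "Y = f h - (trunc A (real M) (a M) h + ?e * trunc A (real M) (b M) h)"
      define U where "U = trunc A (real M) (a M) h - trunc A (real N) (a M) h"
      define V where "V = trunc A (real M) (b M) h - trunc A (real N) (b M) h"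
      have eq: "trunc A (real N) (\<lambda>\<alpha>. a N \<alpha> - a M \<alpha>) h + ?e * trunc A (real N) (\<lambda>\<alpha>. b N \<alpha> - b M \<alpha>) h
          = (Y - X) + (U + ?e * V)"
        by (simp add: trunc_diff X_def Y_def U_def V_def algebra_simps)
      have "norm X \<le> \<bar>C N\<bar> * h powr real N"
        using elim(1) h by (simp add: X_def powr_realpow)
           (meson abs_ge_self mult_right_mono order_trans zero_le_power less_imp_le)
      moreover have "norm Y \<le> \<bar>C M\<bar> * h powr real N"
      proof -
        have "norm Y \<le> C M * h powr real M" using elim(2) h by (simp add: Y_def powr_realpow)
        also have "\<dots> \<le> \<bar>C M\<bar> * h powr real N" using h NM by (intro mult_mono powr_mono') auto
        finally show ?thesis .
      qed
      moreover have "norm U \<le> ?Da * h powr real N"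
        unfolding U_def by (rule trunc_diff_bound[OF A(1) _ elim(3)]) (use NM in simp)
      moreover have "norm (?e * V) \<le> ?Db * h powr real N"
        unfolding norm_cis_mult V_def by (rule trunc_diff_bound[OF A(1) _ elim(3)]) (use NM in simp)
      moreover have "norm ((Y - X) + (U + ?e * V)) \<le> (norm Y + norm X) + (norm U + norm (?e * V))"
        by (intro order_trans[OF norm_triangle_ineq] add_mono norm_triangle_ineq norm_triangle_ineq4)
      ultimately show ?case unfolding eq by (simp only: distrib_right)
    qed
    then have "\<forall>\<alpha>\<in>{\<alpha>\<in>A. \<alpha> < real N}. a N \<alpha> - a M \<alpha> = 0 \<and> b N \<alpha> - b M \<alpha> = 0"
      unfolding trunc_def
      by (intro oscillating_coefficients_zero[OF s finite_exponents_below[OF A(1)]]) auto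
    then show ?thesis using \<alpha> by simp
  qed
  \<comment> \<open>The least natural number above \<alpha>: the first truncation order at which
    this coefficient occurs.\<close>
  define n where "n \<alpha> = nat \<lfloor>\<alpha>\<rfloor> + 1" for \<alpha> :: real
  define a' where "a' \<alpha> = a (n \<alpha>) \<alpha>" for \<alpha>
  define b' where "b' \<alpha> = b (n \<alpha>) \<alpha>" for \<alpha>
  have n: "\<alpha> < real (n \<alpha>)" "n \<alpha> \<le> N" if "\<alpha> \<in> A" "\<alpha> < real N" for \<alpha> N
  proof -
    have "\<alpha> \<ge> 0" using that A(2) by auto
    then show "\<alpha> < real (n \<alpha>)" "n \<alpha> \<le> N" using that(2) unfolding n_def by linarith+
  qed
  have tr: "trunc A (real N) a' h = trunc A (real N) (a N) h" "trunc A (real N) b' h = trunc A (real N) (b N) h" for N h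
    unfolding trunc_def a'_def b'_def using agree[OF n(2) _ n(1)] by (auto intro!: sum.cong)
  obtain G where G: "has_asymp A G b'" using borel_summation[OF A(1,2)] by blast
  \<comment> \<open>Taken as the rest, so the splitting is exact. \<open>F\<close> expands because
    \<open>G\<close> has the coefficients that occur in the truncated splittings of
    \<open>f\<close>.\<close>
  define F where "F h = f h - cis (s / h) * G h" for h
  have F: "has_asymp A F a'"
  proof (rule has_asymp_natI[OF A(1)])
    fix N :: nat
    obtain D where D: "\<forall>\<^sub>F h in at_right 0. norm (G h - trunc A (real N) b' h) \<le> D * h powr real N"
      using G unfolding has_asymp_def by (meson of_nat_0_le_iff)
    have "\<forall>\<^sub>F h in at_right 0. norm (F h - trunc A (real N) a' h) \<le> (C N + D) * h ^ N"
      using abC[rule_format, of N] D eventually_unit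
    proof eventually_elim
      case (elim h)
      define X where "X = f h - (trunc A (real N) (a N) h + cis (s / h) * trunc A (real N) (b N) h)"
      define Y where "Y = G h - trunc A (real N) (b N) h"
      have "F h - trunc A (real N) a' h = X - cis (s / h) * Y"
        by (simp add: F_def tr X_def Y_def algebra_simps)
      then have "norm (F h - trunc A (real N) a' h) \<le> norm X + norm Y"
        using norm_triangle_ineq4[of X "cis (s / h) * Y"] by simp
      also have "\<dots> \<le> C N * h ^ N + D * h ^ N"
        using elim by (intro add_mono) (auto simp: X_def Y_def tr powr_realpow)
      finally show ?case by (simp add: distrib_right)
    qed
    then show "\<exists>C. \<forall>\<^sub>F h in at_right 0. norm (F h - trunc A (real N) a' h) \<le> C * h ^ N" by blast
  qed
  \<comment> \<open>The limit of \<open>f\<close> forces the constant coefficients to be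
    \<open>v\<close> and 0, which removes the exponent 0 from both expansions.\<close>
  have "((\<lambda>h. (f h - v) - (F h - a' 0) - cis (s / h) * (G h - b' 0)) \<longlongrightarrow> 0) (at_right 0)"
  proof -
    have "((\<lambda>h. G h - b' 0) \<longlongrightarrow> 0) (at_right 0)"
      using has_asymp_limit[OF A G] by (simp add: LIM_zero_iff)
    then have "((\<lambda>h. cis (s / h) * (G h - b' 0)) \<longlongrightarrow> 0) (at_right 0)"
      by (simp add: tendsto_norm_zero_iff[symmetric, of "\<lambda>h. cis (s / h) * (G h - b' 0)"] tendsto_norm_zero_iff)
    moreover have "((\<lambda>h. F h - a' 0) \<longlongrightarrow> 0) (at_right 0)" "((\<lambda>h. f h - v) \<longlongrightarrow> 0) (at_right 0)"
      using has_asymp_limit[OF A F] lim by (simp_all add: LIM_zero_iff)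
    ultimately have "((\<lambda>h. (f h - v) - (F h - a' 0) - cis (s / h) * (G h - b' 0)) \<longlongrightarrow> 0 - 0 - 0) (at_right 0)"
      by (intro tendsto_diff)
    then show ?thesis by simp
  qed
  moreover have "(f h - v) - (F h - a' 0) - cis (s / h) * (G h - b' 0) = (a' 0 - v) + cis (s / h) * b' 0" for h
    by (simp add: F_def algebra_simps)
  ultimately have "((\<lambda>h. (a' 0 - v) + cis (s / h) * b' 0) \<longlongrightarrow> 0) (at_right 0)" by simp
  from oscillating_limit_zero[OF s this] have z: "a' 0 = v" "b' 0 = 0" by auto
  have A': "exponent_set (A - {0})"
    using A(1) unfolding exponent_set_def by (auto intro: bdd_below_mono finite_subset[rotated])
  show thesis
  proof (rule that[of "\<lambda>h. F h - v" G])
    show "f h = v + (F h - v) + cis (s / h) * G h" for h by (simp add: F_def)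
    show "asymp_expansion (A - {0}) (\<lambda>h. F h - v)" "asymp_expansion (A - {0}) G"
      using has_asymp_remove_0[OF A(1,3) F] has_asymp_remove_0[OF A(1,3) G] A' z
      by (auto simp: asymp_expansion_iff)
  qed
qed

section \<open>The transfer matrix\<close>

lemma exponents_insert_0:
  assumes "\<gamma> > 0"
  shows "exponent_set (insert 0 (exponents \<gamma>))" "insert 0 (exponents \<gamma>) \<subseteq> {0..}"
    "insert 0 (exponents \<gamma>) - {0} = exponents \<gamma>"
proof -
  show "insert 0 (exponents \<gamma>) \<subseteq> {0..}" using assms by (auto simp: exponents_def)
  then have "bdd_below (insert 0 (exponents \<gamma>))" by (auto simp: bdd_below_def)
  moreover have "finite (insert 0 (exponents \<gamma>) \<inter> {x..y})" for x y
    using exponent_set_exponents[OF assms] by (simp add: exponent_set_def Int_insert_left)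
  ultimately show "exponent_set (insert 0 (exponents \<gamma>))" by (simp add: exponent_set_def)
  show "insert 0 (exponents \<gamma>) - {0} = exponents \<gamma>" by (auto simp: exponents_def)
qed

text \<open>Written as a combination of matrix units, so that expansions of the entries carry over
  by linearity; the entries are real.\<close>

definition mat4 :: "real \<Rightarrow> real \<Rightarrow> real \<Rightarrow> real \<Rightarrow> complex^2^2" where
  "mat4 a b c d = a *\<^sub>R vector [vector [1, 0], vector [0, 0]] + b *\<^sub>R vector [vector [0, 1], vector [0, 0]] +
     c *\<^sub>R vector [vector [0, 0], vector [1, 0]] + d *\<^sub>R vector [vector [0, 0], vector [0, 1]]"

lemma mat4_nth [simp]:
  "mat4 a b c d $ 1 $ 1 = of_real a" "mat4 a b c d $ 1 $ 2 = of_real b"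
  "mat4 a b c d $ 2 $ 1 = of_real c" "mat4 a b c d $ 2 $ 2 = of_real d"
  by (simp_all add: mat4_def scaleR_conv_of_real[where 'a = complex])

lemma asymp_expansion_mat4:
  assumes "asymp_expansion A a" "asymp_expansion A b" "asymp_expansion A c" "asymp_expansion A d"
  shows "asymp_expansion A (\<lambda>h. mat4 (a h) (b h) (c h) (d h))"
  unfolding mat4_def
  by (intro asymp_expansion_add asymp_expansion_linear[OF _ bounded_linear_scaleR_left] assms)

text \<open>The two wave relations are conjugate in their coefficients. This symmetry makes the
  matrix real in the coordinates (A, B), for complex solutions as well.\<close>

lemma rotate_back:
  fixes A B A0 B0 w1 w2 :: complex
  assumes "A0 + \<i> * B0 = w1 * (A + \<i> * B) + w2 * (A - \<i> * B)"
    and "A0 - \<i> * B0 = cnj w2 * (A + \<i> * B) + cnj w1 * (A - \<i> * B)"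
  shows "A0 = of_real (Re (w1 + cnj w2)) * A - of_real (Im (w1 + cnj w2)) * B"
    and "B0 = of_real (Im (w1 - cnj w2)) * A + of_real (Re (w1 - cnj w2)) * B"
proof -
  define P where "P = w1 + cnj w2"
  define M where "M = w1 - cnj w2"
  have P: "P + cnj P = 2 * of_real (Re P)" "P - cnj P = 2 * \<i> * of_real (Im P)"
    by (simp_all add: complex_eq_iff)
  have M: "M + cnj M = 2 * of_real (Re M)" "M - cnj M = 2 * \<i> * of_real (Im M)"
    by (simp_all add: complex_eq_iff)
  have "2 * A0 = (A0 + \<i> * B0) + (A0 - \<i> * B0)" by simp
  also have "\<dots> = (P + cnj P) * A + \<i> * (P - cnj P) * B"
    unfolding assms P_def by (simp add: algebra_simps)
  also have "\<dots> = 2 * (of_real (Re P) * A - of_real (Im P) * B)"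
    unfolding P by (simp add: algebra_simps)
  finally show "A0 = of_real (Re (w1 + cnj w2)) * A - of_real (Im (w1 + cnj w2)) * B"
    unfolding P_def[symmetric] by (simp only: mult_cancel_left) simp
  have "2 * \<i> * B0 = (A0 + \<i> * B0) - (A0 - \<i> * B0)" by simp
  also have "\<dots> = (M - cnj M) * A + \<i> * (M + cnj M) * B"
    unfolding assms M_def by (simp add: algebra_simps)
  also have "\<dots> = 2 * \<i> * (of_real (Im M) * A + of_real (Re M) * B)"
    unfolding M by (simp add: algebra_simps)
  finally show "B0 = of_real (Im (w1 - cnj w2)) * A + of_real (Re (w1 - cnj w2)) * B"
    unfolding M_def[symmetric] by simp
qed

text \<open>Here amplitudes of exp(i t) and exp(- i t) are resorted into the coefficients of cos t
  and sin t, which become the entries of the two correction matrices.\<close>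

lemma Re_Im_two_phases:
  "Re (cis t * x + cis (- t) * y) = cos t * Re (x + y) + sin t * Im (y - x)"
  "Im (cis t * x + cis (- t) * y) = cos t * Im (x + y) + sin t * Re (x - y)"
  by (simp_all add: algebra_simps)

context irrational_potential
begin

lemma h_powers_trunc:
  assumes "F \<in> sums_of h_powers"
  shows "\<exists>a. \<forall>M::nat. \<exists>C. \<forall>h\<in>{0<..1}. norm (F h - trunc (insert 0 (exponents \<gamma>)) (real M) a h) \<le> C * h ^ M"
  using assms
proof induction
  case sums_of_zero
  show ?case by (intro exI[of _ "\<lambda>_. 0"] allI exI[of _ 0]) (simp add: trunc_def)
next
  case (sums_of_gen f)
  then obtain c m n where f: "f = (\<lambda>h. c * of_real (h powr (real m * \<gamma> + real n)))"
    unfolding h_powers_def by blast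
  define \<mu> where "\<mu> = real m * \<gamma> + real n"
  let ?\<Lambda> = "insert 0 (exponents \<gamma>)"
  let ?a = "\<lambda>\<alpha>. if \<alpha> = \<mu> then c else 0"
  have f': "f = (\<lambda>h. c * of_real (h powr \<mu>))" by (simp add: f \<mu>_def)
  have mu: "\<mu> \<in> ?\<Lambda>" by (auto simp: exponents_def \<mu>_def)
  have "\<exists>C. \<forall>h\<in>{0<..1}. norm (f h - trunc ?\<Lambda> (real M) ?a h) \<le> C * h ^ M" for M :: nat
  proof -
    have fin: "finite {\<alpha>\<in>?\<Lambda>. \<alpha> < real M}"
      by (rule finite_exponents_below[OF exponents_insert_0(1)[OF gamma]])
    have t: "trunc ?\<Lambda> (real M) ?a h = (if \<mu> < real M then (h powr \<mu>) *\<^sub>R c else 0)" for h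
    proof -
      have "trunc ?\<Lambda> (real M) ?a h = (\<Sum>\<alpha>\<in>{\<alpha>\<in>?\<Lambda>. \<alpha> < real M}. if \<alpha> = \<mu> then (h powr \<mu>) *\<^sub>R c else 0)"
        unfolding trunc_def by (intro sum.cong) auto
      then show ?thesis using fin mu by (simp add: sum.delta)
    qed
    have "norm (f h - trunc ?\<Lambda> (real M) ?a h) \<le> norm c * h ^ M" if h: "h \<in> {0<..1}" for h
    proof (cases "\<mu> < real M")
      case True
      then show ?thesis using h by (simp add: t f' scaleR_conv_of_real mult.commute)
    next
      case False
      then have "h powr \<mu> \<le> h powr real M" using h by (intro powr_mono') auto
      then have "norm c * h powr \<mu> \<le> norm c * h ^ M"
        using h by (intro mult_left_mono) (auto simp: powr_realpow)
      then show ?thesis using False by (simp add: t f' norm_mult)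
    qed
    then show ?thesis by blast
  qed
  then show ?case by blast
next
  case (sums_of_add f g)
  let ?\<Lambda> = "insert 0 (exponents \<gamma>)"
  obtain a b where ab: "\<forall>M::nat. \<exists>C. \<forall>h\<in>{0<..1}. norm (f h - trunc ?\<Lambda> (real M) a h) \<le> C * h ^ M"
    "\<forall>M::nat. \<exists>C. \<forall>h\<in>{0<..1}. norm (g h - trunc ?\<Lambda> (real M) b h) \<le> C * h ^ M"
    using sums_of_add.IH by blast
  have "\<exists>C. \<forall>h\<in>{0<..1}. norm (f h + g h - trunc ?\<Lambda> (real M) (\<lambda>\<alpha>. a \<alpha> + b \<alpha>) h) \<le> C * h ^ M" for M :: nat
  proof -
    obtain C D where C: "\<forall>h\<in>{0<..1}. norm (f h - trunc ?\<Lambda> (real M) a h) \<le> C * h ^ M"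
      and D: "\<forall>h\<in>{0<..1}. norm (g h - trunc ?\<Lambda> (real M) b h) \<le> D * h ^ M"
      using ab by blast
    have "norm (f h + g h - trunc ?\<Lambda> (real M) (\<lambda>\<alpha>. a \<alpha> + b \<alpha>) h) \<le> (C + D) * h ^ M" if h: "h \<in> {0<..1}" for h
      using C[rule_format, OF h] D[rule_format, OF h]
        norm_diff_triangle_ineq[of "f h" "g h" "trunc ?\<Lambda> (real M) a h" "trunc ?\<Lambda> (real M) b h"]
      by (simp add: trunc_add distrib_right)
    then show ?thesis by blast
  qed
  then show ?case by blast
qed

lemma ev_splits_exact:
  assumes f: "ev_splits \<zeta> f" and zeta: "\<zeta> \<noteq> 0" and lim: "(f \<longlongrightarrow> v) (at_right 0)"
  obtains F G where "\<And>h. f h = v + F h + cis (2 * \<zeta> * (S b / h)) * G h"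
    "asymp_expansion (exponents \<gamma>) F" "asymp_expansion (exponents \<gamma>) G"
proof -
  let ?\<Lambda> = "insert 0 (exponents \<gamma>)" and ?s = "2 * \<zeta> * S b"
  have s: "?s \<noteq> 0" using zeta S_pos[of b] b by simp
  have tr: "\<exists>a b' C. \<forall>\<^sub>F h in at_right 0.
      norm (f h - (trunc ?\<Lambda> (real N) a h + cis (?s / h) * trunc ?\<Lambda> (real N) b' h)) \<le> C * h ^ N" for N :: nat
  proof -
    obtain A B C where AB: "A \<in> sums_of h_powers" "B \<in> sums_of h_powers"
      and C: "\<forall>\<^sub>F h in at_right 0. norm (f h - (A h + cis (2 * \<zeta> * (S b / h)) * B h)) \<le> C * h ^ N"
      using f[unfolded ev_splits_def, rule_format, of N] by (elim bexE exE)
    obtain a where a: "\<forall>M::nat. \<exists>C. \<forall>h\<in>{0<..1}. norm (A h - trunc ?\<Lambda> (real M) a h) \<le> C * h ^ M"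
      using h_powers_trunc[OF AB(1)] by (elim exE)
    obtain b' where b': "\<forall>M::nat. \<exists>C. \<forall>h\<in>{0<..1}. norm (B h - trunc ?\<Lambda> (real M) b' h) \<le> C * h ^ M"
      using h_powers_trunc[OF AB(2)] by (elim exE)
    obtain Ca where Ca: "\<forall>h\<in>{0<..1}. norm (A h - trunc ?\<Lambda> (real N) a h) \<le> Ca * h ^ N"
      using a[rule_format, of N] by (elim exE)
    obtain Cb where Cb: "\<forall>h\<in>{0<..1}. norm (B h - trunc ?\<Lambda> (real N) b' h) \<le> Cb * h ^ N"
      using b'[rule_format, of N] by (elim exE)
    have "\<forall>\<^sub>F h in at_right 0.
      norm (f h - (trunc ?\<Lambda> (real N) a h + cis (?s / h) * trunc ?\<Lambda> (real N) b' h)) \<le> (C + Ca + Cb) * h ^ N"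
      using C eventually_unit
    proof eventually_elim
      case (elim h)
      define e where "e = cis (?s / h)"
      have e: "cis (2 * \<zeta> * (S b / h)) = e" by (simp add: e_def)
      have "f h - (trunc ?\<Lambda> (real N) a h + e * trunc ?\<Lambda> (real N) b' h) = (f h - (A h + e * B h)) +
          (A h - trunc ?\<Lambda> (real N) a h) + e * (B h - trunc ?\<Lambda> (real N) b' h)"
        by (simp add: algebra_simps)
      moreover have "norm (x + y + z) \<le> norm x + norm y + norm z" for x y z :: complex
        by (intro order_trans[OF norm_triangle_ineq] add_mono norm_triangle_ineq order_refl)
      ultimately have "norm (f h - (trunc ?\<Lambda> (real N) a h + e * trunc ?\<Lambda> (real N) b' h)) \<le>
          norm (f h - (A h + e * B h)) + norm (A h - trunc ?\<Lambda> (real N) a h) +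
          norm (e * (B h - trunc ?\<Lambda> (real N) b' h))"
        by (simp only:)
      also have "\<dots> \<le> C * h ^ N + Ca * h ^ N + Cb * h ^ N"
        using elim(1)[unfolded e] Ca[rule_format, OF elim(2)] Cb[rule_format, OF elim(2)]
        by (intro add_mono) (auto simp: e_def)
      finally show ?case by (simp add: e_def distrib_right)
    qed
    then show ?thesis by (intro exI)
  qed
  obtain F G where FG: "\<And>h. f h = v + F h + cis (?s / h) * G h"
    "asymp_expansion (?\<Lambda> - {0}) F" "asymp_expansion (?\<Lambda> - {0}) G"
    using exact_splitting[OF exponents_insert_0(1,2)[OF gamma] _ s tr lim] by blast
  show thesis
    by (rule that[of F G]) (use FG in \<open>simp_all add: exponents_insert_0(3)[OF gamma]\<close>)
qed

lemma transfer_matrix: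
  "\<exists>Ap Am. asymp_expansion (exponents \<gamma>) Ap \<and> asymp_expansion (exponents \<gamma>) Am \<and>
     (\<forall>\<^sub>F h in at_right 0. \<forall>\<phi> d\<phi>. schrodinger_solution V b E h \<phi> d\<phi> \<longrightarrow>
        scaled_data E h (\<phi> 0) (d\<phi> 0) =
          (propagation_rotation (action V b E / h)
             + cos (action V b E / h) *\<^sub>R Ap h + sin (action V b E / h) *\<^sub>R Am h)
          *v scaled_data (E - V b) h (\<phi> b) (d\<phi> b))"
proof -
  obtain a1 b1 where 1: "\<And>h. sol h b = 1 + a1 h + cis (2 * 1 * (S b / h)) * b1 h"
    "asymp_expansion (exponents \<gamma>) a1" "asymp_expansion (exponents \<gamma>) b1"
    by (rule ev_splits_exact[OF sol_asymptotics(1) _ sol_asymptotics(3)]) (simp, blast)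
  obtain c1 d1 where 2: "\<And>h. sol' h b = 0 + c1 h + cis (2 * (-1) * (S b / h)) * d1 h"
    "asymp_expansion (exponents \<gamma>) c1" "asymp_expansion (exponents \<gamma>) d1"
    by (rule ev_splits_exact[OF sol_asymptotics(2) _ sol_asymptotics(4)]) (simp, blast)
  \<comment> \<open>\<open>P1\<close>, \<open>P2\<close> are the amplitudes of exp(i t), exp(- i t)
    in w1 + cnj w2, and \<open>P3\<close>, \<open>P4\<close> those in w1 - cnj w2; the leading 1,
    removed here, yields the rotation.\<close>
  define P1 where "P1 h = cnj (a1 h) - c1 h" for h
  define P2 where "P2 h = cnj (b1 h) - d1 h" for h
  define P3 where "P3 h = cnj (a1 h) + c1 h" for h
  define P4 where "P4 h = cnj (b1 h) + d1 h" for h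
  define Ap where "Ap h = mat4 (Re (P1 h + P2 h)) (- Im (P1 h + P2 h)) (Im (P3 h + P4 h)) (Re (P3 h + P4 h))" for h
  define Am where "Am h = mat4 (Im (P2 h - P1 h)) (- Re (P1 h - P2 h)) (Re (P3 h - P4 h)) (Im (P4 h - P3 h))" for h
  have P: "asymp_expansion (exponents \<gamma>) P1" "asymp_expansion (exponents \<gamma>) P2"
    "asymp_expansion (exponents \<gamma>) P3" "asymp_expansion (exponents \<gamma>) P4"
    unfolding P1_def P2_def P3_def P4_def
    by (intro asymp_expansion_diff asymp_expansion_add asymp_expansion_linear[OF _ bounded_linear_cnj] 1 2)+
  have "asymp_expansion (exponents \<gamma>) Ap" "asymp_expansion (exponents \<gamma>) Am"
    unfolding Ap_def Am_def
    by (intro asymp_expansion_mat4 asymp_expansion_minus asymp_expansion_linear[OF _ bounded_linear_Re]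
        asymp_expansion_linear[OF _ bounded_linear_Im] asymp_expansion_diff asymp_expansion_add P)+
  moreover have "\<forall>\<^sub>F h in at_right 0. \<forall>\<phi> d\<phi>. schrodinger_solution V b E h \<phi> d\<phi> \<longrightarrow>
        scaled_data E h (\<phi> 0) (d\<phi> 0) =
          (propagation_rotation (action V b E / h)
             + cos (action V b E / h) *\<^sub>R Ap h + sin (action V b E / h) *\<^sub>R Am h)
          *v scaled_data (E - V b) h (\<phi> b) (d\<phi> b)"
    using sol_asymptotics(5)
  proof eventually_elim
    case (elim h)
    then have h: "h \<in> {0<..1}" "admissible 2 (sol h)" "\<forall>x\<in>{0..b}. sol h x = 1 + osc_int 1 h (sol' h) x"
      by auto
    show ?case
    proof (intro allI impI)
      fix \<phi> d\<phi> assume sch: "schrodinger_solution V b E h \<phi> d\<phi>"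
      define t where "t = S b / h"
      have act: "action V b E / h = t"
        unfolding action_def t_def S_def p_def[abs_def] by simp
      define A where "A = complex_of_real ((E - V b) powr (1/4)) * \<phi> b"
      define B where "B = complex_of_real ((E - V b) powr (- 1/4) * h) * d\<phi> b"
      define A0 where "A0 = complex_of_real (E powr (1/4)) * \<phi> 0"
      define B0 where "B0 = complex_of_real (E powr (- 1/4) * h) * d\<phi> 0"
      have wave: "wave 1 h \<phi> d\<phi> 0 = A0 + \<i> * B0" "wave (-1) h \<phi> d\<phi> 0 = A0 - \<i> * B0"
        "wave 1 h \<phi> d\<phi> b = A + \<i> * B" "wave (-1) h \<phi> d\<phi> b = A - \<i> * B"
        by (simp_all add: wave_def V_0 A_def B_def A0_def B0_def)
      define w1 where "w1 = cis t * cnj (sol h b)"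
      define w2 where "w2 = - (cis (- t) * cnj (sol' h b))"
      have "A0 + \<i> * B0 = w1 * (A + \<i> * B) + w2 * (A - \<i> * B)"
        using transfer(1)[OF h sch] unfolding wave w1_def w2_def t_def by simp
      moreover have "A0 - \<i> * B0 = cnj w2 * (A + \<i> * B) + cnj w1 * (A - \<i> * B)"
        using transfer(2)[OF h sch] unfolding wave w1_def w2_def t_def by (simp add: cis_cnj)
      ultimately have AB: "A0 = of_real (Re (w1 + cnj w2)) * A - of_real (Im (w1 + cnj w2)) * B"
        "B0 = of_real (Im (w1 - cnj w2)) * A + of_real (Re (w1 - cnj w2)) * B"
        by (rule rotate_back)+
      \<comment> \<open>The phase exp(-2 i t), from cnj sol and from sol', meets the factor exp(i t)
        of the transfer formula and becomes exp(- i t); no third harmonic appears.\<close>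
      have c2: "cis t * cis (- (2 * t)) = cis (- t)" by (simp add: cis_mult)
      have e1: "w1 = cis t * (1 + cnj (a1 h)) + (cis t * cis (- (2 * t))) * cnj (b1 h)"
        unfolding w1_def 1(1) t_def[symmetric] by (simp add: cis_cnj distrib_left mult.assoc)
      have e2: "cnj w2 = - (cis t * c1 h + (cis t * cis (- (2 * t))) * d1 h)"
        unfolding w2_def 2(1) t_def[symmetric] by (simp add: cis_cnj distrib_left mult.assoc)
      have w: "w1 + cnj w2 = cis t * (1 + P1 h) + cis (- t) * P2 h"
        "w1 - cnj w2 = cis t * (1 + P3 h) + cis (- t) * P4 h"
        unfolding e1 e2 c2 P1_def P2_def P3_def P4_def by (simp_all add: algebra_simps)
      have "vector [A0, B0] = (propagation_rotation t + cos t *\<^sub>R Ap h + sin t *\<^sub>R Am h) *v vector [A, B]"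
        unfolding vec_eq_iff forall_2 AB w Re_Im_two_phases
        by (simp add: matrix_vector_mult_def sum_2 propagation_rotation_def Ap_def Am_def
            scaleR_conv_of_real[where 'a = complex] algebra_simps)
      then show "scaled_data E h (\<phi> 0) (d\<phi> 0) =
          (propagation_rotation (action V b E / h)
             + cos (action V b E / h) *\<^sub>R Ap h + sin (action V b E / h) *\<^sub>R Am h)
          *v scaled_data (E - V b) h (\<phi> b) (d\<phi> b)"
        unfolding act scaled_data_def A_def B_def A0_def B0_def .
    qed
  qed
  ultimately show ?thesis by blast
qed

end

theorem theorem1:
  fixes \<gamma> b \<delta>\<^sub>0 :: real and V W :: "real \<Rightarrow> real" and K :: "real set"
  assumes "\<gamma> > 0" and "\<gamma> \<notin> \<rat>" and "b > 0"
    and "continuous_on {0..b} V" and "smooth_on {0<..b} V" and "mono_on {0<..b} V"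
    and "V 0 = 0"
    and "\<And>x. x \<in> {0<..b} \<Longrightarrow> V x = x powr \<gamma> * W x"
    and "smooth_on {0..b} W" and "\<And>x. x \<in> {0..b} \<Longrightarrow> W x > 0"
    and "compact K" and "is_interval K" and "K \<subseteq> {0<..}"
    and "\<delta>\<^sub>0 > 0" and "\<And>E x. E \<in> K \<Longrightarrow> x \<in> {0..b} \<Longrightarrow> E - V x \<ge> \<delta>\<^sub>0"
  shows "\<exists>Ap Am :: real \<Rightarrow> real \<Rightarrow> complex^2^2. \<forall>E\<in>K.
           asymp_expansion (exponents \<gamma>) (\<lambda>h. Ap h E) \<and>
           asymp_expansion (exponents \<gamma>) (\<lambda>h. Am h E) \<and>
           (\<forall>\<^sub>F h in at_right 0. \<forall>\<phi> d\<phi>. schrodinger_solution V b E h \<phi> d\<phi> \<longrightarrow>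
              scaled_data E h (\<phi> 0) (d\<phi> 0) =
                (propagation_rotation (action V b E / h)
                   + cos (action V b E / h) *\<^sub>R Ap h E
                   + sin (action V b E / h) *\<^sub>R Am h E)
                *v scaled_data (E - V b) h (\<phi> b) (d\<phi> b))"
proof -
  obtain dW where dW: "\<And>x. x \<in> {0..b} \<Longrightarrow> dW 0 x = W x"
    "\<And>n x. x \<in> {0..b} \<Longrightarrow> (dW n has_real_derivative dW (Suc n) x) (at x within {0..b})"
    using assms(9) unfolding smooth_on_def by blast
  let ?P = "\<lambda>E Ap Am. asymp_expansion (exponents \<gamma>) Ap \<and> asymp_expansion (exponents \<gamma>) Am \<and>
     (\<forall>\<^sub>F h in at_right 0. \<forall>\<phi> d\<phi>. schrodinger_solution V b E h \<phi> d\<phi> \<longrightarrow>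
        scaled_data E h (\<phi> 0) (d\<phi> 0) =
          (propagation_rotation (action V b E / h)
             + cos (action V b E / h) *\<^sub>R Ap h + sin (action V b E / h) *\<^sub>R Am h)
          *v scaled_data (E - V b) h (\<phi> b) (d\<phi> b))"
  have "\<forall>E\<in>K. \<exists>T. ?P E (fst T) (snd T)"
  proof
    fix E assume E: "E \<in> K"
    interpret irrational_potential \<gamma> b E \<delta>\<^sub>0 V W dW
      by unfold_locales (use assms dW E in auto)
    obtain Ap Am where "?P E Ap Am" using transfer_matrix by (elim exE)
    then show "\<exists>T. ?P E (fst T) (snd T)" by (intro exI[of _ "(Ap, Am)"]) simp
  qed
  \<comment> \<open>The matrices are chosen separately for each energy, as the expansions are
    claimed pointwise in E.\<close>
  from bchoice[OF this] obtain T where "\<forall>E\<in>K. ?P E (fst (T E)) (snd (T E))" by (elim exE)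
  then show ?thesis
    by (intro exI[of _ "\<lambda>h E. fst (T E) h"] exI[of _ "\<lambda>h E. snd (T E) h"])
qed

end
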